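(* There is a randomized algorithm that, given an $n$-vertex graph $G$ with maximum degree $\Delta$, computes a maximal independent set of $G$ with high probability in $O(\log\log \Delta)$ rounds of the MPC model with $\tilde{O}(n)$ bits of memory per machine. Moreover, the same algorithm can be adapted to compute a maximal independent set of $G$ in $O(\log\log\Delta)$ rounds of the $\mathsf{CONGESTED}$-$\mathsf{CLIQUE}$ model.
   Context: An independent set of a graph $G=(V,E)$ is a set $I\subseteq V$ of pairwise non-adjacent vertices; it is maximal if no vertex $v\in V\setminus I$ can be added to $I$ keeping it independent. MPC (Massively Parallel Computation) model: computation proceeds in synchronous rounds carried out by machines, each with a bounded local memory $S$ (here $S=\tilde{O}(n)$ bits, i.e. $n\cdot\mathrm{polylog}(n)$ bits) and total memory proportional to the input size; the input (vertices and edges) is distributed across machines; in each round each machine performs arbitrary local computation and then machines exchange messages, where each machine sends and receives in total at most as much data as fits in its memory. $\mathsf{CONGESTED}$-$\mathsf{CLIQUE}$ model: there are $n$ players, one per vertex of $G$, each initially knowing only the edges incident to its vertex; in each synchronous round every player may send a (possibly different) message of $O(\log n)$ bits to every other player; at the end each player must know whether its vertex is in the output set. $\tilde{O}(\cdot)$ hides polylogarithmic factors in $n$. "With high probability" means with probability at least $1-1/\mathrm{poly}(n)$. *)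

theory Defs
  imports "HOL-Probability.Probability" "HOL-Library.Landau_Symbols"
begin

section \<open>Simple graphs on the vertex set \<open>{..<n}\<close>\<close>

definition simple_graph :: "nat \<Rightarrow> nat set set \<Rightarrow> bool" where
  "simple_graph n E \<longleftrightarrow> (\<forall>e\<in>E. e \<subseteq> {..<n} \<and> card e = 2)"

definition neighbors :: "nat set set \<Rightarrow> nat \<Rightarrow> nat set" where
  "neighbors E v = {u. {u, v} \<in> E}"

text \<open>Only meaningful for \<open>n \<ge> 1\<close>.\<close>

definition max_degree :: "nat \<Rightarrow> nat set set \<Rightarrow> nat" where
  "max_degree n E = Max ((\<lambda>v. card (neighbors E v)) ` {..<n})"

definition independent_set :: "nat \<Rightarrow> nat set set \<Rightarrow> nat set \<Rightarrow> bool" where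
  "independent_set n E I \<longleftrightarrow> I \<subseteq> {..<n} \<and> (\<forall>u\<in>I. \<forall>v\<in>I. {u, v} \<notin> E)"

definition maximal_independent_set :: "nat \<Rightarrow> nat set set \<Rightarrow> nat set \<Rightarrow> bool" where
  "maximal_independent_set n E I \<longleftrightarrow>
     independent_set n E I \<and> (\<forall>v\<in>{..<n} - I. \<not> independent_set n E (insert v I))"


section \<open>Randomized synchronous message passing\<close>

type_synonym bits = "bool list"

text \<open>
  A protocol for machines \<open>0, \<dots>, k - 1\<close> on graphs with \<open>n\<close> vertices. The first three arguments of
  every component are \<open>n\<close>, \<open>k\<close> and the index of the executing machine, which are all that a
  machine knows besides its local input. Local computation is arbitrary, and coins are private and
  independent.
    \<^item> \<open>start\<close> turns the local input into the initial state.
    \<^item> \<open>send\<close> gives the message to machine \<open>j\<close>; the empty string stands for no message. It is a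
      function of the state, so that random choices have to be made in the preceding local
      computation.
    \<^item> \<open>update\<close> computes the next state from the current one and the received messages,
      indexed by the sender.
    \<^item> \<open>result\<close> is \<open>None\<close> while the machine is running and \<open>Some\<close> of its output once it has
      halted.
\<close>

record ('i, 'o) protocol =
  start :: "nat \<Rightarrow> nat \<Rightarrow> nat \<Rightarrow> 'i \<Rightarrow> bits pmf"
  send :: "nat \<Rightarrow> nat \<Rightarrow> nat \<Rightarrow> bits \<Rightarrow> nat \<Rightarrow> bits"
  update :: "nat \<Rightarrow> nat \<Rightarrow> nat \<Rightarrow> bits \<Rightarrow> (nat \<Rightarrow> bits) \<Rightarrow> bits pmf"
  result :: "nat \<Rightarrow> nat \<Rightarrow> nat \<Rightarrow> bits \<Rightarrow> 'o option"

text \<open>The states of all machines.\<close>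

type_synonym config = "nat \<Rightarrow> bits"

definition halted :: "('i, 'o) protocol \<Rightarrow> nat \<Rightarrow> nat \<Rightarrow> config \<Rightarrow> nat \<Rightarrow> bool" where
  "halted A n k s i \<longleftrightarrow> result A n k i (s i) \<noteq> None"

text \<open>The message from machine \<open>i\<close> to machine \<open>j\<close> in the round that starts in configuration \<open>s\<close>.\<close>

definition message :: "('i, 'o) protocol \<Rightarrow> nat \<Rightarrow> nat \<Rightarrow> config \<Rightarrow> nat \<Rightarrow> nat \<Rightarrow> bits" where
  "message A n k s i j =
     (if i < k \<and> j < k \<and> \<not> halted A n k s i then send A n k i (s i) j else [])"

definition initial :: "('i, 'o) protocol \<Rightarrow> nat \<Rightarrow> nat \<Rightarrow> (nat \<Rightarrow> 'i) \<Rightarrow> config pmf" where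
  "initial A n k inp = Pi_pmf {..<k} [] (\<lambda>i. start A n k i (inp i))"

definition round_step :: "('i, 'o) protocol \<Rightarrow> nat \<Rightarrow> nat \<Rightarrow> config \<Rightarrow> config pmf" where
  "round_step A n k s = Pi_pmf {..<k} []
     (\<lambda>i. if halted A n k s i then return_pmf (s i)
          else update A n k i (s i) (\<lambda>j. message A n k s j i))"

text \<open>
  The resource limits of a model are a predicate \<open>ok\<close> on configurations. A run that violates them
  crashes: it ends in \<open>None\<close>, which never counts as a success.
\<close>

definition limit :: "(config \<Rightarrow> bool) \<Rightarrow> config \<Rightarrow> config option" where
  "limit ok s = (if ok s then Some s else None)"

fun run :: "('i, 'o) protocol \<Rightarrow> (config \<Rightarrow> bool) \<Rightarrow> nat \<Rightarrow> nat \<Rightarrow> (nat \<Rightarrow> 'i) \<Rightarrow> nat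
    \<Rightarrow> config option pmf" where
  "run A ok n k inp 0 = map_pmf (limit ok) (initial A n k inp)"
| "run A ok n k inp (Suc r) = bind_pmf (run A ok n k inp r)
     (\<lambda>x. case x of None \<Rightarrow> return_pmf None
                  | Some s \<Rightarrow> map_pmf (limit ok) (round_step A n k s))"


section \<open>The MPC model\<close>

text \<open>Bits to write down an element of \<open>{..<n}\<close>; at least \<open>1\<close> if \<open>n \<ge> 1\<close>.\<close>

definition id_bits :: "nat \<Rightarrow> nat" where
  "id_bits n = nat \<lceil>log 2 (real n + 1)\<rceil>"

text \<open>The size in bits of a list of \<open>a\<close> vertices and \<open>b\<close> edges.\<close>

definition input_bits :: "nat \<Rightarrow> nat \<Rightarrow> nat \<Rightarrow> nat" where
  "input_bits n a b = (a + 2 * b) * id_bits n"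

text \<open>
  The input is spread over the \<open>k\<close> machines by arbitrary functions \<open>pv\<close> on vertices and \<open>pe\<close> on
  edges. Machine \<open>i\<close> gets the following vertices and edges.
\<close>

definition mpc_input ::
  "nat \<Rightarrow> nat set set \<Rightarrow> (nat \<Rightarrow> nat) \<Rightarrow> (nat set \<Rightarrow> nat) \<Rightarrow> nat \<Rightarrow> nat set \<times> nat set set" where
  "mpc_input n E pv pe i = ({v. v < n \<and> pv v = i}, {e\<in>E. pe e = i})"

definition mpc_placement ::
  "nat \<Rightarrow> nat \<Rightarrow> nat \<Rightarrow> nat set set \<Rightarrow> (nat \<Rightarrow> nat) \<Rightarrow> (nat set \<Rightarrow> nat) \<Rightarrow> bool" where
  "mpc_placement S n k E pv pe \<longleftrightarrow>
     (\<forall>v<n. pv v < k) \<and> (\<forall>e\<in>E. pe e < k) \<and>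
     (\<forall>i<k. input_bits n (card (fst (mpc_input n E pv pe i)))
                         (card (snd (mpc_input n E pv pe i))) \<le> S)"

text \<open>The state, the data sent and the data received by each machine fit in \<open>S\<close> bits.\<close>

definition mpc_ok ::
  "(nat set \<times> nat set set, nat set) protocol \<Rightarrow> nat \<Rightarrow> nat \<Rightarrow> nat \<Rightarrow> config \<Rightarrow> bool" where
  "mpc_ok A S n k s \<longleftrightarrow> (\<forall>i<k. length (s i) \<le> S \<and>
     (\<Sum>j<k. length (message A n k s i j)) \<le> S \<and>
     (\<Sum>j<k. length (message A n k s j i)) \<le> S)"

text \<open>All machines have halted, and the sets that they output make up a MIS.\<close>

definition mpc_success ::
  "(nat set \<times> nat set set, nat set) protocol \<Rightarrow> nat \<Rightarrow> nat \<Rightarrow> nat set set \<Rightarrow> config \<Rightarrow> bool" where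
  "mpc_success A n k E s \<longleftrightarrow> (\<forall>i<k. halted A n k s i) \<and>
     maximal_independent_set n E (\<Union>i<k. the (result A n k i (s i)))"

text \<open>The probability that \<open>A\<close> has computed a MIS within \<open>r\<close> rounds.\<close>

definition mpc_mis_prob ::
  "(nat set \<times> nat set set, nat set) protocol \<Rightarrow> nat \<Rightarrow> nat \<Rightarrow> nat \<Rightarrow> nat set set
    \<Rightarrow> (nat \<Rightarrow> nat) \<Rightarrow> (nat set \<Rightarrow> nat) \<Rightarrow> nat \<Rightarrow> real" where
  "mpc_mis_prob A S n k E pv pe r =
     measure_pmf.prob (run A (mpc_ok A S n k) n k (mpc_input n E pv pe) r)
       (Some ` {s. mpc_success A n k E s})"

text \<open>
  \<open>M n m\<close> machines with \<open>S n\<close> bits each suffice to hold any graph with \<open>n\<close> vertices and \<open>m\<close> edges,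
  and their total memory is linear in the input size. The second summand on the right-hand side
  allows for rounding up to a whole number of machines.
\<close>

definition mpc_machines :: "(nat \<Rightarrow> nat) \<Rightarrow> (nat \<Rightarrow> nat \<Rightarrow> nat) \<Rightarrow> bool" where
  "mpc_machines S M \<longleftrightarrow>
     (\<forall>n\<ge>1. \<forall>E. simple_graph n E \<longrightarrow> (\<exists>pv pe. mpc_placement (S n) n (M n (card E)) E pv pe)) \<and>
     (\<exists>K. \<forall>n\<ge>1. \<forall>m\<le>n choose 2. M n m * S n \<le> K * (input_bits n n m + S n))"


section \<open>The CONGESTED-CLIQUE model\<close>

text \<open>Each message has at most \<open>b\<close> bits; player \<open>v\<close> is the vertex \<open>v\<close>, and its input is the set
  of its neighbors.\<close>

definition clique_ok :: "(nat set, bool) protocol \<Rightarrow> nat \<Rightarrow> nat \<Rightarrow> config \<Rightarrow> bool" where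
  "clique_ok A b n s \<longleftrightarrow> (\<forall>i<n. \<forall>j<n. length (message A n n s i j) \<le> b)"

definition clique_success ::
  "(nat set, bool) protocol \<Rightarrow> nat \<Rightarrow> nat set set \<Rightarrow> config \<Rightarrow> bool" where
  "clique_success A n E s \<longleftrightarrow> (\<forall>i<n. halted A n n s i) \<and>
     maximal_independent_set n E {v. v < n \<and> result A n n v (s v) = Some True}"

definition clique_mis_prob ::
  "(nat set, bool) protocol \<Rightarrow> nat \<Rightarrow> nat \<Rightarrow> nat set set \<Rightarrow> nat \<Rightarrow> real" where
  "clique_mis_prob A b n E r =
     measure_pmf.prob (run A (clique_ok A b n) n n (neighbors E) r)
       (Some ` {s. clique_success A n E s})"

end

theory Submission
  imports Defs "HOL-Real_Asymp.Real_Asymp"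
begin

text \<open>
  Sequential greedy MIS is run on a random order, namely on \<open>n\<close> independent uniform vertices followed
  by all vertices, and the order is processed in few batches: in each stage the machines agree on the
  longest prefix whose alive vertices span \<open>O(n)\<close> edges, all machines learn these edges, and every
  machine computes the greedy choices of the batch by itself. So the protocol never exceeds its
  resources and never errs; only the number of stages is random.

  After \<open>r\<close> picks, with high probability, the alive graph has maximum degree \<open>O(n log n / r)\<close> and
  \<open>O(n\<^sup>2 / r)\<close> edges: a pick removes \<open>(\<Sum>v. deg v ^ 2) / n\<close> pairs on average, so \<open>1 / edges\<close> grows by
  about \<open>1 / n\<^sup>2\<close> per step, and exponential moments give concentration because the degrees bound
  the increments. Hence a batch that ends at \<open>\<surd>(n r)\<close> spans \<open>O(n)\<close> edges. Starting from \<open>n / \<Delta>\<close>, the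
  distance \<open>n / r\<close> is replaced by its square root in each stage, which takes \<open>O(log log \<Delta>)\<close> stages
  until \<open>r = n / 2\<close>; then all remaining edges fit into one more batch.

  In both models a vector of \<open>O(n)\<close> words can be summed over the machines in two rounds, and a stage
  consists of four such summations. In the MPC model an input that fills its machine is
  stored as a set of edges, which takes fewer bits than a list; this makes room for the rest of the
  state.
\<close>


section \<open>Supermartingales on random sequences\<close>

text \<open>Drawing picks with replacement makes each pick uniform whatever the history, so every
  concentration bound reduces to an average over the \<open>n\<close> values of the next pick. A
  vertex may then be missed by the sample, which the appended list of all vertices repairs. Edge
  counts need a degree bound first: the loss of pairs that a pick guarantees must be bounded, here
  by \<open>D\<^sup>2\<close>, before exponential moments apply. Hence half of the picks so far
  serve to lower the degrees and the other half to lower the edge count. The degree bound carries a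
  factor \<open>ln n\<close>, but within a batch it enters only through an additive deviation of
  order \<open>n (ln n)\<^sup>2 / r\<close>, which is below \<open>n\<close> for large
  \<open>n\<close> once \<open>r\<close> is about \<open>sqrt n\<close>. So batches lose no
  logarithm, and prescribed batches may start at \<open>sqrt n\<close>, since that many picks span
  at most \<open>n\<close> pairs anyway. The machines know neither \<Delta> nor the prescribed
  positions. Taking the longest affordable prefix is enough because the alive set only shrinks:
  being ahead of the schedule never makes the next prescribed position more expensive.\<close>

definition seqs :: "nat \<Rightarrow> nat \<Rightarrow> nat list set" where
  "seqs n m = {xs. set xs \<subseteq> {..<n} \<and> length xs = m}"

text \<open>Probability as a count over \<open>n ^ m\<close> equally likely lists. It meets the
  distribution of a protocol run in \<open>prob_run\<close>.\<close>

definition freq :: "nat \<Rightarrow> nat \<Rightarrow> (nat list \<Rightarrow> bool) \<Rightarrow> real" where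
  "freq n m Q = real (card {xs \<in> seqs n m. Q xs}) / real n ^ m"

lemma finite_seqs [simp]: "finite (seqs n m)"
  unfolding seqs_def by (rule finite_lists_length_eq) simp

lemma card_seqs: "card (seqs n m) = n ^ m"
  unfolding seqs_def by (subst card_lists_length_eq) simp_all

lemma seqs_0 [simp]: "seqs n 0 = {[]}"
  by (auto simp: seqs_def)

lemma sum_seqs_Suc: "(\<Sum>xs\<in>seqs n (Suc m). f xs) = (\<Sum>xs\<in>seqs n m. \<Sum>x<n. f (x # xs))"
proof -
  have "seqs n (Suc m) = (\<lambda>(xs, x). x # xs) ` (seqs n m \<times> {..<n})"
    by (auto simp: seqs_def length_Suc_conv image_iff)
  moreover have "inj_on (\<lambda>(xs, x). x # xs) (seqs n m \<times> {..<n})"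
    by (auto simp: inj_on_def)
  ultimately show ?thesis
    by (simp add: sum.reindex sum.cartesian_product case_prod_unfold comp_def)
qed

lemma seqs_append: "seqs n (b + m) = (\<lambda>(ys, zs). ys @ zs) ` (seqs n b \<times> seqs n m)"
proof (intro equalityI subsetI)
  fix xs assume xs: "xs \<in> seqs n (b + m)"
  have "xs = (\<lambda>(ys, zs). ys @ zs) (take b xs, drop b xs)" by simp
  moreover have "(take b xs, drop b xs) \<in> seqs n b \<times> seqs n m"
    using xs set_take_subset[of b xs] set_drop_subset[of b xs] by (auto simp: seqs_def)
  ultimately show "xs \<in> (\<lambda>(ys, zs). ys @ zs) ` (seqs n b \<times> seqs n m)" by blast
qed (auto simp: seqs_def)

lemma card_seqs_append:
  "card {xs \<in> seqs n (b + m). Q (take b xs) (drop b xs)}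
    = (\<Sum>zs\<in>seqs n m. card {ys \<in> seqs n b. Q ys zs})"
proof -
  let ?S = "SIGMA zs:seqs n m. {ys \<in> seqs n b. Q ys zs}"
  have "{xs \<in> seqs n (b + m). Q (take b xs) (drop b xs)} = (\<lambda>(zs, ys). ys @ zs) ` ?S"
    unfolding seqs_append by (auto simp: image_iff seqs_def)
  moreover have "inj_on (\<lambda>(zs, ys). ys @ zs) ?S"
    by (auto simp: inj_on_def seqs_def)
  ultimately show ?thesis by (simp add: card_image)
qed

context
  fixes n :: nat
  assumes n: "n \<ge> 1"
begin

lemma freq_mono:
  assumes "\<And>xs. xs \<in> seqs n m \<Longrightarrow> Q xs \<Longrightarrow> R xs"
  shows "freq n m Q \<le> freq n m R"
  unfolding freq_def using assms
  by (intro divide_right_mono) (auto intro!: card_mono)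

lemma freq_disj: "freq n m (\<lambda>xs. Q xs \<or> R xs) \<le> freq n m Q + freq n m R"
proof -
  have "{xs \<in> seqs n m. Q xs \<or> R xs} = {xs \<in> seqs n m. Q xs} \<union> {xs \<in> seqs n m. R xs}"
    by auto
  then have "card {xs \<in> seqs n m. Q xs \<or> R xs}
      \<le> card {xs \<in> seqs n m. Q xs} + card {xs \<in> seqs n m. R xs}"
    by (simp add: card_Un_le)
  then show ?thesis
    unfolding freq_def add_divide_distrib [symmetric]
    by (intro divide_right_mono) (auto simp flip: of_nat_add)
qed

lemma freq_bex:
  assumes "finite J"
  shows "freq n m (\<lambda>xs. \<exists>j\<in>J. Q j xs) \<le> (\<Sum>j\<in>J. freq n m (Q j))"
  using assms
proof (induction J)
  case empty
  then show ?case by (simp add: freq_def)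
next
  case (insert j J)
  have "freq n m (\<lambda>xs. \<exists>i\<in>insert j J. Q i xs) = freq n m (\<lambda>xs. Q j xs \<or> (\<exists>i\<in>J. Q i xs))"
    by simp
  also have "\<dots> \<le> freq n m (Q j) + freq n m (\<lambda>xs. \<exists>i\<in>J. Q i xs)" by (rule freq_disj)
  finally show ?case using insert by simp
qed

lemma freq_compl: "freq n m (\<lambda>xs. \<not> Q xs) = 1 - freq n m Q"
proof -
  have "{xs \<in> seqs n m. \<not> Q xs} = seqs n m - {xs \<in> seqs n m. Q xs}" by auto
  then have "card {xs \<in> seqs n m. \<not> Q xs} = n ^ m - card {xs \<in> seqs n m. Q xs}"
    by (simp add: card_Diff_subset card_seqs)
  moreover have "card {xs \<in> seqs n m. Q xs} \<le> n ^ m"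
    unfolding card_seqs [symmetric] by (rule card_mono) auto
  ultimately show ?thesis using n
    by (simp add: freq_def of_nat_diff field_simps)
qed

text \<open>Lists grow at the head, so dropping from the front leaves the earliest \<open>m\<close>
  picks. Each such list has \<open>n ^ (N - m)\<close> continuations, so these picks are uniform by
  themselves.\<close>

lemma freq_drop:
  assumes "m \<le> N"
  shows "freq n N (\<lambda>xs. Q (drop (N - m) xs)) = freq n m Q"
proof -
  define b where "b = N - m"
  have N: "N = b + m" using assms by (simp add: b_def)
  have "card {xs \<in> seqs n (b + m). Q (drop b xs)}
      = (\<Sum>zs\<in>seqs n m. card {ys \<in> seqs n b. Q zs})"
    using card_seqs_append [of n b m "\<lambda>_. Q"] .
  also have "\<dots> = (\<Sum>zs\<in>seqs n m. if Q zs then n ^ b else 0)"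
    by (intro sum.cong) (auto simp: card_seqs)
  also have "\<dots> = card {zs \<in> seqs n m. Q zs} * n ^ b"
    by (simp add: sum.If_cases Int_def)
  finally show ?thesis using n by (simp add: freq_def N power_add)
qed

text \<open>Conditioning on the history \<open>zs\<close>: the count is split over the histories,
  and those that violate \<open>G\<close> contribute 0. For a fixed history only the
  \<open>b\<close> fresh picks are random.\<close>

lemma freq_cond:
  assumes "\<And>zs. zs \<in> seqs n m \<Longrightarrow> G zs \<Longrightarrow> freq n b (\<lambda>ys. Q ys zs) \<le> \<epsilon>" and "\<epsilon> \<ge> 0"
  shows "freq n (b + m) (\<lambda>xs. G (drop b xs) \<and> Q (take b xs) (drop b xs)) \<le> \<epsilon>"
proof -
  have "real (card {xs \<in> seqs n (b + m). G (drop b xs) \<and> Q (take b xs) (drop b xs)})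
      = (\<Sum>zs\<in>seqs n m. real (card {ys \<in> seqs n b. G zs \<and> Q ys zs}))"
    using card_seqs_append [of n b m "\<lambda>ys zs. G zs \<and> Q ys zs"] by simp
  also have "\<dots> \<le> (\<Sum>zs\<in>seqs n m. \<epsilon> * real n ^ b)"
  proof (intro sum_mono)
    fix zs assume zs: "zs \<in> seqs n m"
    show "real (card {ys \<in> seqs n b. G zs \<and> Q ys zs}) \<le> \<epsilon> * real n ^ b"
      using assms(1) [OF zs] assms(2) n by (cases "G zs") (simp_all add: freq_def field_simps)
  qed
  also have "\<dots> = \<epsilon> * real n ^ (b + m)"
    by (simp add: card_seqs power_add)
  finally show ?thesis using n by (simp add: freq_def field_simps)
qed

text \<open>Markov's inequality for a nonnegative supermartingale, up to the factor \<open>\<kappa>\<close> per step.\<close>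

lemma freq_supermartingale:
  fixes \<Phi> :: "nat list \<Rightarrow> real"
  assumes nonneg: "\<And>xs. \<Phi> xs \<ge> 0" and "\<kappa> \<ge> 0" and "\<theta> > 0"
    and step: "\<And>xs. set xs \<subseteq> {..<n} \<Longrightarrow> (\<Sum>x<n. \<Phi> (x # xs)) \<le> real n * \<kappa> * \<Phi> xs"
    and Q: "\<And>xs. Q xs \<Longrightarrow> \<theta> \<le> \<Phi> xs"
  shows "freq n m Q \<le> \<kappa> ^ m * \<Phi> [] / \<theta>"
proof -
  have bound: "(\<Sum>xs\<in>seqs n m. \<Phi> xs) \<le> (real n * \<kappa>) ^ m * \<Phi> []"
  proof (induction m)
    case (Suc m)
    have "(\<Sum>xs\<in>seqs n (Suc m). \<Phi> xs) \<le> (\<Sum>xs\<in>seqs n m. real n * \<kappa> * \<Phi> xs)"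
      unfolding sum_seqs_Suc by (intro sum_mono step) (auto simp: seqs_def)
    also have "\<dots> \<le> real n * \<kappa> * ((real n * \<kappa>) ^ m * \<Phi> [])"
      unfolding sum_distrib_left [symmetric]
      using Suc assms(2) by (intro mult_left_mono) auto
    finally show ?case by (simp add: mult.assoc)
  qed simp
  have "\<theta> * real (card {xs \<in> seqs n m. Q xs}) = (\<Sum>xs\<in>{xs \<in> seqs n m. Q xs}. \<theta>)" by simp
  also have "\<dots> \<le> (\<Sum>xs\<in>{xs \<in> seqs n m. Q xs}. \<Phi> xs)"
    by (intro sum_mono Q) auto
  also have "\<dots> \<le> (\<Sum>xs\<in>seqs n m. \<Phi> xs)"
    by (intro sum_mono2) (auto simp: nonneg)
  also note bound
  finally show ?thesis using n \<open>\<theta> > 0\<close>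
    by (simp add: freq_def field_simps power_mult_distrib)
qed

end

section \<open>Random greedy independent sets\<close>

text \<open>Lists of picks have the newest pick at the head, so that the history is the tail.\<close>

definition pick :: "nat set set \<Rightarrow> nat \<Rightarrow> nat set \<Rightarrow> nat set" where
  "pick E x A = (if x \<in> A then A - insert x (neighbors E x) else A)"

definition alive :: "nat set set \<Rightarrow> nat set \<Rightarrow> nat list \<Rightarrow> nat set" where
  "alive E A xs = foldr (pick E) xs A"

text \<open>Ordered pairs count every edge twice, which makes the cardinality the sum of the
  degrees.\<close>

definition pairs :: "nat set set \<Rightarrow> nat set \<Rightarrow> (nat \<times> nat) set" where
  "pairs E A = {(u, v). u \<in> A \<and> v \<in> A \<and> {u, v} \<in> E}"

abbreviation deg :: "nat set set \<Rightarrow> nat set \<Rightarrow> nat \<Rightarrow> nat" where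
  "deg E A v \<equiv> card (A \<inter> neighbors E v)"

lemma neighbors_sym: "u \<in> neighbors E v \<longleftrightarrow> v \<in> neighbors E u"
  by (simp add: neighbors_def insert_commute)

lemma alive_Nil [simp]: "alive E A [] = A"
  and alive_Cons [simp]: "alive E A (x # xs) = pick E x (alive E A xs)"
  and alive_append: "alive E A (xs @ ys) = alive E (alive E A ys) xs"
  by (simp_all add: alive_def)

lemma pick_subset: "pick E x A \<subseteq> A"
  by (auto simp: pick_def)

lemma alive_subset: "alive E A xs \<subseteq> A"
proof (induction xs)
  case (Cons x xs)
  then show ?case using pick_subset [of E x "alive E A xs"] by simp
qed simp

lemma alive_disjoint: "alive E A xs \<inter> set xs = {}"
  by (induction xs) (auto simp: pick_def)

lemma pairs_mono: "A \<subseteq> B \<Longrightarrow> pairs E A \<subseteq> pairs E B"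
  by (auto simp: pairs_def)

lemma pairs_Sigma: "pairs E A = (SIGMA v:A. A \<inter> neighbors E v)"
  by (auto simp: pairs_def neighbors_def insert_commute)

lemma card_pairs: "finite A \<Longrightarrow> card (pairs E A) = (\<Sum>v\<in>A. deg E A v)"
  unfolding pairs_Sigma by (subst card_SigmaI) auto

lemma finite_pairs: "finite A \<Longrightarrow> finite (pairs E A)"
  unfolding pairs_Sigma by auto

lemma card_pairs_mono: "A \<subseteq> B \<Longrightarrow> finite B \<Longrightarrow> card (pairs E A) \<le> card (pairs E B)"
  by (intro card_mono finite_pairs pairs_mono)

lemma deg_mono: "A \<subseteq> B \<Longrightarrow> finite B \<Longrightarrow> deg E A v \<le> deg E B v"
  by (intro card_mono) auto

section \<open>Decay of degrees and of edges under random picks\<close>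

context
  fixes n :: nat and E :: "nat set set"
  assumes n: "n \<ge> 1"
begin

text \<open>Any pick among the at least \<open>d\<close> alive neighbors kills \<open>v\<close>, so
  the event survives a pick with probability at most \<open>1 - d / n\<close>. Degrees never grow,
  so the event cannot return once it has failed, and its indicator serves as the potential.\<close>

lemma freq_deg_vertex:
  assumes A: "A \<subseteq> {..<n}" and v: "v < n" and d: "d \<le> real n"
  shows "freq n m (\<lambda>xs. v \<in> alive E A xs \<and> d \<le> real (deg E (alive E A xs) v)) \<le> (1 - d / n) ^ m"
proof -
  let ?Q = "\<lambda>xs. v \<in> alive E A xs \<and> d \<le> real (deg E (alive E A xs) v)"
  have "freq n m ?Q \<le> (1 - d / n) ^ m * of_bool (?Q []) / 1"
  proof (rule freq_supermartingale [OF n])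
    fix xs assume "set xs \<subseteq> {..<n}"
    let ?B = "alive E A xs"
    have B: "?B \<subseteq> {..<n}" using alive_subset A by blast
    show "(\<Sum>x<n. of_bool (?Q (x # xs))) \<le> real n * (1 - d / n) * of_bool (?Q xs)"
    proof (cases "?Q xs")
      case True
      have "(\<Sum>x<n. of_bool (?Q (x # xs)) :: real) \<le> (\<Sum>x<n. of_bool (x \<notin> ?B \<inter> neighbors E v))"
        by (intro sum_mono) (auto simp: pick_def neighbors_def insert_commute)
      also have "\<dots> = real (card ({..<n} - ?B \<inter> neighbors E v))"
        by (simp add: sum.If_cases of_bool_def set_diff_eq Collect_conj_eq lessThan_def)
      also have "\<dots> = real n - real (deg E ?B v)"
        using B by (subst card_Diff_subset)
          (auto simp: of_nat_diff card_mono finite_subset intro!: of_nat_diff card_mono[of "{..<n}", simplified])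
      also have "\<dots> \<le> real n * (1 - d / n) * of_bool (?Q xs)"
        using True n by (simp add: field_simps)
      finally show ?thesis .
    next
      case False
      have none: "\<not> ?Q (x # xs)" for x
      proof
        assume *: "?Q (x # xs)"
        have "pick E x ?B \<subseteq> ?B" by (rule pick_subset)
        moreover from this have "deg E (pick E x ?B) v \<le> deg E ?B v"
          using finite_subset [OF B] by (intro deg_mono) auto
        ultimately show False using * False by auto
      qed
      then have "(\<Sum>x<n. of_bool (?Q (x # xs)) :: real) = 0"
        by (intro sum.neutral) simp
      moreover have "of_bool (?Q xs) = (0::real)" using False by auto
      ultimately show ?thesis by (simp only: mult_zero_right)
    qed
  qed (use d n in auto)
  also have "\<dots> \<le> (1 - d / n) ^ m * 1 / 1"
    using d n by (intro divide_right_mono mult_left_mono zero_le_power) (auto simp: field_simps)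
  finally show ?thesis by simp
qed

lemma freq_deg:
  assumes A: "A \<subseteq> {..<n}" and d: "d \<ge> 0"
  shows "freq n m (\<lambda>xs. \<exists>v\<in>alive E A xs. d \<le> real (deg E (alive E A xs) v))
    \<le> real n * exp (- d * m / n)"
proof -
  have "freq n m (\<lambda>xs. \<exists>v\<in>alive E A xs. d \<le> real (deg E (alive E A xs) v))
    \<le> freq n m (\<lambda>xs. \<exists>v\<in>{..<n}. v \<in> alive E A xs \<and> d \<le> real (deg E (alive E A xs) v))"
    by (intro freq_mono [OF n]) (use alive_subset A in blast)
  also have "\<dots> \<le> (\<Sum>v\<in>{..<n}. freq n m (\<lambda>xs. v \<in> alive E A xs \<and> d \<le> real (deg E (alive E A xs) v)))"
    by (rule freq_bex [OF n]) simp
  also have "\<dots> \<le> (\<Sum>v\<in>{..<n}. exp (- d * m / n))"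
  proof (intro sum_mono)
    fix v assume v: "v \<in> {..<n}"
    show "freq n m (\<lambda>xs. v \<in> alive E A xs \<and> d \<le> real (deg E (alive E A xs) v)) \<le> exp (- d * m / n)"
    proof (cases "d \<le> real n")
      case True
      have "(1 - d / n) ^ m \<le> exp (- d / n) ^ m"
        using True n exp_ge_add_one_self [of "- d / n"] by (intro power_mono) (auto simp: field_simps)
      also have "\<dots> = exp (- d * m / n)"
        by (simp add: exp_of_nat_mult [symmetric] mult.commute)
      finally show ?thesis using freq_deg_vertex [OF A _ True, of v m] v by auto
    next
      \<comment> \<open>Here \<open>1 - d / n\<close> is negative, but no degree can reach a
        threshold above \<open>n\<close>.\<close>
      case False
      have "\<not> d \<le> real (deg E (alive E A xs) v)" for xs
      proof -
        have "deg E (alive E A xs) v \<le> card {..<n}"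
          using alive_subset [of E A xs] A by (intro card_mono) auto
        then show ?thesis using False by simp
      qed
      then show ?thesis by (simp add: freq_def)
    qed
  qed
  finally show ?thesis by simp
qed

lemma exp_neg_le_half: "exp (- y) \<le> 1 - y / 2" if "0 \<le> y" "y \<le> 1" for y :: real
proof -
  have "1 + y + y\<^sup>2 / 2 \<le> exp y" using exp_lower_Taylor_quadratic [of y] that by simp
  then have "exp (- y) \<le> 1 / (1 + y + y\<^sup>2 / 2)"
    using that by (simp add: exp_minus field_simps add_pos_nonneg)
  also have "\<dots> \<le> 1 - y / 2"
  proof -
    have "y ^ 3 \<le> y" using power_decreasing [of 1 3 y] that by simp
    \<comment> \<open>The product equals \<open>1 + y / 2 - y ^ 3 / 4\<close>.\<close>
    then have "1 \<le> (1 - y / 2) * (1 + y + y\<^sup>2 / 2)"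
      using that by (simp add: field_simps power2_eq_square power3_eq_cube)
    moreover have "0 < 1 + y + y\<^sup>2 / 2" using that by (simp add: add_pos_nonneg)
    ultimately show ?thesis by (simp only: pos_divide_le_eq)
  qed
  finally show ?thesis .
qed

lemma exp_le_double: "exp y \<le> 1 + 2 * y" if "0 \<le> y" "y \<le> 1" for y :: real
  using exp_bound [of y] that mult_left_mono [of y 1 y] by (simp add: power2_eq_square)

text \<open>
  Picking an alive vertex \<open>x\<close> removes at least all pairs whose first component is a neighbor of \<open>x\<close>.
  On average over \<open>x\<close> these are \<open>(\<Sum>u. deg u ^ 2) / n\<close> pairs, and Cauchy-Schwarz applies.
\<close>

lemma sum_neighbor_degrees:
  assumes A: "A \<subseteq> {..<n}"
  shows "(real (card (pairs E A)))\<^sup>2 / n \<le> (\<Sum>x\<in>A. \<Sum>u\<in>A \<inter> neighbors E x. real (deg E A u))"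
proof -
  have fin: "finite A" using A by (rule finite_subset) simp
  have "(\<Sum>x\<in>A. \<Sum>u\<in>A \<inter> neighbors E x. real (deg E A u))
      = (\<Sum>x\<in>A. \<Sum>u\<in>A. if u \<in> neighbors E x then real (deg E A u) else 0)"
    by (intro sum.cong [OF refl]) (simp add: sum.inter_restrict fin)
  also have "\<dots> = (\<Sum>u\<in>A. \<Sum>x\<in>A. if x \<in> neighbors E u then real (deg E A u) else 0)"
    by (subst sum.swap) (intro sum.cong refl if_cong neighbors_sym)
  also have "\<dots> = (\<Sum>u\<in>A. (real (deg E A u))\<^sup>2)"
    by (intro sum.cong [OF refl])
      (simp add: power2_eq_square fin flip: sum.inter_restrict)
  finally have eq: "(\<Sum>x\<in>A. \<Sum>u\<in>A \<inter> neighbors E x. real (deg E A u)) = (\<Sum>u\<in>A. (real (deg E A u))\<^sup>2)" .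
  have "(real (card (pairs E A)))\<^sup>2 = (\<Sum>u\<in>A. real (deg E A u))\<^sup>2"
    by (simp add: card_pairs fin)
  also have "\<dots> \<le> real (card A) * (\<Sum>u\<in>A. (real (deg E A u))\<^sup>2)"
    using sum_squared_le_sum_of_squares [of "\<lambda>u. real (deg E A u)" A] by (simp add: mult.commute fin)
  also have "\<dots> \<le> real n * (\<Sum>u\<in>A. (real (deg E A u))\<^sup>2)"
    using card_mono [OF _ A] by (intro mult_right_mono sum_nonneg) auto
  finally show ?thesis using n eq by (simp add: field_simps)
qed

lemma card_pairs_pick:
  assumes A: "finite A" and x: "x \<in> A"
  shows "card (pairs E (pick E x A)) + (\<Sum>u\<in>A \<inter> neighbors E x. deg E A u) \<le> card (pairs E A)"
proof -
  let ?R = "SIGMA u:A \<inter> neighbors E x. A \<inter> neighbors E u"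
  have "card (pairs E (pick E x A)) + card ?R = card (pairs E (pick E x A) \<union> ?R)"
  proof (rule card_Un_disjoint [symmetric])
    show "finite (pairs E (pick E x A))"
      using finite_subset [OF pick_subset A] by (rule finite_pairs)
    show "pairs E (pick E x A) \<inter> ?R = {}" using x by (auto simp: pairs_def pick_def)
  qed (use A in simp)
  also have "\<dots> \<le> card (pairs E A)"
  proof (intro card_mono)
    show "finite (pairs E A)" using A by (rule finite_pairs)
    show "pairs E (pick E x A) \<union> ?R \<subseteq> pairs E A"
      using pairs_mono [OF pick_subset, of E E x A] by (auto simp: pairs_Sigma)
  qed
  finally show ?thesis using A by simp
qed

text \<open>The potential is \<open>exp (- l * n\<^sup>2 / X)\<close> for the current number
  \<open>X\<close> of pairs. Since \<open>1 / X\<close> grows by at least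
  \<open>1 / n\<^sup>2\<close> on average, the exponent falls by at least \<open>l\<close> per pick
  on average. The condition on \<open>l\<close> keeps the guaranteed fall at most 1, where
  \<open>exp (- y) \<le> 1 - y / 2\<close> applies; this halves the rate to
  \<open>l / 2\<close>.\<close>

lemma freq_pairs:
  assumes A: "A \<subseteq> {..<n}" and D: "\<And>v. v \<in> A \<Longrightarrow> real (deg E A v) \<le> D"
    and x: "x > 0" and l: "l > 0" "l * D\<^sup>2 * (real n)\<^sup>2 \<le> x\<^sup>2"
  shows "freq n m (\<lambda>xs. x \<le> real (card (pairs E (alive E A xs))))
    \<le> exp (- l * m / 2 + l * (real n)\<^sup>2 / x)"
proof -
  let ?X = "\<lambda>xs. real (card (pairs E (alive E A xs)))"
  \<comment> \<open>Cutting the potential off below \<open>x\<close> keeps \<open>X\<close> away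
    from 0 and the increments bounded. As \<open>X\<close> only decreases, a potential of 0 stays
    0.\<close>
  define \<Phi> where "\<Phi> xs = (if x \<le> ?X xs then exp (- l * (real n)\<^sup>2 / ?X xs) else 0)" for xs
  have "freq n m (\<lambda>xs. x \<le> ?X xs) \<le> exp (- l / 2) ^ m * \<Phi> [] / exp (- l * (real n)\<^sup>2 / x)"
  proof (rule freq_supermartingale [OF n])
    fix xs assume "set xs \<subseteq> {..<n}"
    let ?B = "alive E A xs"
    have BA: "?B \<subseteq> A" by (rule alive_subset)
    with A have B: "?B \<subseteq> {..<n}" by (rule subset_trans [rotated])
    then have finB: "finite ?B" by (rule finite_subset) simp
    \<comment> \<open>The loss of pairs guaranteed by \<open>card_pairs_pick\<close> when
      \<open>y\<close> is picked.\<close>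
    define \<rho> where "\<rho> y = (if y \<in> ?B then \<Sum>u\<in>?B \<inter> neighbors E y. real (deg E ?B u) else 0)" for y
    define X where "X = ?X xs"
    show "(\<Sum>y<n. \<Phi> (y # xs)) \<le> real n * exp (- l / 2) * \<Phi> xs"
    proof (cases "x \<le> X")
      case True
      have X0: "X > 0" using True x by simp
      define \<delta> where "\<delta> y = l * \<rho> y * (real n)\<^sup>2 / X\<^sup>2" for y
      have D': "real (deg E ?B v) \<le> D" if "v \<in> ?B" for v
      proof -
        have "deg E ?B v \<le> deg E A v" using BA finite_subset [OF A] by (intro deg_mono) auto
        moreover have "real (deg E A v) \<le> D" using D that BA by blast
        ultimately show ?thesis by linarith
      qed
      have \<rho>0: "\<rho> y \<ge> 0" for y by (auto simp: \<rho>_def intro!: sum_nonneg)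
      have \<rho>D: "\<rho> y \<le> D\<^sup>2" for y
      proof (cases "y \<in> ?B")
        case yB: True
        have D0: "0 \<le> D" using D' [OF yB] by linarith
        have "\<rho> y \<le> real (deg E ?B y) * D" using yB D'
          unfolding \<rho>_def if_P [OF yB] by (intro sum_bounded_above) blast
        also have "\<dots> \<le> D * D" using D' [OF yB] D0 by (simp add: mult_right_mono)
        finally show ?thesis by (simp add: power2_eq_square)
      qed (simp add: \<rho>_def)
      have \<delta>0: "\<delta> y \<ge> 0" for y using \<rho>0 l by (simp add: \<delta>_def)
      have \<delta>1: "\<delta> y \<le> 1" for y
      proof -
        have "l * \<rho> y * (real n)\<^sup>2 \<le> l * D\<^sup>2 * (real n)\<^sup>2"
          using \<rho>D l by (intro mult_right_mono mult_left_mono) auto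
        also have "\<dots> \<le> x\<^sup>2" by (rule l)
        also have "\<dots> \<le> X\<^sup>2" using True x by (intro power_mono) auto
        finally show ?thesis using X0 by (simp add: \<delta>_def)
      qed
      have step: "\<Phi> (y # xs) \<le> \<Phi> xs * exp (- \<delta> y)" for y
      proof (cases "x \<le> ?X (y # xs)")
        case xy: True
        define X' where "X' = ?X (y # xs)"
        have X'0: "X' > 0" using xy x by (simp add: X'_def)
        have le: "X' + \<rho> y \<le> X"
        proof (cases "y \<in> ?B")
          case yB: True
          show ?thesis
            using card_pairs_pick [OF finB yB] yB by (simp add: X'_def X_def \<rho>_def flip: of_nat_sum of_nat_add)
        next
          case False
          then show ?thesis by (simp add: X'_def X_def \<rho>_def pick_def)
        qed
        \<comment> \<open>The first-order growth of \<open>1 / X\<close> is a lower bound for its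
          true growth because \<open>X' \<le> X\<close>.\<close>
        have "\<rho> y / X\<^sup>2 \<le> \<rho> y / (X * X')"
          using \<rho>0 [of y] X0 X'0 le
          by (intro divide_left_mono) (auto simp: power2_eq_square)
        also have "\<dots> \<le> (X - X') / (X * X')"
          using le X0 X'0 by (intro divide_right_mono) auto
        also have "\<dots> = 1 / X' - 1 / X" using X0 X'0 by (simp add: field_simps)
        finally have "1 / X + \<rho> y / X\<^sup>2 \<le> 1 / X'" by simp
        from mult_left_mono [OF this, of "l * (real n)\<^sup>2"]
        have "l * (real n)\<^sup>2 / X + \<delta> y \<le> l * (real n)\<^sup>2 / X'"
          using l by (simp add: \<delta>_def distrib_left mult_ac)
        then have "exp (- l * (real n)\<^sup>2 / X') \<le> exp (- l * (real n)\<^sup>2 / X) * exp (- \<delta> y)"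
          by (simp add: exp_add [symmetric])
        then show ?thesis using xy True by (simp add: \<Phi>_def X_def X'_def)
      next
        case False
        then show ?thesis by (simp add: \<Phi>_def)
      qed
      \<comment> \<open>The scaling by \<open>n\<^sup>2 / X\<^sup>2\<close> turns the Cauchy-Schwarz
        bound \<open>X\<^sup>2 / n\<close> into \<open>l * n\<close>, which no longer depends on
        \<open>X\<close>.\<close>
      have sum\<delta>: "real n * l \<le> (\<Sum>y<n. \<delta> y)"
      proof -
        have "(\<Sum>y<n. \<rho> y) = (\<Sum>y\<in>?B. \<Sum>u\<in>?B \<inter> neighbors E y. real (deg E ?B u))"
          unfolding \<rho>_def using B by (simp add: sum.If_cases Int_absorb1)
        then have "X\<^sup>2 / n \<le> (\<Sum>y<n. \<rho> y)" using sum_neighbor_degrees [OF B] by (simp add: X_def)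
        then have "l * (real n)\<^sup>2 / X\<^sup>2 * (X\<^sup>2 / n) \<le> l * (real n)\<^sup>2 / X\<^sup>2 * (\<Sum>y<n. \<rho> y)"
          using l by (intro mult_left_mono) auto
        also have "\<dots> = (\<Sum>y<n. \<delta> y)"
          unfolding \<delta>_def sum_distrib_left by (intro sum.cong refl) simp
        finally show ?thesis using X0 n by (simp add: power2_eq_square field_simps)
      qed
      have \<Phi>0: "\<Phi> xs \<ge> 0" by (simp add: \<Phi>_def)
      have "(\<Sum>y<n. \<Phi> (y # xs)) \<le> (\<Sum>y<n. \<Phi> xs * (1 - \<delta> y / 2))"
      proof (intro sum_mono)
        fix y
        have "\<Phi> (y # xs) \<le> \<Phi> xs * exp (- \<delta> y)" by (rule step)
        also have "\<dots> \<le> \<Phi> xs * (1 - \<delta> y / 2)"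
          using \<delta>0 \<delta>1 \<Phi>0 by (intro mult_left_mono exp_neg_le_half)
        finally show "\<Phi> (y # xs) \<le> \<Phi> xs * (1 - \<delta> y / 2)" .
      qed
      also have "\<dots> = \<Phi> xs * (real n - (\<Sum>y<n. \<delta> y) / 2)"
        by (simp add: sum_distrib_left [symmetric] sum_subtractf sum_divide_distrib [symmetric])
      also have "\<dots> \<le> \<Phi> xs * (real n * (1 - l / 2))"
        using sum\<delta> \<Phi>0 by (intro mult_left_mono) (auto simp: field_simps)
      also have "\<dots> \<le> \<Phi> xs * (real n * exp (- l / 2))"
        using \<Phi>0 exp_ge_add_one_self [of "- l / 2"] by (intro mult_left_mono) auto
      finally show ?thesis by (simp add: mult_ac)
    next
      case False
      have "\<Phi> (y # xs) = 0" for y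
        using False card_pairs_mono [OF pick_subset [of E y] finB, of E]
        by (auto simp: \<Phi>_def X_def)
      then show ?thesis by (simp add: \<Phi>_def)
    qed
  next
    fix xs assume xs: "x \<le> ?X xs"
    then have "l * (real n)\<^sup>2 / ?X xs \<le> l * (real n)\<^sup>2 / x"
      using x l by (intro divide_left_mono mult_pos_pos) auto
    then show "exp (- l * (real n)\<^sup>2 / x) \<le> \<Phi> xs"
      using xs by (simp add: \<Phi>_def)
  qed (auto simp: \<Phi>_def)
  also have "\<dots> \<le> exp (- l / 2) ^ m * 1 / exp (- l * (real n)\<^sup>2 / x)"
    using l by (intro divide_right_mono mult_left_mono) (auto simp: \<Phi>_def)
  also have "\<dots> = exp (real m * (- l / 2) - (- l * (real n)\<^sup>2 / x))"
    by (simp only: exp_of_nat_mult exp_diff mult_1_right)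
  also have "real m * (- l / 2) - (- l * (real n)\<^sup>2 / x) = - l * m / 2 + l * (real n)\<^sup>2 / x"
    by simp
  finally show ?thesis .
qed

text \<open>The sum of the degrees of the picks has mean \<open>b * card (pairs E A) / n\<close>.
  Its exponential moment with parameter \<open>1 / D\<close> costs a factor 2 on the mean, because
  \<open>exp y \<le> 1 + 2 * y\<close> up to \<open>y = 1\<close>, and a deviation of
  \<open>a * D\<close>.\<close>

lemma freq_degree_sum:
  assumes A: "A \<subseteq> {..<n}" and D: "\<And>v. v \<in> A \<Longrightarrow> real (deg E A v) \<le> D" "D > 0"
  shows "freq n b (\<lambda>ys. 2 * b * card (pairs E A) / n + a * D
      \<le> (\<Sum>y\<leftarrow>ys. if y \<in> A then real (deg E A y) else 0)) \<le> exp (- a)"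
proof -
  define w where "w y = (if y \<in> A then real (deg E A y) else 0)" for y
  define X where "X = real (card (pairs E A))"
  have finA: "finite A" using A by (rule finite_subset) simp
  have w: "0 \<le> w y" "w y \<le> D" for y using D by (auto simp: w_def)
  have sumw: "(\<Sum>y<n. w y) = X"
    using A by (simp add: w_def X_def card_pairs finA sum.If_cases Int_absorb1)
  have "freq n b (\<lambda>ys. 2 * b * X / n + a * D \<le> (\<Sum>y\<leftarrow>ys. w y))
      \<le> exp (2 * X / (n * D)) ^ b * exp ((\<Sum>y\<leftarrow>[]. w y) / D) / exp ((2 * b * X / n + a * D) / D)"
  proof (rule freq_supermartingale [OF n])
    fix ys :: "nat list"
    let ?s = "(\<Sum>y\<leftarrow>ys. w y)"
    have "(\<Sum>y<n. exp ((\<Sum>z\<leftarrow>y # ys. w z) / D)) = exp (?s / D) * (\<Sum>y<n. exp (w y / D))"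
      by (simp add: sum_distrib_left exp_add add_divide_distrib mult.commute)
    also have "\<dots> \<le> exp (?s / D) * (\<Sum>y<n. 1 + 2 * (w y / D))"
      using w D by (intro mult_left_mono sum_mono exp_le_double) auto
    also have "(\<Sum>y<n. 1 + 2 * (w y / D)) = real n * (1 + 2 * X / (n * D))"
    proof -
      have "(\<Sum>y<n. 1 + 2 * (w y / D)) = real n + 2 / D * (\<Sum>y<n. w y)"
        by (simp add: sum.distrib sum_distrib_left)
      then show ?thesis unfolding sumw using n D by (simp add: distrib_left)
    qed
    also have "exp (?s / D) * \<dots> \<le> exp (?s / D) * (real n * exp (2 * X / (n * D)))"
      by (intro mult_left_mono exp_ge_add_one_self) auto
    finally show "(\<Sum>y<n. exp ((\<Sum>z\<leftarrow>y # ys. w z) / D))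
        \<le> real n * exp (2 * X / (n * D)) * exp (?s / D)" by (simp add: mult_ac)
  next
    fix ys :: "nat list"
    assume "2 * b * X / n + a * D \<le> (\<Sum>y\<leftarrow>ys. w y)"
    then show "exp ((2 * b * X / n + a * D) / D) \<le> exp ((\<Sum>y\<leftarrow>ys. w y) / D)"
      using D by (simp add: divide_right_mono)
  qed auto
  also have "\<dots> = exp (real b * (2 * X / (n * D)) - (2 * b * X / n + a * D) / D)"
    by (simp add: exp_of_nat_mult [symmetric] exp_diff [symmetric])
  also have "real b * (2 * X / (n * D)) - (2 * b * X / n + a * D) / D = - a"
    using D n by (simp add: add_divide_distrib)
  finally show ?thesis by (simp add: w_def X_def)
qed

text \<open>Edges inside a batch are revealed pick by pick: each pick is charged with its neighbors
  among the earlier picks of the batch. The set \<open>A\<close> stays the one alive before the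
  batch.\<close>

fun hits :: "nat set \<Rightarrow> nat list \<Rightarrow> nat" where
  "hits A [] = 0"
| "hits A (y # ys) = (if y \<in> A then card (A \<inter> set ys \<inter> neighbors E y) else 0) + hits A ys"

text \<open>A new pick adds its pairs with earlier neighbors in both orders. Without loops it forms
  no pair with itself.\<close>

lemma card_pairs_le_hits:
  assumes "\<And>v. {v} \<notin> E"
  shows "card (pairs E (A \<inter> set ys)) \<le> 2 * hits A ys"
proof (induction ys)
  case (Cons y ys)
  let ?S = "A \<inter> set ys" and ?N = "A \<inter> set ys \<inter> neighbors E y"
  show ?case
  proof (cases "y \<in> A")
    case True
    have "pairs E (A \<inter> set (y # ys)) \<subseteq> pairs E ?S \<union> {y} \<times> ?N \<union> ?N \<times> {y}"
      using assms by (auto simp: pairs_def neighbors_def insert_commute)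
    then have "card (pairs E (A \<inter> set (y # ys))) \<le> card (pairs E ?S \<union> {y} \<times> ?N \<union> ?N \<times> {y})"
      by (intro card_mono) (auto intro: finite_pairs)
    also have "\<dots> \<le> card (pairs E ?S \<union> {y} \<times> ?N) + card (?N \<times> {y})" by (rule card_Un_le)
    also have "\<dots> \<le> card (pairs E ?S) + card ({y} \<times> ?N) + card (?N \<times> {y})"
      by (intro add_right_mono card_Un_le)
    also have "\<dots> \<le> 2 * hits A ys + 2 * card ?N"
      using Cons.IH by simp
    finally show ?thesis using True by simp
  next
    case False
    then have "A \<inter> set (y # ys) = A \<inter> set ys" by auto
    then show ?thesis using Cons.IH False by simp
  qed
qed (simp add: pairs_def)

text \<open>As long as the earlier picks have total degree at most \<open>Q\<close>, the next pick
  has at most \<open>Q / n\<close> earlier neighbors on average. The potential is set to 0 when the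
  degree sum exceeds \<open>Q\<close>; that sum never decreases, so the potential stays 0.\<close>

lemma freq_hits:
  assumes A: "A \<subseteq> {..<n}" and D: "\<And>v. v \<in> A \<Longrightarrow> real (deg E A v) \<le> D" "D > 0" and Q: "Q \<ge> 0"
  shows "freq n b (\<lambda>ys. (\<Sum>y\<leftarrow>ys. if y \<in> A then real (deg E A y) else 0) \<le> Q
      \<and> 2 * b * Q / n + a * D \<le> real (hits A ys)) \<le> exp (- a)"
proof -
  define w where "w y = (if y \<in> A then real (deg E A y) else 0)" for y
  define inc where "inc ys y = (if y \<in> A then real (card (A \<inter> set ys \<inter> neighbors E y)) else 0)" for ys y
  define \<Phi> where "\<Phi> ys = (if (\<Sum>y\<leftarrow>ys. w y) \<le> Q then exp (real (hits A ys) / D) else 0)" for ys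
  have finA: "finite A" using A by (rule finite_subset) simp
  have w: "0 \<le> w y" for y by (simp add: w_def)
  have inc: "0 \<le> inc ys y" "inc ys y \<le> D" for ys y
  proof -
    have "real (card (A \<inter> set ys \<inter> neighbors E y)) \<le> deg E A y"
      using finA by (intro of_nat_mono card_mono) auto
    then show "inc ys y \<le> D" using D(1) [of y] D(2) by (auto simp: inc_def)
  qed (simp add: inc_def)
  \<comment> \<open>Double counting: an earlier pick is a neighbor of as many alive candidates
    \<open>y\<close> as its degree.\<close>
  have suminc: "(\<Sum>y<n. inc ys y) \<le> (\<Sum>y\<leftarrow>ys. w y)" for ys
  proof -
    have "(\<Sum>y<n. inc ys y) = (\<Sum>y\<in>A. real (card (A \<inter> set ys \<inter> neighbors E y)))"
      using A by (simp add: inc_def sum.If_cases Int_absorb1)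
    also have "\<dots> = (\<Sum>y\<in>A. \<Sum>u\<in>A \<inter> set ys. if u \<in> neighbors E y then 1 else 0)"
      by (intro sum.cong [OF refl]) (simp add: sum.If_cases)
    also have "\<dots> = (\<Sum>u\<in>A \<inter> set ys. \<Sum>y\<in>A. if y \<in> neighbors E u then 1 else 0)"
      by (subst sum.swap) (intro sum.cong refl if_cong neighbors_sym)
    also have "\<dots> = (\<Sum>u\<in>A \<inter> set ys. w u)"
      by (intro sum.cong [OF refl]) (simp add: sum.If_cases finA w_def)
    also have "\<dots> \<le> (\<Sum>u\<in>set ys. w u)" using w by (intro sum_mono2) auto
    also have "\<dots> \<le> (\<Sum>y\<leftarrow>ys. w y)"
    proof (induction ys)
      case (Cons y ys)
      have "(\<Sum>u\<in>set (y # ys). w u) \<le> w y + (\<Sum>u\<in>set ys. w u)"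
        using w [of y] by (cases "y \<in> set ys") (simp_all add: insert_absorb)
      then show ?case using Cons by simp
    qed simp
    finally show ?thesis .
  qed
  have "freq n b (\<lambda>ys. (\<Sum>y\<leftarrow>ys. w y) \<le> Q \<and> 2 * b * Q / n + a * D \<le> real (hits A ys))
      \<le> exp (2 * Q / (n * D)) ^ b * \<Phi> [] / exp ((2 * b * Q / n + a * D) / D)"
  proof (rule freq_supermartingale [OF n])
    fix ys :: "nat list"
    show "(\<Sum>y<n. \<Phi> (y # ys)) \<le> real n * exp (2 * Q / (n * D)) * \<Phi> ys"
    proof (cases "(\<Sum>y\<leftarrow>ys. w y) \<le> Q")
      case True
      have "(\<Sum>y<n. \<Phi> (y # ys)) \<le> (\<Sum>y<n. \<Phi> ys * (1 + 2 * (inc ys y / D)))"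
      proof (intro sum_mono)
        fix y
        have "\<Phi> (y # ys) \<le> exp (real (hits A (y # ys)) / D)" by (simp add: \<Phi>_def)
        also have "real (hits A (y # ys)) = real (hits A ys) + inc ys y" by (simp add: inc_def)
        also have "exp ((real (hits A ys) + inc ys y) / D) = \<Phi> ys * exp (inc ys y / D)"
          using True by (simp add: \<Phi>_def add_divide_distrib exp_add)
        also have "\<dots> \<le> \<Phi> ys * (1 + 2 * (inc ys y / D))"
          using inc D by (intro mult_left_mono exp_le_double) (auto simp: \<Phi>_def)
        finally show "\<Phi> (y # ys) \<le> \<Phi> ys * (1 + 2 * (inc ys y / D))" .
      qed
      also have "\<dots> = \<Phi> ys * (real n + 2 * (\<Sum>y<n. inc ys y) / D)"
        by (simp add: sum_distrib_left [symmetric] sum.distrib sum_divide_distrib [symmetric])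
      also have "\<dots> \<le> \<Phi> ys * (real n + 2 * Q / D)"
        using suminc [of ys] True D by (intro mult_left_mono add_left_mono divide_right_mono) (auto simp: \<Phi>_def)
      also have "real n + 2 * Q / D = real n * (1 + 2 * Q / (n * D))"
        using n by (simp add: field_simps)
      also have "\<Phi> ys * \<dots> \<le> \<Phi> ys * (real n * exp (2 * Q / (n * D)))"
        by (intro mult_left_mono exp_ge_add_one_self) (auto simp: \<Phi>_def)
      finally show ?thesis by (simp add: mult_ac)
    next
      case False
      then have "\<not> (\<Sum>z\<leftarrow>y # ys. w z) \<le> Q" for y using w [of y] by simp
      then show ?thesis using False by (simp add: \<Phi>_def)
    qed
  next
    fix ys :: "nat list"
    assume "(\<Sum>y\<leftarrow>ys. w y) \<le> Q \<and> 2 * b * Q / n + a * D \<le> real (hits A ys)"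
    then show "exp ((2 * b * Q / n + a * D) / D) \<le> \<Phi> ys"
      using D by (simp add: \<Phi>_def divide_right_mono)
  qed (auto simp: \<Phi>_def)
  also have "\<Phi> [] = 1" using Q by (simp add: \<Phi>_def)
  also have "exp (2 * Q / (n * D)) ^ b * 1 / exp ((2 * b * Q / n + a * D) / D)
      = exp (real b * (2 * Q / (n * D)) - (2 * b * Q / n + a * D) / D)"
    by (simp only: exp_of_nat_mult exp_diff mult_1_right)
  also have "real b * (2 * Q / (n * D)) - (2 * b * Q / n + a * D) / D = - a"
    using D n by (simp add: add_divide_distrib)
  finally show ?thesis by (simp add: w_def)
qed

text \<open>The batch has about \<open>(b / n)\<^sup>2\<close> times as many pairs as
  \<open>A\<close>, since both ends must be picked: one factor \<open>b / n\<close> comes from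
  \<open>freq_degree_sum\<close>, the other from \<open>freq_hits\<close>.\<close>

lemma freq_stage:
  assumes A: "A \<subseteq> {..<n}" and D: "\<And>v. v \<in> A \<Longrightarrow> real (deg E A v) \<le> D" "D > 0"
    and x: "real (card (pairs E A)) \<le> x" and a: "a \<ge> 0" and b: "b \<le> n" and E: "\<And>v. {v} \<notin> E"
  shows "freq n b (\<lambda>ys. 8 * (real b)\<^sup>2 * x / (real n)\<^sup>2 + 6 * a * D < real (card (pairs E (A \<inter> set ys))))
    \<le> 2 * exp (- a)"
proof -
  define Q where "Q = 2 * b * card (pairs E A) / n + a * D"
  have Q0: "Q \<ge> 0" using a D by (simp add: Q_def)
  let ?w = "\<lambda>ys. (\<Sum>y\<leftarrow>ys. if y \<in> A then real (deg E A y) else 0)"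
  \<comment> \<open>Twice the threshold of \<open>freq_hits\<close>, as pairs are at most twice the
    hits. With \<open>b \<le> n\<close> the deviation inside \<open>Q\<close> contributes at most
    \<open>4 * a * D\<close>.\<close>
  have "4 * b * Q / n + 2 * a * D = 8 * (real b)\<^sup>2 * card (pairs E A) / (real n)\<^sup>2 + (4 * (real b / n) + 2) * a * D"
    using n by (simp add: Q_def field_simps power2_eq_square)
  also have "\<dots> \<le> 8 * (real b)\<^sup>2 * x / (real n)\<^sup>2 + (4 * 1 + 2) * a * D"
    using x a D b n by (intro add_mono mult_right_mono divide_right_mono mult_left_mono) auto
  finally have le: "4 * b * Q / n + 2 * a * D \<le> 8 * (real b)\<^sup>2 * x / (real n)\<^sup>2 + 6 * a * D"
    by simp
  have "freq n b (\<lambda>ys. 8 * (real b)\<^sup>2 * x / (real n)\<^sup>2 + 6 * a * D < real (card (pairs E (A \<inter> set ys))))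
      \<le> freq n b (\<lambda>ys. Q \<le> ?w ys \<or> (?w ys \<le> Q \<and> 2 * b * Q / n + a * D \<le> real (hits A ys)))"
  proof (intro freq_mono [OF n])
    fix ys
    assume *: "8 * (real b)\<^sup>2 * x / (real n)\<^sup>2 + 6 * a * D < real (card (pairs E (A \<inter> set ys)))"
    have "real (card (pairs E (A \<inter> set ys))) \<le> 2 * real (hits A ys)"
      using card_pairs_le_hits [OF E, of A ys] by linarith
    moreover have "2 * (2 * b * Q / n + a * D) = 4 * b * Q / n + 2 * a * D" by simp
    ultimately have "2 * b * Q / n + a * D \<le> real (hits A ys)" using le * by linarith
    then show "Q \<le> ?w ys \<or> (?w ys \<le> Q \<and> 2 * b * Q / n + a * D \<le> real (hits A ys))" by linarith
  qed
  also have "\<dots> \<le> freq n b (\<lambda>ys. Q \<le> ?w ys)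
      + freq n b (\<lambda>ys. ?w ys \<le> Q \<and> 2 * b * Q / n + a * D \<le> real (hits A ys))"
    by (rule freq_disj [OF n])
  also have "\<dots> \<le> exp (- a) + exp (- a)"
  proof (rule add_mono)
    show "freq n b (\<lambda>ys. Q \<le> ?w ys) \<le> exp (- a)"
      using freq_degree_sum [OF A D, of b a] by (simp add: Q_def)
    show "freq n b (\<lambda>ys. ?w ys \<le> Q \<and> 2 * b * Q / n + a * D \<le> real (hits A ys)) \<le> exp (- a)"
      using freq_hits [OF A D Q0, of b a] by simp
  qed
  finally show ?thesis by simp
qed

end

section \<open>Batches\<close>

text \<open>With the newest pick at the head, the last \<open>r\<close> entries are the first
  \<open>r\<close> picks: the history at time \<open>r\<close>.\<close>

definition recent :: "nat list \<Rightarrow> nat \<Rightarrow> nat list" where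
  "recent \<sigma> r = drop (length \<sigma> - r) \<sigma>"

lemma recent_split:
  assumes "r \<le> r'" "r' \<le> length \<sigma>"
  shows "recent \<sigma> r' = take (r' - r) (recent \<sigma> r') @ recent \<sigma> r"
proof -
  have "drop (r' - r) (recent \<sigma> r') = recent \<sigma> r"
    using assms by (simp add: recent_def)
  then show ?thesis by (metis append_take_drop_id)
qed

text \<open>The parameter \<kappa> is the exponent of the failure probability: each bad event has
  probability at most \<open>2 * n powr - \<kappa>\<close>.\<close>

locale schedule =
  fixes n :: nat and E :: "nat set set" and \<kappa> :: real
  assumes n2: "n \<ge> 2" and E: "simple_graph n E" and \<kappa>: "\<kappa> \<ge> 1"
begin

lemma n1: "n \<ge> 1" using n2 by simp

lemma no_loop: "{v} \<notin> E"
  using E by (auto simp: simple_graph_def)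

text \<open>Both bounds have \<open>r div 2\<close> in the denominator because each is achieved by
  one half of the picks.\<close>

definition good :: "nat \<Rightarrow> nat list \<Rightarrow> bool" where
  "good r zs \<longleftrightarrow>
     real (card (pairs E (alive E {..<n} zs))) \<le> 4 * (real n)\<^sup>2 / real (r div 2) \<and>
     (\<forall>v\<in>alive E {..<n} zs. real (deg E (alive E {..<n} zs) v) \<le> (\<kappa> + 1) * n * ln n / real (r div 2))"

text \<open>The earliest \<open>m\<close> picks bring all degrees down to \<open>D\<close>, except
  with probability \<open>n * exp (- D * m / n)\<close>. Conditioned on that, the later
  \<open>b\<close> picks reduce the pairs to \<open>x\<close>. With \<open>b \<ge> m\<close> the
  exponent of \<open>freq_pairs\<close> is at most \<open>- l * m / 4\<close>, and the hypothesis on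
  \<open>r div 2\<close> makes this at most \<open>- \<kappa> * ln n\<close>.\<close>

lemma freq_not_good:
  assumes r: "r \<ge> 2" "r \<le> n"
    and m: "4 * real (r div 2) \<ge> \<kappa> * (\<kappa> + 1)\<^sup>2 * ln n ^ 3"
  shows "freq n n (\<lambda>\<sigma>. \<not> good r (recent \<sigma> r)) \<le> 2 * real n powr - \<kappa>"
proof -
  define m where "m = r div 2"
  define b where "b = r - m"
  define D where "D = (\<kappa> + 1) * n * ln n / m"
  define x where "x = 4 * (real n)\<^sup>2 / m"
  \<comment> \<open>The largest \<open>l\<close> that \<open>freq_pairs\<close> admits: it makes
    \<open>l * D\<^sup>2 * n\<^sup>2 = x\<^sup>2\<close>.\<close>
  define l where "l = 16 / ((\<kappa> + 1)\<^sup>2 * (ln n)\<^sup>2)"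
  have m1: "m \<ge> 1" and bm: "b \<ge> m" and rbm: "r = b + m" using r by (auto simp: m_def b_def)
  have ln0: "ln (real n) > 0" using n2 by simp
  have D0: "D > 0" using \<kappa> n2 m1 ln0 by (simp add: D_def)
  have l0: "l > 0" using \<kappa> ln0 by (simp add: l_def)
  have x0: "x > 0" using n2 m1 by (simp add: x_def)
  have lD: "l * D\<^sup>2 * (real n)\<^sup>2 = x\<^sup>2"
  proof -
    have "(\<kappa> + 1) \<noteq> 0" using \<kappa> by simp
    then show ?thesis using ln0 n2 m1
      by (simp add: l_def D_def x_def power_divide power_mult_distrib)
  qed
  define G where "G zs \<longleftrightarrow> \<not> (\<exists>v\<in>alive E {..<n} zs. D \<le> real (deg E (alive E {..<n} zs) v))" for zs
  define X where "X zs = real (card (pairs E (alive E {..<n} zs)))" for zs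
  have "freq n n (\<lambda>\<sigma>. \<not> good r (recent \<sigma> r)) = freq n n (\<lambda>\<sigma>. \<not> good r (drop (n - r) \<sigma>))"
    unfolding freq_def by (intro arg_cong2 [where f = "(/)"] arg_cong [where f = real] arg_cong [where f = card])
      (auto simp: seqs_def recent_def)
  also have "\<dots> = freq n r (\<lambda>zs. \<not> good r zs)"
    using freq_drop [OF n1 r(2)] .
  also have "\<dots> \<le> freq n r (\<lambda>zs. \<not> G (drop b zs) \<or> (G (drop b zs) \<and> x \<le> X (take b zs @ drop b zs)))"
  proof (intro freq_mono [OF n1])
    fix zs assume zs: "\<not> good r zs"
    show "\<not> G (drop b zs) \<or> (G (drop b zs) \<and> x \<le> X (take b zs @ drop b zs))"
    proof (rule ccontr)
      assume "\<not> ?thesis"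
      then have G: "G (drop b zs)" and X: "X zs < x" by auto
      have sub: "alive E {..<n} zs \<subseteq> alive E {..<n} (drop b zs)"
        using alive_append [of E "{..<n}" "take b zs" "drop b zs"] alive_subset by simp
      have fin: "finite (alive E {..<n} (drop b zs))"
        by (rule finite_subset [OF alive_subset]) simp
      have "real (deg E (alive E {..<n} zs) v) \<le> D" if "v \<in> alive E {..<n} zs" for v
      proof -
        have "deg E (alive E {..<n} zs) v \<le> deg E (alive E {..<n} (drop b zs)) v"
          using sub fin by (rule deg_mono)
        moreover have "real (deg E (alive E {..<n} (drop b zs)) v) < D"
          using G sub that by (auto simp: G_def not_le)
        ultimately show ?thesis by linarith
      qed
      then show False
        using zs X less_imp_le unfolding good_def X_def x_def D_def m_def by blast
    qed
  qed
  also have "\<dots> \<le> freq n r (\<lambda>zs. \<not> G (drop b zs)) + freq n r (\<lambda>zs. G (drop b zs) \<and> x \<le> X (take b zs @ drop b zs))"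
    by (rule freq_disj [OF n1])
  also have "freq n r (\<lambda>zs. \<not> G (drop b zs)) \<le> real n powr - \<kappa>"
  proof -
    have "freq n r (\<lambda>zs. \<not> G (drop b zs)) = freq n m (\<lambda>zs. \<not> G zs)"
      using freq_drop [OF n1, of m r "\<lambda>zs. \<not> G zs"] by (simp add: rbm)
    also have "\<dots> \<le> real n * exp (- D * m / n)"
      unfolding G_def not_not using D0 by (intro freq_deg [OF n1]) auto
    also have "- D * m / n = - \<kappa> * ln n - ln n"
      using n2 m1 by (simp add: D_def field_simps)
    also have "real n * exp (- \<kappa> * ln n - ln n) = real n powr - \<kappa>"
      using n2 by (simp add: exp_diff powr_def)
    finally show ?thesis .
  qed
  also have "freq n r (\<lambda>zs. G (drop b zs) \<and> x \<le> X (take b zs @ drop b zs)) \<le> real n powr - \<kappa>"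
    unfolding rbm
  proof (rule freq_cond [OF n1, where Q = "\<lambda>ys zs. x \<le> X (ys @ zs)"])
    fix zs assume G: "G zs"
    have "freq n b (\<lambda>ys. x \<le> X (ys @ zs)) \<le> exp (- l * b / 2 + l * (real n)\<^sup>2 / x)"
      unfolding X_def alive_append
      by (rule freq_pairs [OF n1 alive_subset, where D = D])
         (use G x0 l0 lD in \<open>auto simp: G_def not_le intro: less_imp_le\<close>)
    also have "\<dots> \<le> exp (- \<kappa> * ln n)"
    proof -
      have "l * (real n)\<^sup>2 / x = l * m / 4" using n2 m1 by (simp add: x_def)
      moreover have "l * m \<le> l * b" using l0 bm by simp
      moreover have "\<kappa> * ln n \<le> l * m / 4"
      proof -
        have "\<kappa> * (\<kappa> + 1)\<^sup>2 * ln n ^ 3 \<le> 4 * m" using m by (simp add: m_def)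
        then have "\<kappa> * ln n * ((\<kappa> + 1)\<^sup>2 * (ln n)\<^sup>2) \<le> 4 * m"
          by (simp add: power2_eq_square power3_eq_cube mult_ac)
        then have "\<kappa> * ln n \<le> 4 * m / ((\<kappa> + 1)\<^sup>2 * (ln n)\<^sup>2)"
          using ln0 \<kappa> by (subst pos_le_divide_eq) auto
        then show ?thesis by (simp add: l_def)
      qed
      ultimately have "l * (real n)\<^sup>2 / x - l * b / 2 \<le> - (\<kappa> * ln n)" by argo
      then have "- l * b / 2 + l * (real n)\<^sup>2 / x \<le> - \<kappa> * ln n" by simp
      then show ?thesis by (simp only: exp_le_cancel_iff)
    qed
    also have "exp (- \<kappa> * ln n) = real n powr - \<kappa>" using n2 by (simp add: powr_def)
    finally show "freq n b (\<lambda>ys. x \<le> X (ys @ zs)) \<le> real n powr - \<kappa>" .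
  qed simp
  finally show ?thesis by simp
qed

text \<open>Picks made before time \<open>r\<close> are no longer alive, so only the fresh picks of
  the batch matter, and these are independent of the alive set.\<close>

lemma alive_Int_recent:
  assumes "r \<le> r'" "r' \<le> length \<sigma>"
  shows "alive E A (recent \<sigma> r) \<inter> set (recent \<sigma> r')
       = alive E A (recent \<sigma> r) \<inter> set (take (r' - r) (recent \<sigma> r'))"
  using alive_disjoint [of E A "recent \<sigma> r"]
  by (subst recent_split [OF assms]) auto

text \<open>The case \<open>a = \<kappa> * ln n\<close> of \<open>freq_stage\<close>, conditioned on
  a good history at time \<open>r\<close>.\<close>

lemma freq_stage_fails:
  assumes r: "2 \<le> r" "r \<le> r'" "r' \<le> n"
    and bound: "8 * (real (r' - r))\<^sup>2 * (4 * (real n)\<^sup>2 / real (r div 2)) / (real n)\<^sup>2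
        + 6 * (\<kappa> * ln n) * ((\<kappa> + 1) * n * ln n / real (r div 2)) \<le> B"
  shows "freq n n (\<lambda>\<sigma>. good r (recent \<sigma> r) \<and>
      B < real (card (pairs E (alive E {..<n} (recent \<sigma> r) \<inter> set (recent \<sigma> r'))))) \<le> 2 * real n powr - \<kappa>"
proof -
  define b where "b = r' - r"
  have r': "r' = b + r" using r by (simp add: b_def)
  let ?P = "\<lambda>ys zs. B < real (card (pairs E (alive E {..<n} zs \<inter> set ys)))"
  have ln0: "ln (real n) > 0" using n2 by simp
  have "freq n n (\<lambda>\<sigma>. good r (recent \<sigma> r) \<and>
      B < real (card (pairs E (alive E {..<n} (recent \<sigma> r) \<inter> set (recent \<sigma> r')))))
    \<le> freq n n (\<lambda>\<sigma>. (\<lambda>xs. good r (drop b xs) \<and> ?P (take b xs) (drop b xs)) (drop (n - r') \<sigma>))"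
  proof (intro freq_mono [OF n1])
    fix \<sigma> assume \<sigma>: "\<sigma> \<in> seqs n n"
      and *: "good r (recent \<sigma> r) \<and>
        B < real (card (pairs E (alive E {..<n} (recent \<sigma> r) \<inter> set (recent \<sigma> r'))))"
    have len: "length \<sigma> = n" using \<sigma> by (simp add: seqs_def)
    have "drop (n - r') \<sigma> = recent \<sigma> r'" "drop b (drop (n - r') \<sigma>) = recent \<sigma> r"
      using r by (simp_all add: recent_def len b_def)
    then show "good r (drop b (drop (n - r') \<sigma>)) \<and> ?P (take b (drop (n - r') \<sigma>)) (drop b (drop (n - r') \<sigma>))"
      using * alive_Int_recent [of r r' \<sigma> "{..<n}"] r len by (simp add: b_def)
  qed
  also have "\<dots> = freq n r' (\<lambda>xs. good r (drop b xs) \<and> ?P (take b xs) (drop b xs))"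
    using freq_drop [OF n1 r(3)] .
  also have "\<dots> \<le> 2 * real n powr - \<kappa>"
    unfolding r'
  proof (rule freq_cond [OF n1])
    fix zs assume zs: "good r zs"
    have m1: "r div 2 \<ge> 1" using r by simp
    have "freq n b (\<lambda>ys. ?P ys zs)
        \<le> freq n b (\<lambda>ys. 8 * (real b)\<^sup>2 * (4 * (real n)\<^sup>2 / real (r div 2)) / (real n)\<^sup>2
          + 6 * (\<kappa> * ln n) * ((\<kappa> + 1) * n * ln n / real (r div 2))
          < real (card (pairs E (alive E {..<n} zs \<inter> set ys))))"
    proof (intro freq_mono [OF n1])
      fix ys
      assume "?P ys zs"
      with bound show "8 * (real b)\<^sup>2 * (4 * (real n)\<^sup>2 / real (r div 2)) / (real n)\<^sup>2
          + 6 * (\<kappa> * ln n) * ((\<kappa> + 1) * n * ln n / real (r div 2))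
          < real (card (pairs E (alive E {..<n} zs \<inter> set ys)))"
        unfolding b_def by (rule le_less_trans)
    qed
    also have "\<dots> \<le> 2 * exp (- (\<kappa> * ln n))"
      by (rule freq_stage [OF n1 alive_subset])
         (use zs m1 \<kappa> n2 ln0 r no_loop in \<open>auto simp: good_def b_def\<close>)
    finally show "freq n b (\<lambda>ys. ?P ys zs) \<le> 2 * real n powr - \<kappa>"
      using n2 by (simp add: powr_def)
  qed simp
  finally show ?thesis .
qed

end

text \<open>
  The prescribed batches end at the positions \<open>r 0, \<dots>, r I\<close>. The protocol chooses its own batches
  greedily and is never behind them.
\<close>

definition scheduled :: "nat \<Rightarrow> nat \<Rightarrow> nat set set \<Rightarrow> nat \<Rightarrow> nat list \<Rightarrow> bool" where
  "scheduled C n E I \<sigma> \<longleftrightarrow> (\<exists>r. (\<forall>i\<le>I. r i \<le> n) \<and>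
     2 * card (pairs E (set (recent \<sigma> (r 0)))) \<le> C * n \<and>
     (\<forall>i<I. 2 * card (pairs E (alive E {..<n} (recent \<sigma> (r i)) \<inter> set (recent \<sigma> (r (Suc i))))) \<le> C * n) \<and>
     2 * card (pairs E (alive E {..<n} (recent \<sigma> (r I)))) \<le> C * n)"

text \<open>For the finitely many \<open>n\<close> below the range of the asymptotic estimates, the
  whole graph is affordable at once, so no pick has to precede it.\<close>

lemma scheduled_small:
  assumes "2 * n \<le> C" and "set \<sigma> \<subseteq> {..<n}"
  shows "scheduled C n E I \<sigma>"
proof -
  have small: "2 * card (pairs E A) \<le> C * n" if "A \<subseteq> {..<n}" for A
  proof -
    have "card (pairs E A) \<le> card ({..<n} \<times> {..<n})"
      using that by (intro card_mono) (auto simp: pairs_def)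
    then have "2 * card (pairs E A) \<le> 2 * n * n" by simp
    also have "\<dots> \<le> C * n" using assms by (intro mult_right_mono) auto
    finally show ?thesis .
  qed
  show ?thesis
    unfolding scheduled_def
    by (rule exI [of _ "\<lambda>_. 0"]) (auto simp: recent_def intro!: small)
qed

section \<open>The doubly exponential schedule\<close>

context schedule
begin

text \<open>A prescribed batch has at most \<open>256 * n\<close> pairs by the main term of
  \<open>freq_stage\<close> and \<open>n\<close> by its deviation; doubling as in
  \<open>scheduled\<close> gives \<open>514\<close>. The hypothesis \<open>big1\<close> bounds the
  deviation, \<open>big2\<close> feeds \<open>freq_not_good\<close>.\<close>

lemma freq_not_scheduled:
  assumes n16: "n \<ge> 16"
    and big1: "48 * \<kappa> * (\<kappa> + 1) * sqrt n * (ln n)\<^sup>2 \<le> n"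
    and big2: "\<kappa> * (\<kappa> + 1)\<^sup>2 * ln n ^ 3 \<le> sqrt n / 2"
    and deg: "\<And>v. v < n \<Longrightarrow> card (neighbors E v) \<le> 2 ^ 2 ^ I"
    and C: "C \<ge> 514"
  shows "freq n n (\<lambda>\<sigma>. \<not> scheduled C n E I \<sigma>) \<le> 4 * (real I + 1) * real n powr - \<kappa>"
proof -
  \<comment> \<open>Histories of length about \<open>sqrt n\<close> are long enough for
    \<open>freq_not_good\<close>, yet so few picks span at most \<open>s * s \<le> n\<close> pairs
    whatever the degrees are.\<close>
  define s where "s = nat \<lfloor>sqrt n\<rfloor>"
  \<comment> \<open>The target for \<open>n / r i\<close>: it bounds all degrees at
    \<open>i = 0\<close>, becomes its square root with each step, and is 2 at
    \<open>i = I\<close>.\<close>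
  define q :: "nat \<Rightarrow> nat" where "q i = 2 ^ 2 ^ (I - i)" for i
  define r where "r i = max s (n div q i)" for i
  have sq4: "sqrt (real n) \<ge> 4" using n16 real_le_rsqrt [of 4 "real n"] by simp
  have s_le: "real s \<le> sqrt n" by (simp add: s_def)
  have s_ge: "real s \<ge> sqrt n / 2" unfolding s_def using sq4 by linarith
  have ss: "s * s \<le> n"
  proof -
    have "real s * real s \<le> sqrt n * sqrt n" using s_le by (intro mult_mono) auto
    then show ?thesis by (simp flip: of_nat_mult)
  qed
  have s2: "s \<ge> 2" using s_ge sq4 by linarith
  have sn: "s \<le> n" using ss s2 by (metis le_square le_trans)
  have r: "2 \<le> r i" "s \<le> r i" "r i \<le> n" for i using s2 sn by (auto simp: r_def)
  have q0: "q i > 0" for i by (simp add: q_def)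
  have q_Suc: "q i = q (Suc i) * q (Suc i)" if "i < I" for i
  proof -
    have "I - i = Suc (I - Suc i)" using that by simp
    then show ?thesis by (simp add: q_def power_add [symmetric] mult_2)
  qed
  have r_Suc: "r i \<le> r (Suc i)" if "i < I" for i
  proof -
    have "n div q i \<le> n div q (Suc i)"
      unfolding q_Suc [OF that] using q0 by (intro div_le_mono2 le_square)
    then show ?thesis by (auto simp: r_def)
  qed
  have m_ge: "real (r i) \<le> 4 * real (r i div 2)" for i
  proof -
    have "r i \<le> 4 * (r i div 2)" using r(1) [of i] by linarith
    then show ?thesis by (metis of_nat_le_iff of_nat_mult of_nat_numeral)
  qed
  \<comment> \<open>Rounding in \<open>n div q i\<close> costs at most a factor 2, because
    \<open>r i\<close> is at least 1.\<close>
  have rq: "real n \<le> 2 * real (r i) * q i" for i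
  proof -
    have "n = n div q i * q i + n mod q i" by simp
    also have "\<dots> \<le> r i * q i + 1 * q i"
      using mod_less_divisor [OF q0, of n i] by (intro add_mono mult_right_mono) (auto simp: r_def)
    also have "\<dots> \<le> r i * q i + r i * q i"
      using r(1) [of i] by (intro add_left_mono mult_right_mono) auto
    finally show ?thesis by (metis of_nat_le_iff of_nat_mult of_nat_numeral mult.assoc mult_2)
  qed
  have x_le: "4 * (real n)\<^sup>2 / real (r i div 2) \<le> 16 * (real n)\<^sup>2 / r i" for i
  proof -
    have "4 * (real n)\<^sup>2 / real (r i div 2) = 16 * (real n)\<^sup>2 / (4 * real (r i div 2))" by simp
    also have "\<dots> \<le> 16 * (real n)\<^sup>2 / r i"
      using m_ge [of i] r(1) [of i] by (intro divide_left_mono) auto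
    finally show ?thesis .
  qed
  have aD_le: "6 * (\<kappa> * ln n) * ((\<kappa> + 1) * n * ln n / real (r i div 2)) \<le> n" for i
  proof -
    have m: "sqrt n / 8 \<le> real (r i div 2)" using m_ge [of i] r(2) [of i] s_ge by linarith
    have "6 * (\<kappa> * ln n) * ((\<kappa> + 1) * n * ln n / real (r i div 2))
        = 6 * \<kappa> * (\<kappa> + 1) * (ln n)\<^sup>2 * n / real (r i div 2)"
      by (simp add: power2_eq_square mult_ac)
    also have "\<dots> \<le> 6 * \<kappa> * (\<kappa> + 1) * (ln n)\<^sup>2 * n / (sqrt n / 8)"
    proof -
      have "0 < real (r i div 2)" using m sq4 by linarith
      then show ?thesis using m \<kappa> sq4 n2 by (intro divide_left_mono mult_pos_pos) auto
    qed
    also have "\<dots> = 48 * \<kappa> * (\<kappa> + 1) * sqrt n * (ln n)\<^sup>2"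
    proof -
      have "6 * \<kappa> * (\<kappa> + 1) * (ln n)\<^sup>2 * n / (sqrt n / 8)
          = 48 * \<kappa> * (\<kappa> + 1) * (ln n)\<^sup>2 * (n / sqrt n)" by simp
      then show ?thesis by (simp add: real_div_sqrt)
    qed
    also note big1
    finally show ?thesis .
  qed
  have bad1: "freq n n (\<lambda>\<sigma>. \<not> good (r i) (recent \<sigma> (r i))) \<le> 2 * real n powr - \<kappa>" for i
  proof (rule freq_not_good [OF r(1) r(3)])
    have "sqrt n / 2 \<le> 4 * real (r i div 2)"
      using m_ge [of i] r(2) [of i] s_ge by linarith
    then show "\<kappa> * (\<kappa> + 1)\<^sup>2 * ln n ^ 3 \<le> 4 * real (r i div 2)"
      using big2 by linarith
  qed
  let ?P = "\<lambda>i \<sigma>. card (pairs E (alive E {..<n} (recent \<sigma> (r i)) \<inter> set (recent \<sigma> (r (Suc i)))))"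
  have bad2: "freq n n (\<lambda>\<sigma>. good (r i) (recent \<sigma> (r i)) \<and> 257 * real n < real (?P i \<sigma>))
      \<le> 2 * real n powr - \<kappa>" if i: "i < I" for i
  proof (rule freq_stage_fails [OF r(1) r_Suc [OF i] r(3)])
    let ?b = "r (Suc i) - r i" and ?q = "q (Suc i)"
    \<comment> \<open>Either \<open>r (Suc i) = s\<close>, and then the batch is empty, or
      \<open>r (Suc i) = n div q (Suc i)\<close>.\<close>
    have "?b \<le> n div ?q"
      using r(2) [of i] unfolding r_def [of "Suc i"] by linarith
    then have "real ?b \<le> real (n div ?q)" by (rule of_nat_mono)
    then have b: "real ?b \<le> n / ?q"
      by (rule order_trans) (rule of_nat_div_le_of_nat)
    \<comment> \<open>The two factors \<open>1 / q (Suc i)\<close> from \<open>b\<^sup>2\<close>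
      multiply to \<open>1 / q i\<close>, which cancels
      \<open>n / r i \<le> 2 * q i\<close>.\<close>
    have "8 * (real ?b)\<^sup>2 * (4 * (real n)\<^sup>2 / real (r i div 2)) / (real n)\<^sup>2
        \<le> 8 * (n / ?q)\<^sup>2 * (16 * (real n)\<^sup>2 / r i) / (real n)\<^sup>2"
      using b x_le [of i] by (intro divide_right_mono mult_mono power_mono) auto
    also have "\<dots> = 128 * (real n)\<^sup>2 / (r i * real (?q * ?q))"
      using n2 by (simp add: power2_eq_square)
    also have "?q * ?q = q i" using q_Suc [OF i] ..
    also have "128 * (real n)\<^sup>2 / (r i * real (q i)) \<le> 256 * n"
    proof -
      have "real n * n \<le> real n * (2 * real (r i) * real (q i))" using rq [of i] by (intro mult_left_mono) auto
      moreover have "0 < real (r i) * real (q i)" using r(1) [of i] q0 [of i] by simp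
      ultimately show ?thesis
        by (subst pos_divide_le_eq) (simp_all add: power2_eq_square mult_ac)
    qed
    finally have "8 * (real ?b)\<^sup>2 * (4 * (real n)\<^sup>2 / real (r i div 2)) / (real n)\<^sup>2 \<le> 256 * n" .
    then show "8 * (real ?b)\<^sup>2 * (4 * (real n)\<^sup>2 / real (r i div 2)) / (real n)\<^sup>2
        + 6 * (\<kappa> * ln n) * ((\<kappa> + 1) * n * ln n / real (r i div 2)) \<le> 257 * real n"
      by (rule order_trans [OF add_mono [OF _ aD_le]]) simp
  qed
  \<comment> \<open>Nothing has been removed yet, so the bound is deterministic: it is quadratic in
    \<open>s\<close>, or uses that the given degrees are at most \<open>q 0\<close>.\<close>
  have first: "card (pairs E (set (recent \<sigma> (r 0)))) \<le> n" if \<sigma>: "\<sigma> \<in> seqs n n" for \<sigma>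
  proof -
    let ?S = "set (recent \<sigma> (r 0))"
    have len: "length \<sigma> = n" and "set \<sigma> \<subseteq> {..<n}" using \<sigma> by (auto simp: seqs_def)
    then have S: "?S \<subseteq> {..<n}"
      using set_drop_subset [of "n - r 0" \<sigma>] by (auto simp: recent_def)
    have finN: "finite (neighbors E v)" for v
    proof (rule finite_subset)
      have "u < n" if "{u, v} \<in> E" for u
        using bspec [OF E [unfolded simple_graph_def] that] by simp
      then show "neighbors E v \<subseteq> {..<n}" by (auto simp: neighbors_def)
    qed simp
    have cS: "card ?S \<le> r 0" using card_length [of "recent \<sigma> (r 0)"] r(3) [of 0] by (simp add: recent_def len)
    have dS: "deg E ?S v \<le> card ?S" for v by (intro card_mono) auto
    have dq: "deg E ?S v \<le> q 0" if "v \<in> ?S" for v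
    proof -
      have "deg E ?S v \<le> card (neighbors E v)" by (intro card_mono finN) simp
      also have "\<dots> \<le> q 0" using deg [of v] that S by (auto simp: q_def)
      finally show ?thesis .
    qed
    show ?thesis
    proof (cases "r 0 = s")
      case True
      have "card (pairs E ?S) \<le> (\<Sum>v\<in>?S. card ?S)"
        unfolding card_pairs [OF finite_set] by (intro sum_mono dS)
      also have "\<dots> = card ?S * card ?S" by simp
      also have "\<dots> \<le> s * s" using cS unfolding True by (intro mult_mono) auto
      also note ss
      finally show ?thesis .
    next
      case False
      then have r0: "r 0 = n div q 0" unfolding r_def by linarith
      have "card (pairs E ?S) \<le> (\<Sum>v\<in>?S. q 0)"
        unfolding card_pairs [OF finite_set] by (intro sum_mono dq)
      also have "\<dots> = card ?S * q 0" by simp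
      also have "\<dots> \<le> (n div q 0) * q 0" using cS unfolding r0 by (rule mult_right_mono) simp
      also have "\<dots> \<le> n" by (rule div_times_less_eq_dividend)
      finally show ?thesis .
    qed
  qed
  \<comment> \<open>Since \<open>q I = 2\<close>, at least \<open>n / 4\<close> picks have been made
    and all alive pairs together are affordable.\<close>
  have last: "real (card (pairs E (alive E {..<n} zs))) \<le> 257 * real n" if "good (r I) zs" for zs
  proof -
    have "real (card (pairs E (alive E {..<n} zs))) \<le> 4 * (real n)\<^sup>2 / real (r I div 2)"
      using that by (simp only: good_def)
    also have "\<dots> \<le> 16 * (real n)\<^sup>2 / r I" by (rule x_le)
    also have "\<dots> \<le> 16 * (real n)\<^sup>2 / (n / 4)"
    proof (intro divide_left_mono)
      show "real n / 4 \<le> r I" using rq [of I] by (simp add: q_def)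
    qed (use n2 r(1) [of I] in auto)
    also have "\<dots> \<le> 257 * real n" using n2 by (simp add: power2_eq_square)
    finally show ?thesis .
  qed
  have "freq n n (\<lambda>\<sigma>. \<not> scheduled C n E I \<sigma>)
    \<le> freq n n (\<lambda>\<sigma>. (\<exists>i\<in>{..I}. \<not> good (r i) (recent \<sigma> (r i))) \<or>
        (\<exists>i\<in>{..<I}. good (r i) (recent \<sigma> (r i)) \<and> 257 * real n < real (?P i \<sigma>)))"
  proof (intro freq_mono [OF n1], rule ccontr)
    fix \<sigma> assume \<sigma>: "\<sigma> \<in> seqs n n" and *: "\<not> scheduled C n E I \<sigma>"
      and ok: "\<not> ((\<exists>i\<in>{..I}. \<not> good (r i) (recent \<sigma> (r i))) \<or>
        (\<exists>i\<in>{..<I}. good (r i) (recent \<sigma> (r i)) \<and> 257 * real n < real (?P i \<sigma>)))"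
    have g: "good (r i) (recent \<sigma> (r i))" if "i \<le> I" for i
    proof (rule ccontr)
      assume "\<not> good (r i) (recent \<sigma> (r i))"
      then have "\<exists>i\<in>{..I}. \<not> good (r i) (recent \<sigma> (r i))"
        using that by (intro bexI [of _ i]) auto
      with ok show False by (simp only: simp_thms)
    qed
    have P: "real (?P i \<sigma>) \<le> 257 * real n" if "i < I" for i
    proof (rule ccontr)
      assume "\<not> real (?P i \<sigma>) \<le> 257 * real n"
      then have "good (r i) (recent \<sigma> (r i)) \<and> 257 * real n < real (?P i \<sigma>)"
        using g [of i] that by (simp only: not_le simp_thms less_imp_le)
      then have "\<exists>i\<in>{..<I}. good (r i) (recent \<sigma> (r i)) \<and> 257 * real n < real (?P i \<sigma>)"
        using that by (intro bexI [of _ i]) (simp_all only: lessThan_iff)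
      with ok show False by (simp only: simp_thms)
    qed
    have le: "2 * k \<le> C * n" if "real k \<le> 257 * real n" for k
    proof -
      have "k \<le> 257 * n" using that by linarith
      then have "2 * k \<le> 514 * n" by simp
      also have "\<dots> \<le> C * n" using C by (intro mult_right_mono) auto
      finally show ?thesis .
    qed
    have "scheduled C n E I \<sigma>"
      unfolding scheduled_def
    proof (intro exI [of _ r] conjI allI impI le)
      show "real (card (pairs E (set (recent \<sigma> (r 0))))) \<le> 257 * real n"
        using first [OF \<sigma>] by linarith
    qed (use r(3) P last [OF g [OF order_refl]] in blast)+
    with * show False ..
  qed
  also have "\<dots> \<le> freq n n (\<lambda>\<sigma>. \<exists>i\<in>{..I}. \<not> good (r i) (recent \<sigma> (r i)))
      + freq n n (\<lambda>\<sigma>. \<exists>i\<in>{..<I}. good (r i) (recent \<sigma> (r i)) \<and> 257 * real n < real (?P i \<sigma>))"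
    by (rule freq_disj [OF n1])
  also have "\<dots> \<le> (\<Sum>i\<in>{..I}. 2 * real n powr - \<kappa>) + (\<Sum>i\<in>{..<I}. 2 * real n powr - \<kappa>)"
    by (intro add_mono order_trans [OF freq_bex [OF n1]] sum_mono) (auto intro: bad1 bad2)
  also have "\<dots> \<le> 4 * (real I + 1) * real n powr - \<kappa>" by (simp add: algebra_simps)
  finally show ?thesis .
qed

end

theorem freq_not_scheduled_poly:
  fixes c :: nat
  obtains C where "C \<ge> 3" and
    "\<And>n E I. n \<ge> 1 \<Longrightarrow> simple_graph n E \<Longrightarrow> I \<le> n \<Longrightarrow> (\<And>v. v < n \<Longrightarrow> card (neighbors E v) \<le> 2 ^ 2 ^ I)
      \<Longrightarrow> freq n n (\<lambda>\<sigma>. \<not> scheduled C n E I \<sigma>) \<le> 1 / real n ^ c"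
proof -
  \<comment> \<open>Four powers of \<open>n\<close> are reserved for the union bound over the
    \<open>2 * I + 1\<close> bad events, where \<open>I \<le> n\<close>.\<close>
  define \<kappa> where "\<kappa> = real c + 4"
  have "\<kappa> > 0" by (simp add: \<kappa>_def)
  have "eventually (\<lambda>n::nat. 48 * \<kappa> * (\<kappa> + 1) * sqrt n * (ln n)\<^sup>2 \<le> n) at_top"
    using \<open>\<kappa> > 0\<close> by real_asymp
  moreover have "eventually (\<lambda>n::nat. \<kappa> * (\<kappa> + 1)\<^sup>2 * ln n ^ 3 \<le> sqrt n / 2) at_top"
    using \<open>\<kappa> > 0\<close> by real_asymp
  ultimately have "eventually (\<lambda>n::nat. 48 * \<kappa> * (\<kappa> + 1) * sqrt n * (ln n)\<^sup>2 \<le> n \<and>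
      \<kappa> * (\<kappa> + 1)\<^sup>2 * ln n ^ 3 \<le> sqrt n / 2) at_top"
    by (rule eventually_conj)
  then obtain n0 where
    "\<forall>n\<ge>n0. 48 * \<kappa> * (\<kappa> + 1) * sqrt (real n) * (ln (real n))\<^sup>2 \<le> real n \<and>
      \<kappa> * (\<kappa> + 1)\<^sup>2 * ln (real n) ^ 3 \<le> sqrt (real n) / 2"
    unfolding eventually_at_top_linorder by blast
  then have n0: "n \<ge> n0 \<Longrightarrow> 48 * \<kappa> * (\<kappa> + 1) * sqrt (real n) * (ln (real n))\<^sup>2 \<le> real n"
      "n \<ge> n0 \<Longrightarrow> \<kappa> * (\<kappa> + 1)\<^sup>2 * ln (real n) ^ 3 \<le> sqrt (real n) / 2" for n :: nat
    by blast+
  \<comment> \<open>The summand \<open>2 * n0\<close> lets \<open>scheduled_small\<close> handle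
    \<open>n < n0\<close>, and \<open>514\<close> lets it handle \<open>n < 16\<close>.\<close>
  define C where "C = 514 + 2 * n0"
  show ?thesis
  proof
    show "C \<ge> 3" by (simp add: C_def)
    fix n :: nat and E I
    assume n: "n \<ge> 1" and E: "simple_graph n E" and I: "I \<le> n"
      and deg: "\<And>v. v < n \<Longrightarrow> card (neighbors E v) \<le> 2 ^ 2 ^ I"
    show "freq n n (\<lambda>\<sigma>. \<not> scheduled C n E I \<sigma>) \<le> 1 / real n ^ c"
    proof (cases "n \<ge> n0 \<and> n \<ge> 16")
      case True
      interpret schedule n E \<kappa> using True E by unfold_locales (auto simp: \<kappa>_def)
      have "freq n n (\<lambda>\<sigma>. \<not> scheduled C n E I \<sigma>) \<le> 4 * (real I + 1) * real n powr - \<kappa>"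
      proof (rule freq_not_scheduled)
        show "card (neighbors E v) \<le> 2 ^ 2 ^ I" if "v < n" for v using that by (rule deg)
      qed (use True n0 [of n] in \<open>simp_all add: C_def\<close>)
      also have "\<dots> \<le> real n ^ 4 * real n powr - \<kappa>"
      proof (rule mult_right_mono)
        have "16 * n \<le> n * n" using True by (intro mult_right_mono) auto
        moreover have "4 * (I + 1) \<le> 16 * n" using I n by simp
        ultimately have "4 * (I + 1) \<le> n * n" by (rule order_trans [rotated])
        then have "real (4 * (I + 1)) \<le> real (n * n)" by (rule of_nat_mono)
        then have "4 * (real I + 1) \<le> (real n)\<^sup>2" by (simp add: power2_eq_square algebra_simps)
        also have "\<dots> \<le> real n ^ 4" using n by (intro power_increasing) auto
        finally show "4 * (real I + 1) \<le> real n ^ 4" .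
      qed simp
      also have "\<dots> = 1 / real n ^ c"
      proof -
        have "real n ^ 4 * real n powr - \<kappa> = real n powr (4 + - \<kappa>)"
          using n by (subst powr_add) simp
        also have "4 + - \<kappa> = - real c" by (simp add: \<kappa>_def)
        also have "real n powr - real c = 1 / real n ^ c"
          using n by (simp add: powr_minus powr_realpow divide_inverse)
        finally show ?thesis .
      qed
      finally show ?thesis .
    next
      case False
      then have "2 * n \<le> C" by (auto simp: C_def)
      then have "scheduled C n E I \<sigma>" if "\<sigma> \<in> seqs n n" for \<sigma>
        using that by (intro scheduled_small) (auto simp: seqs_def)
      then have "{\<sigma> \<in> seqs n n. \<not> scheduled C n E I \<sigma>} = {}" by blast
      then show ?thesis by (simp only: freq_def card.empty) simp
    qed
  qed
qed

section \<open>The protocol\<close>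

text \<open>
  Local computation is arbitrary, so states and messages may be encoded by any injection, and only
  the number of possible values matters for their length.
\<close>

definition code :: "'a set \<Rightarrow> 'a \<Rightarrow> bits" where
  "code X = (SOME f. inj_on f X \<and> (\<forall>b. card X \<le> 2 ^ b \<longrightarrow> (\<forall>x\<in>X. length (f x) \<le> b)))"

definition decode :: "'a set \<Rightarrow> bits \<Rightarrow> 'a" where
  "decode X = inv_into X (code X)"

text \<open>Lists of the least sufficient length \<open>b\<close> satisfy all the length bounds at
  once.\<close>

lemma code_exists:
  assumes "finite X"
  shows "\<exists>f :: 'a \<Rightarrow> bits. inj_on f X \<and> (\<forall>b. card X \<le> 2 ^ b \<longrightarrow> (\<forall>x\<in>X. length (f x) \<le> b))"
proof -
  define b where "b = (LEAST b. card X \<le> 2 ^ b)"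
  have b: "card X \<le> 2 ^ b"
    unfolding b_def by (rule LeastI [of _ "card X"]) (simp add: less_imp_le)
  let ?B = "{xs :: bits. set xs \<subseteq> UNIV \<and> length xs = b}"
  have "card X \<le> card ?B" using b by (simp only: card_lists_length_eq [OF finite] card_UNIV_bool)
  moreover have "finite ?B" by (rule finite_lists_length_eq) simp
  ultimately obtain f where f: "f ` X \<subseteq> ?B" "inj_on f X"
    using card_le_inj [OF assms] by blast
  have "length (f x) \<le> b'" if "card X \<le> 2 ^ b'" "x \<in> X" for b' x
    using f(1) that(2) Least_le [of "\<lambda>b. card X \<le> 2 ^ b", OF that(1)] by (auto simp: b_def)
  then show ?thesis using f(2) by blast
qed

lemma decode_code [simp]: "finite X \<Longrightarrow> x \<in> X \<Longrightarrow> decode X (code X x) = x"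
  and length_code: "finite X \<Longrightarrow> x \<in> X \<Longrightarrow> card X \<le> 2 ^ b \<Longrightarrow> length (code X x) \<le> b"
  unfolding decode_def code_def using someI_ex [OF code_exists [of X]] by (auto intro: inv_into_f_f)

definition all_edges :: "nat \<Rightarrow> nat set set" where
  "all_edges n = {e. e \<subseteq> {..<n} \<and> card e = 2}"

lemma simple_graph_all_edges: "simple_graph n E \<longleftrightarrow> E \<subseteq> all_edges n"
  by (auto simp: simple_graph_def all_edges_def)

lemma finite_all_edges [simp]: "finite (all_edges n)"
  by (rule finite_subset [of _ "Pow {..<n}"]) (auto simp: all_edges_def)

lemma card_all_edges: "card (all_edges n) = n choose 2"
  unfolding all_edges_def by (subst n_subsets) simp_all

lemma card_all_edges_le: "card (all_edges n) \<le> n\<^sup>2"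
  unfolding card_all_edges choose_two power2_eq_square
  by (rule order_trans [OF div_le_dividend]) (simp add: mult_le_mono2)

definition inside :: "nat set set \<Rightarrow> nat set \<Rightarrow> nat set set" where
  "inside F S = {e \<in> F. e \<subseteq> S}"

fun chosen :: "nat set set \<Rightarrow> nat set \<Rightarrow> nat list \<Rightarrow> nat set" where
  "chosen E A [] = {}"
| "chosen E A (x # xs) = (if x \<in> alive E A xs then insert x (chosen E A xs) else chosen E A xs)"

lemma chosen_subset: "chosen E A xs \<subseteq> A"
proof (induction xs)
  case (Cons x xs)
  then show ?case using alive_subset [of E A xs] by auto
qed simp

definition encode_edge :: "nat \<Rightarrow> nat set \<Rightarrow> nat" where
  "encode_edge n e = Min e * n + Max e"

definition decode_edge :: "nat \<Rightarrow> nat \<Rightarrow> nat set" where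
  "decode_edge n c = {c div n, c mod n}"

lemma decode_encode_edge:
  assumes "e \<in> all_edges n"
  shows "decode_edge n (encode_edge n e) = e" "encode_edge n e < n\<^sup>2"
proof -
  obtain u v where e: "e = {u, v}" "u \<noteq> v" using assms by (auto simp: all_edges_def card_2_iff)
  then have uv: "u < n" "v < n" using assms by (auto simp: all_edges_def)
  have m: "Min e < n" "Max e < n" "e = {Min e, Max e}" using e uv by (auto simp: min_def max_def)
  show "decode_edge n (encode_edge n e) = e"
    using m by (simp add: decode_edge_def encode_edge_def)
  have "Min e * n + Max e < Min e * n + n" using m by simp
  also have "\<dots> = Suc (Min e) * n" by simp
  also have "\<dots> \<le> n * n" using m by (intro mult_right_mono) auto
  finally show "encode_edge n e < n\<^sup>2" by (simp add: encode_edge_def power2_eq_square)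
qed

definition edge_codes :: "nat \<Rightarrow> nat set set \<Rightarrow> nat list" where
  "edge_codes n F = sorted_list_of_set (encode_edge n ` F)"

lemma edge_codes:
  assumes "F \<subseteq> all_edges n"
  shows "decode_edge n ` set (edge_codes n F) = F" "length (edge_codes n F) = card F"
    "\<And>c. c \<in> set (edge_codes n F) \<Longrightarrow> c < n\<^sup>2"
proof -
  have fin: "finite F" using assms by (rule finite_subset) simp
  have id: "decode_edge n (encode_edge n e) = e" if "e \<in> F" for e
    using that assms decode_encode_edge(1) by blast
  then have "inj_on (encode_edge n) F" by (metis inj_onI)
  then show "length (edge_codes n F) = card F" by (simp add: edge_codes_def card_image)
  show "decode_edge n ` set (edge_codes n F) = F" using fin id by (force simp: edge_codes_def)
  show "c < n\<^sup>2" if "c \<in> set (edge_codes n F)" for c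
    using that fin assms decode_encode_edge(2) by (auto simp: edge_codes_def)
qed

text \<open>
  The common knowledge of all machines: phase, random sample, number of positions of the order that
  are processed in the current stage, alive vertices, chosen vertices, and the number of edges that
  each machine contributes to the current stage. Phase \<open>0\<close> distributes the sample, phases \<open>1\<close> to
  \<open>4\<close> make up a stage, and phase \<open>5\<close> is the end.
\<close>

type_synonym know = "nat \<times> nat list \<times> nat \<times> nat set \<times> nat set \<times> nat list"

text \<open>The newest element comes first, so that the tail \<open>[0..<n]\<close> of the order is at the front.\<close>

definition order :: "nat \<Rightarrow> nat list \<Rightarrow> nat list" where
  "order n \<sigma> = [0..<n] @ \<sigma>"

text \<open>The contribution of machine \<open>i\<close> to position \<open>p\<close> of the summed
  vector. In phase 2 the positions are the machines themselves. The prefix sums of the resulting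
  counts assign disjoint intervals to the machines, where they write their edges in phase 3, so
  summation superimposes the lists without mixing them. \<open>Suc\<close> separates the edge code 0
  from an empty position.\<close>

fun word :: "nat \<Rightarrow> nat \<Rightarrow> nat set set \<times> nat list \<Rightarrow> know \<Rightarrow> nat \<Rightarrow> nat" where
  "word n i (F, \<rho>) (ph, \<sigma>, r, A, I, v) p =
     (if ph = 0 then (if i = 0 \<and> p < n then \<rho> ! p else 0)
      else if ph = 1 then card (inside F (A \<inter> set (recent (order n \<sigma>) p)))
      else if ph = 2 then (if p = i then card (inside F (A \<inter> set (recent (order n \<sigma>) r))) else 0)
      else if ph = 3 then
        (let cs = edge_codes n (inside F (A \<inter> set (recent (order n \<sigma>) r))); s = sum_list (take i v)
         in if s \<le> p \<and> p < s + length cs then Suc (cs ! (p - s)) else 0)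
      else of_bool (\<exists>u\<in>I. {u, p} \<in> F))"

text \<open>All machines receive the same sums and so reach the same knowledge. Phase 3 can rerun
  the greedy process over the whole prefix because earlier picks are dead.\<close>

fun advance :: "nat \<Rightarrow> nat \<Rightarrow> nat \<Rightarrow> know \<Rightarrow> (nat \<Rightarrow> nat) \<Rightarrow> know" where
  "advance C n k (ph, \<sigma>, r, A, I, v) y =
     (if ph = 0 then (1, map y [0..<n], r, A, I, v)
      else if ph = 1 then (2, \<sigma>, Max (insert 0 {p \<in> {..2 * n}. y p \<le> C * n}), A, I, v)
      else if ph = 2 then (3, \<sigma>, r, A, I, map y [0..<k])
      else if ph = 3 then
        (4, \<sigma>, r, A, I \<union> chosen (decode_edge n ` {c. \<exists>p<C * n. y p = Suc c})
          (A \<inter> set (recent (order n \<sigma>) r)) (recent (order n \<sigma>) r), v)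
      else let A' = A - I - {p. 0 < y p} in (if A' = {} then 5 else 1, \<sigma>, r, A', I, v))"

abbreviation finished :: "know \<Rightarrow> bool" where
  "finished K \<equiv> fst K = 5"

abbreviation mis :: "know \<Rightarrow> nat set" where
  "mis K \<equiv> fst (snd (snd (snd (snd K))))"

definition start_know :: "nat \<Rightarrow> nat \<Rightarrow> know" where
  "start_know n k = (0, replicate n 0, 0, {..<n}, {}, replicate k 0)"

text \<open>Exceeds every subtotal: at most \<open>2 * n\<close> machines contribute at most
  \<open>n\<^sup>2\<close> each.\<close>

definition words :: "nat \<Rightarrow> nat" where
  "words n = 2 * n ^ 3 + 1"

definition knows :: "nat \<Rightarrow> nat \<Rightarrow> know set" where
  "knows n k = {..5} \<times> seqs (words n) n \<times> {..2 * n} \<times> Pow {..<n} \<times> Pow {..<n} \<times> seqs (words n) k"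

text \<open>The number of positions served by one machine: \<open>p < C * n\<close> gives
  \<open>p div k \<le> C * n div k\<close>.\<close>

definition block :: "nat \<Rightarrow> nat \<Rightarrow> nat \<Rightarrow> nat" where
  "block C n k = C * n div k + 1"

text \<open>The local edge sets range over \<open>fam\<close>, a parameter because its size decides
  how many bits the input occupies.\<close>

definition states :: "nat \<Rightarrow> (nat \<Rightarrow> nat set set set) \<Rightarrow> nat \<Rightarrow> nat
    \<Rightarrow> ((nat set set \<times> nat list) \<times> know \<times> nat list option) set" where
  "states C fam n k = (fam n \<times> seqs n n) \<times> knows n k \<times> insert None (Some ` seqs (words n) (block C n k))"

text \<open>
  Two rounds compute the vector of subtotals \<open>\<lambda>p. \<Sum>i<k. word n i (d i) K p\<close> for \<open>p < C * n\<close>: machine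
  \<open>j\<close> first collects the words at the positions \<open>j, j + k, j + 2 * k, \<dots>\<close> and then sends their subtotals
  to all machines.
\<close>

definition mis_protocol :: "nat \<Rightarrow> (nat \<Rightarrow> nat set set set) \<Rightarrow> (nat \<Rightarrow> 'i \<Rightarrow> nat set set)
    \<Rightarrow> (nat \<Rightarrow> nat set \<Rightarrow> 'o) \<Rightarrow> ('i, 'o) protocol" where
  "mis_protocol C fam edges out = \<lparr>
     start = (\<lambda>n k i inp. map_pmf (\<lambda>\<rho>. code (states C fam n k) ((edges i inp, \<rho>), start_know n k, None))
       (if i = 0 then pmf_of_set (seqs n n) else return_pmf (replicate n 0))),
     send = (\<lambda>n k i s j. code (seqs (words n) (block C n k)) (case decode (states C fam n k) s of
         (d, K, None) \<Rightarrow> map (\<lambda>t. word n i d K (j + t * k)) [0..<block C n k]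
       | (d, K, Some ys) \<Rightarrow> ys)),
     update = (\<lambda>n k i s m. return_pmf (code (states C fam n k) (case decode (states C fam n k) s of
         (d, K, None) \<Rightarrow> (d, K, Some (map (\<lambda>t. \<Sum>j<k. decode (seqs (words n) (block C n k)) (m j) ! t)
           [0..<block C n k]))
       | (d, K, Some ys) \<Rightarrow> (d, advance C n k K (\<lambda>p. if p < C * n
           then decode (seqs (words n) (block C n k)) (m (p mod k)) ! (p div k) else 0), None)))),
     result = (\<lambda>n k i s. case decode (states C fam n k) s of
         (d, K, None) \<Rightarrow> if finished K then Some (out i (mis K)) else None
       | (d, K, Some ys) \<Rightarrow> None) \<rparr>"

text \<open>\<open>C \<ge> 3\<close> gives the vector room for the candidate ends
  \<open>0, ..., 2 * n\<close> of phase 1 and for one position per machine in phase 2.\<close>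

locale execution =
  fixes C :: nat and fam :: "nat \<Rightarrow> nat set set set" and edges :: "nat \<Rightarrow> 'i \<Rightarrow> nat set set"
    and out :: "nat \<Rightarrow> nat set \<Rightarrow> 'o" and n k :: nat and inp :: "nat \<Rightarrow> 'i"
  assumes n1: "n \<ge> 1" and k: "1 \<le> k" "k \<le> 2 * n" and C3: "C \<ge> 3"
    and fam_Pow: "fam n \<subseteq> Pow (all_edges n)"
    and fam: "\<And>i. i < k \<Longrightarrow> edges i (inp i) \<in> fam n"
begin

definition data :: "nat list \<Rightarrow> nat \<Rightarrow> nat set set \<times> nat list" where
  "data \<rho> i = (edges i (inp i), if i = 0 then \<rho> else replicate n 0)"

definition total :: "nat list \<Rightarrow> know \<Rightarrow> nat \<Rightarrow> nat" where
  "total \<rho> K p = (if p < C * n then \<Sum>i<k. word n i (data \<rho> i) K p else 0)"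

definition proceed :: "nat list \<Rightarrow> know \<Rightarrow> know" where
  "proceed \<rho> K = (if finished K then K else advance C n k K (total \<rho> K))"

definition conf :: "nat list \<Rightarrow> know \<Rightarrow> (nat \<Rightarrow> nat list option) \<Rightarrow> config" where
  "conf \<rho> K t = (\<lambda>i. if i < k then code (states C fam n k) (data \<rho> i, K, t i) else [])"

definition subtotals :: "nat list \<Rightarrow> know \<Rightarrow> nat \<Rightarrow> nat list" where
  "subtotals \<rho> K j = map (\<lambda>t. \<Sum>i<k. word n i (data \<rho> i) K (j + t * k)) [0..<block C n k]"

abbreviation "full \<rho> K \<equiv> conf \<rho> K (\<lambda>_. None)"
abbreviation "half \<rho> K \<equiv> conf \<rho> K (\<lambda>i. Some (subtotals \<rho> K i))"
abbreviation "protocol \<equiv> mis_protocol C fam edges out"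

lemma finite_knows: "finite (knows n k)"
  by (simp add: knows_def)

lemma finite_states: "finite (states C fam n k)"
proof -
  have "finite (fam n)" by (rule finite_subset [OF fam_Pow]) simp
  then show ?thesis by (simp add: states_def finite_knows)
qed

lemma word_le:
  assumes "F \<in> fam n" "\<rho> \<in> seqs n n"
  shows "word n i (F, \<rho>) K p \<le> n\<^sup>2"
proof -
  obtain ph \<sigma> r A I v where K: "K = (ph, \<sigma>, r, A, I, v)" by (metis surj_pair)
  have F: "F \<subseteq> all_edges n" using assms fam_Pow by blast
  have ins: "inside F S \<subseteq> all_edges n" for S using F by (auto simp: inside_def)
  have card: "card (inside F S) \<le> n\<^sup>2" for S
    by (rule order_trans [OF card_mono [OF finite_all_edges ins] card_all_edges_le])
  have \<rho>: "\<rho> ! p \<le> n\<^sup>2" if "p < n"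
  proof -
    have "\<rho> ! p \<in> set \<rho>" using assms that by (simp add: seqs_def)
    then have "\<rho> ! p < n" using assms by (auto simp: seqs_def)
    also have "n \<le> n\<^sup>2" by (simp add: power2_eq_square)
    finally show ?thesis by simp
  qed
  have cs: "Suc (edge_codes n (inside F S) ! t) \<le> n\<^sup>2" if "t < length (edge_codes n (inside F S))" for t S
    using edge_codes(3) [OF ins, OF nth_mem [OF that]] by simp
  have n2: "1 \<le> n\<^sup>2" using n1 by simp
  consider "ph = 0" | "ph = 1" | "ph = 2" | "ph = 3" | "ph \<notin> {0, 1, 2, 3}" by blast
  then show ?thesis
  proof cases
    case 1
    then show ?thesis using \<rho> by (simp add: K)
  next
    case 2
    then show ?thesis using card by (simp add: K)
  next
    case 3
    then show ?thesis using card by (simp add: K)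
  next
    case 4
    let ?cs = "edge_codes n (inside F (A \<inter> set (recent (order n \<sigma>) r)))"
    have "Suc (?cs ! (p - sum_list (take i v))) \<le> n\<^sup>2"
      if "sum_list (take i v) \<le> p" "p < sum_list (take i v) + length ?cs"
      using that by (intro cs) linarith
    then show ?thesis using 4 by (simp add: K Let_def)
  next
    case 5
    then show ?thesis using n2 by (simp add: K)
  qed
qed

lemma data_mem: "i < k \<Longrightarrow> \<rho> \<in> seqs n n \<Longrightarrow> data \<rho> i \<in> fam n \<times> seqs n n"
  using fam n1 by (auto simp: data_def seqs_def)

lemma word_data_le: "i < k \<Longrightarrow> \<rho> \<in> seqs n n \<Longrightarrow> word n i (data \<rho> i) K p \<le> n\<^sup>2"
  using word_le data_mem by (metis mem_Sigma_iff prod.collapse)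

lemma sum_words:
  assumes "\<rho> \<in> seqs n n"
  shows "(\<Sum>i<k. word n i (data \<rho> i) K p) < words n"
proof -
  have "(\<Sum>i<k. word n i (data \<rho> i) K p) \<le> (\<Sum>i<k. n\<^sup>2)"
    using word_data_le assms by (intro sum_mono) auto
  also have "\<dots> \<le> 2 * n * n\<^sup>2" using k by simp
  finally show ?thesis by (simp add: words_def power3_eq_cube power2_eq_square)
qed

lemma total_words: "\<rho> \<in> seqs n n \<Longrightarrow> total \<rho> K p < words n"
  using sum_words by (simp add: total_def words_def)

lemma subtotals_mem: "\<rho> \<in> seqs n n \<Longrightarrow> subtotals \<rho> K j \<in> seqs (words n) (block C n k)"
  using sum_words [of \<rho> K] unfolding subtotals_def seqs_def [of "words n"] by auto

lemma words_mem:
  assumes "i < k" "\<rho> \<in> seqs n n"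
  shows "map (\<lambda>t. word n i (data \<rho> i) K (j + t * k)) [0..<block C n k] \<in> seqs (words n) (block C n k)"
proof -
  have "word n i (data \<rho> i) K p < words n" for p
  proof -
    have "n\<^sup>2 \<le> n ^ 3" using n1 by (intro power_increasing) auto
    then show ?thesis using word_data_le [OF assms, of K p] by (simp add: words_def)
  qed
  then show ?thesis by (auto simp: seqs_def)
qed

text \<open>Keeps the knowledge inside the finite set on which \<open>code\<close> is injective, so
  that decoding stays exact.\<close>

lemma advance_knows:
  assumes K: "K \<in> knows n k" "\<not> finished K" and y: "\<And>p. y p < words n"
  shows "advance C n k K y \<in> knows n k"
proof -
  obtain ph \<sigma> r A I v where K': "K = (ph, \<sigma>, r, A, I, v)" by (metis surj_pair)
  have "Max (insert 0 {p \<in> {..2 * n}. y p \<le> C * n}) \<le> 2 * n"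
    by (intro Max.boundedI) auto
  moreover have "map y xs \<in> seqs (words n) (length xs)" for xs
    using y by (auto simp: seqs_def)
  then have "map y [0..<m] \<in> seqs (words n) m" for m by (metis length_upt minus_nat.diff_0)
  moreover have "chosen H (A \<inter> S) xs \<subseteq> {..<n}" for H S xs
    using chosen_subset [of H "A \<inter> S" xs] K by (auto simp: K' knows_def)
  ultimately show ?thesis using K unfolding K' knows_def
    by (auto simp: Let_def)
qed

lemma proceed_knows: "K \<in> knows n k \<Longrightarrow> \<rho> \<in> seqs n n \<Longrightarrow> proceed \<rho> K \<in> knows n k"
  by (simp add: proceed_def advance_knows total_words)

lemma start_know_mem: "start_know n k \<in> knows n k"
  by (auto simp: start_know_def knows_def seqs_def words_def)

lemma full_mem: "i < k \<Longrightarrow> \<rho> \<in> seqs n n \<Longrightarrow> K \<in> knows n k \<Longrightarrow> (data \<rho> i, K, None) \<in> states C fam n k"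
  using data_mem by (simp add: states_def)

lemma half_mem: "i < k \<Longrightarrow> \<rho> \<in> seqs n n \<Longrightarrow> K \<in> knows n k
    \<Longrightarrow> (data \<rho> i, K, Some (subtotals \<rho> K i)) \<in> states C fam n k"
  using data_mem subtotals_mem by (simp add: states_def)

section \<open>One summation in two rounds\<close>

context
  fixes \<rho> K
  assumes \<rho>: "\<rho> \<in> seqs n n" and K: "K \<in> knows n k"
begin

lemma decode_full: "i < k \<Longrightarrow> decode (states C fam n k) (full \<rho> K i) = (data \<rho> i, K, None)"
  by (simp add: conf_def full_mem finite_states \<rho> K)

lemma decode_half: "i < k \<Longrightarrow> decode (states C fam n k) (half \<rho> K i) = (data \<rho> i, K, Some (subtotals \<rho> K i))"
  by (simp add: conf_def half_mem finite_states \<rho> K)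

lemma halted_full: "i < k \<Longrightarrow> halted protocol n k (full \<rho> K) i \<longleftrightarrow> finished K"
  by (simp add: halted_def mis_protocol_def decode_full)

lemma result_full: "i < k \<Longrightarrow> finished K \<Longrightarrow> result protocol n k i (full \<rho> K i) = Some (out i (mis K))"
  by (simp add: mis_protocol_def decode_full)

lemma halted_half: "i < k \<Longrightarrow> \<not> halted protocol n k (half \<rho> K) i"
  by (simp add: halted_def mis_protocol_def decode_half)

lemma send_full: "i < k \<Longrightarrow> send protocol n k i (full \<rho> K i) j = code (seqs (words n) (block C n k))
    (map (\<lambda>t. word n i (data \<rho> i) K (j + t * k)) [0..<block C n k])"
  by (simp add: mis_protocol_def decode_full)

lemma send_half: "i < k \<Longrightarrow> send protocol n k i (half \<rho> K i) j
    = code (seqs (words n) (block C n k)) (subtotals \<rho> K i)"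
  by (simp add: mis_protocol_def decode_half)

lemma update_full: "i < k \<Longrightarrow> update protocol n k i (full \<rho> K i) m
    = return_pmf (code (states C fam n k) (data \<rho> i, K, Some (map (\<lambda>t. \<Sum>j<k.
        decode (seqs (words n) (block C n k)) (m j) ! t) [0..<block C n k])))"
  by (simp add: mis_protocol_def decode_full)

lemma update_half: "i < k \<Longrightarrow> update protocol n k i (half \<rho> K i) m
    = return_pmf (code (states C fam n k) (data \<rho> i, advance C n k K (\<lambda>p. if p < C * n
        then decode (seqs (words n) (block C n k)) (m (p mod k)) ! (p div k) else 0), None))"
  by (simp add: mis_protocol_def decode_half)

lemma message_full:
  assumes "i < k" "j < k" "\<not> finished K"
  shows "message protocol n k (full \<rho> K) i j = code (seqs (words n) (block C n k))
    (map (\<lambda>t. word n i (data \<rho> i) K (j + t * k)) [0..<block C n k])"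
  using assms by (simp add: message_def halted_full send_full)

lemma message_half:
  assumes "i < k" "j < k"
  shows "message protocol n k (half \<rho> K) i j = code (seqs (words n) (block C n k)) (subtotals \<rho> K i)"
  using assms by (simp add: message_def halted_half send_half)

lemma message_finished: "finished K \<Longrightarrow> message protocol n k (full \<rho> K) i j = []"
  by (auto simp: message_def halted_full)

lemma round_full:
  assumes "\<not> finished K"
  shows "round_step protocol n k (full \<rho> K) = return_pmf (half \<rho> K)"
proof -
  have "round_step protocol n k (full \<rho> K) = Pi_pmf {..<k} [] (\<lambda>i. return_pmf (half \<rho> K i))"
    unfolding round_step_def
  proof (intro Pi_pmf_cong refl)
    fix i assume "i \<in> {..<k}"
    then have i: "i < k" by simp
    have "decode (seqs (words n) (block C n k)) (message protocol n k (full \<rho> K) j i) ! t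
        = word n j (data \<rho> j) K (i + t * k)" if "j < k" "t < block C n k" for j t
      using that i assms words_mem [OF _ \<rho>] by (simp add: message_full)
    then have "map (\<lambda>t. \<Sum>j<k. decode (seqs (words n) (block C n k)) (message protocol n k (full \<rho> K) j i) ! t)
        [0..<block C n k] = subtotals \<rho> K i"
      unfolding subtotals_def by (intro map_cong sum.cong refl) auto
    then show "(if halted protocol n k (full \<rho> K) i then return_pmf (full \<rho> K i)
        else update protocol n k i (full \<rho> K i) (\<lambda>j. message protocol n k (full \<rho> K) j i))
      = return_pmf (half \<rho> K i)"
      using i assms by (simp add: halted_full update_full) (simp add: conf_def)
  qed
  also have "\<dots> = return_pmf (half \<rho> K)"
    by (subst Pi_pmf_return_pmf) (auto simp: conf_def fun_eq_iff)
  finally show ?thesis .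
qed

lemma round_half:
  assumes "\<not> finished K"
  shows "round_step protocol n k (half \<rho> K) = return_pmf (full \<rho> (proceed \<rho> K))"
proof -
  have "round_step protocol n k (half \<rho> K) = Pi_pmf {..<k} [] (\<lambda>i. return_pmf (full \<rho> (proceed \<rho> K) i))"
    unfolding round_step_def
  proof (intro Pi_pmf_cong refl)
    fix i assume "i \<in> {..<k}"
    then have i: "i < k" by simp
    have "(if p < C * n then decode (seqs (words n) (block C n k))
        (message protocol n k (half \<rho> K) (p mod k) i) ! (p div k) else 0) = total \<rho> K p" for p
    proof (cases "p < C * n")
      case True
      have pk: "p mod k < k" using k by simp
      have "p div k < block C n k"
        using True div_le_mono [of p "C * n" k] by (simp add: block_def)
      then have "subtotals \<rho> K (p mod k) ! (p div k) = total \<rho> K p"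
        using True by (simp add: total_def subtotals_def)
      then show ?thesis
        using True i pk subtotals_mem [OF \<rho>] by (simp add: message_half)
    qed (simp add: total_def)
    then show "(if halted protocol n k (half \<rho> K) i then return_pmf (half \<rho> K i)
        else update protocol n k i (half \<rho> K i) (\<lambda>j. message protocol n k (half \<rho> K) j i))
      = return_pmf (full \<rho> (proceed \<rho> K) i)"
      using i assms by (simp add: halted_half update_half proceed_def) (simp add: conf_def)
  qed
  also have "\<dots> = return_pmf (full \<rho> (proceed \<rho> K))"
    by (subst Pi_pmf_return_pmf) (auto simp: conf_def fun_eq_iff)
  finally show ?thesis .
qed

lemma round_finished:
  assumes "finished K"
  shows "round_step protocol n k (full \<rho> K) = return_pmf (full \<rho> K)"
proof -
  have "round_step protocol n k (full \<rho> K) = Pi_pmf {..<k} [] (\<lambda>i. return_pmf (full \<rho> K i))"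
    unfolding round_step_def by (intro Pi_pmf_cong refl) (use assms in \<open>simp add: halted_full\<close>)
  also have "\<dots> = return_pmf (full \<rho> K)"
    by (subst Pi_pmf_return_pmf) (auto simp: conf_def fun_eq_iff)
  finally show ?thesis .
qed

end

text \<open>Only machine 0 tosses coins, so the product distribution collapses to one uniform
  sample.\<close>

lemma initial_eq:
  "initial protocol n k inp = map_pmf (\<lambda>\<rho>. full \<rho> (start_know n k)) (pmf_of_set (seqs n n))"
proof -
  let ?c = "\<lambda>i \<rho>. code (states C fam n k) ((edges i (inp i), \<rho>), start_know n k, None)"
  let ?g = "\<lambda>i. if i \<in> {..<k} - {0} then ?c i (replicate n 0) else []"
  have "{..<k} = insert 0 ({..<k} - {0})" using k by auto
  then have "initial protocol n k inp
      = Pi_pmf (insert 0 ({..<k} - {0})) [] (\<lambda>i. start protocol n k i (inp i))"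
    unfolding initial_def by simp
  also have "\<dots> = do {x \<leftarrow> start protocol n k 0 (inp 0);
      f \<leftarrow> Pi_pmf ({..<k} - {0}) [] (\<lambda>i. start protocol n k i (inp i)); return_pmf (f(0 := x))}"
    by (rule Pi_pmf_insert') auto
  also have "Pi_pmf ({..<k} - {0}) [] (\<lambda>i. start protocol n k i (inp i))
      = Pi_pmf ({..<k} - {0}) [] (\<lambda>i. return_pmf (?c i (replicate n 0)))"
    by (intro Pi_pmf_cong) (auto simp: mis_protocol_def)
  also have "\<dots> = return_pmf ?g"
    by (rule Pi_pmf_return_pmf) simp
  also have "start protocol n k 0 (inp 0) = map_pmf (?c 0) (pmf_of_set (seqs n n))"
    by (simp add: mis_protocol_def)
  also have "do {x \<leftarrow> map_pmf (?c 0) (pmf_of_set (seqs n n)); f \<leftarrow> return_pmf ?g; return_pmf (f(0 := x))}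
      = map_pmf (\<lambda>\<rho>. ?g(0 := ?c 0 \<rho>)) (pmf_of_set (seqs n n))"
    by (simp add: bind_return_pmf map_pmf_def bind_assoc_pmf)
  also have "\<dots> = map_pmf (\<lambda>\<rho>. full \<rho> (start_know n k)) (pmf_of_set (seqs n n))"
    using k by (intro map_pmf_cong refl) (auto simp: conf_def data_def fun_eq_iff)
  finally show ?thesis .
qed

lemma seqs_ne: "seqs n n \<noteq> {}"
  using card_seqs [of n n] n1 by (metis card.empty power_eq_0_iff not_one_le_zero)

lemma iterate_knows: "\<rho> \<in> seqs n n \<Longrightarrow> (proceed \<rho> ^^ t) (start_know n k) \<in> knows n k"
  by (induction t) (auto simp: start_know_mem proceed_knows)

text \<open>After the sample is drawn everything is deterministic. The limits hold in every
  configuration of the two kinds, so no run crashes.\<close>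

lemma run_eq:
  assumes ok: "\<And>\<rho> K. \<rho> \<in> seqs n n \<Longrightarrow> K \<in> knows n k \<Longrightarrow> ok (full \<rho> K)"
    "\<And>\<rho> K. \<rho> \<in> seqs n n \<Longrightarrow> K \<in> knows n k \<Longrightarrow> ok (half \<rho> K)"
  shows "run protocol ok n k inp (2 * t)
    = map_pmf (\<lambda>\<rho>. Some (full \<rho> ((proceed \<rho> ^^ t) (start_know n k)))) (pmf_of_set (seqs n n))"
proof (induction t)
  case 0
  then show ?case
    using seqs_ne by (simp add: initial_eq pmf.map_comp)
      (intro map_pmf_cong, auto simp: limit_def ok start_know_mem)
next
  case (Suc t)
  let ?K = "\<lambda>\<rho>. (proceed \<rho> ^^ t) (start_know n k)"
  define step where "step x = (case x of None \<Rightarrow> return_pmf None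
    | Some s \<Rightarrow> map_pmf (limit ok) (round_step protocol n k s))" for x
  \<comment> \<open>Two rounds make one application of \<open>proceed\<close>, also after the end,
    where halted machines and \<open>proceed\<close> both stand still.\<close>
  have two: "bind_pmf (step (Some (full \<rho> (?K \<rho>)))) step = return_pmf (Some (full \<rho> (proceed \<rho> (?K \<rho>))))"
    if \<rho>: "\<rho> \<in> seqs n n" for \<rho>
  proof (cases "finished (?K \<rho>)")
    case True
    then show ?thesis
      using \<rho> ok iterate_knows [OF \<rho>]
      by (simp add: step_def round_finished limit_def bind_return_pmf proceed_def)
  next
    case False
    then show ?thesis
      using \<rho> ok iterate_knows [OF \<rho>] proceed_knows
      by (simp add: step_def round_full round_half limit_def bind_return_pmf)
  qed
  have "run protocol ok n k inp (2 * Suc t) = bind_pmf (bind_pmf (run protocol ok n k inp (2 * t)) step) step"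
    by (simp add: step_def [abs_def])
  also have "\<dots> = bind_pmf (pmf_of_set (seqs n n)) (\<lambda>\<rho>. bind_pmf (step (Some (full \<rho> (?K \<rho>)))) step)"
    unfolding Suc.IH by (simp add: bind_map_pmf bind_assoc_pmf)
  also have "\<dots> = bind_pmf (pmf_of_set (seqs n n)) (\<lambda>\<rho>. return_pmf (Some (full \<rho> (proceed \<rho> (?K \<rho>)))))"
    using two seqs_ne by (intro bind_pmf_cong refl) auto
  finally show ?case by (simp add: map_pmf_def)
qed

lemma prob_run:
  assumes ok: "\<And>\<rho> K. \<rho> \<in> seqs n n \<Longrightarrow> K \<in> knows n k \<Longrightarrow> ok (full \<rho> K)"
    "\<And>\<rho> K. \<rho> \<in> seqs n n \<Longrightarrow> K \<in> knows n k \<Longrightarrow> ok (half \<rho> K)"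
    and success: "\<And>\<rho>. \<rho> \<in> seqs n n \<Longrightarrow> Q \<rho> \<Longrightarrow> success (full \<rho> ((proceed \<rho> ^^ t) (start_know n k)))"
  shows "measure_pmf.prob (run protocol ok n k inp (2 * t)) (Some ` {s. success s}) \<ge> freq n n Q"
proof -
  let ?g = "\<lambda>\<rho>. Some (full \<rho> ((proceed \<rho> ^^ t) (start_know n k)))"
  have "measure_pmf.prob (run protocol ok n k inp (2 * t)) (Some ` {s. success s})
      = measure_pmf.prob (pmf_of_set (seqs n n)) (?g -` (Some ` {s. success s}))"
    by (simp add: run_eq [OF ok])
  also have "\<dots> = real (card (seqs n n \<inter> ?g -` (Some ` {s. success s}))) / real (card (seqs n n))"
    by (rule measure_pmf_of_set [OF seqs_ne]) simp
  also have "\<dots> \<ge> freq n n Q"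
    unfolding freq_def card_seqs of_nat_power
    using success by (intro divide_right_mono of_nat_mono card_mono) auto
  finally show ?thesis by simp
qed

end

section \<open>Correctness of the protocol\<close>

lemma chosen_append: "chosen E A (xs @ ys) = chosen E (alive E A ys) xs \<union> chosen E A ys"
  by (induction xs) (auto simp: alive_append)

text \<open>The alive set is determined by the chosen set without reference to the order of picks.
  This is how phase 4 recomputes it.\<close>

lemma alive_eq: "alive E A xs = A - chosen E A xs - (\<Union>u\<in>chosen E A xs. neighbors E u)"
proof (induction xs)
  case (Cons x xs)
  then show ?case by (auto simp: pick_def)
qed simp

lemma alive_idle: "A \<inter> set xs = {} \<Longrightarrow> alive E A xs = A"
  by (induction xs) (auto simp: pick_def)

lemma chosen_idle: "A \<inter> set xs = {} \<Longrightarrow> chosen E A xs = {}"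
  by (induction xs) (auto simp: alive_idle)

text \<open>Greedy decisions on picks from \<open>T\<close> only look at edges inside
  \<open>A \<inter> T\<close>, so these edges are all that must be communicated for a batch.\<close>

lemma chosen_local:
  assumes "set xs \<subseteq> T"
  shows "chosen (inside E (A \<inter> T)) (A \<inter> T) xs = chosen E A xs
    \<and> alive (inside E (A \<inter> T)) (A \<inter> T) xs = alive E A xs \<inter> T"
  using assms
proof (induction xs)
  case (Cons x xs)
  let ?H = "inside E (A \<inter> T)" and ?B = "alive E A xs"
  have IH: "chosen ?H (A \<inter> T) xs = chosen E A xs" "alive ?H (A \<inter> T) xs = ?B \<inter> T"
    using Cons by simp_all
  have x: "x \<in> T" and B: "?B \<subseteq> A" using Cons.prems alive_subset [of E A xs] by simp_all
  have "pick ?H x (?B \<inter> T) = pick E x ?B \<inter> T"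
    using x B by (auto simp: pick_def neighbors_def inside_def)
  then show ?case using IH x by simp
qed simp

text \<open>The later of two chosen vertices was alive when picked, hence not adjacent to the
  earlier one.\<close>

lemma chosen_independent:
  assumes "\<And>v. {v} \<notin> E" and "u \<in> chosen E A xs" "v \<in> chosen E A xs"
  shows "{u, v} \<notin> E"
  using assms(2,3)
proof (induction xs)
  case (Cons x xs)
  have "{w, x} \<notin> E \<and> {x, w} \<notin> E" if "x \<in> alive E A xs" "w \<in> chosen E A xs" for w
    using that unfolding alive_eq by (auto simp: neighbors_def insert_commute)
  then show ?case using Cons assms(1) [of x] by (auto split: if_splits)
qed simp

lemma maximal_independent_chosen:
  assumes E: "simple_graph n E" and "alive E {..<n} xs = {}"
  shows "maximal_independent_set n E (chosen E {..<n} xs)"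
proof -
  let ?I = "chosen E {..<n} xs"
  have loop: "{v} \<notin> E" for v using E by (auto simp: simple_graph_def)
  have ind: "independent_set n E ?I"
    using chosen_subset [of E "{..<n}" xs] chosen_independent [OF loop]
    by (auto simp: independent_set_def)
  have "\<not> independent_set n E (insert v ?I)" if v: "v \<in> {..<n} - ?I" for v
  proof -
    have "v \<in> (\<Union>u\<in>?I. neighbors E u)" using v assms(2) unfolding alive_eq by blast
    then obtain u where "u \<in> ?I" "{v, u} \<in> E" by (auto simp: neighbors_def)
    then show ?thesis by (auto simp: independent_set_def)
  qed
  with ind show ?thesis by (simp add: maximal_independent_set_def)
qed

lemma recent_order: "length \<sigma> = n \<Longrightarrow> r \<le> n \<Longrightarrow> recent (order n \<sigma>) r = recent \<sigma> r"
  by (simp add: recent_def order_def)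

text \<open>Replaying the processed prefix on its own alive set is idle. Hence the protocol need not
  remember where the previous batch ended.\<close>

lemma alive_recent_resume:
  assumes "p \<le> r" "r \<le> length \<tau>"
  shows "alive E (alive E A (recent \<tau> p)) (recent \<tau> r) = alive E A (recent \<tau> r)"
    and "chosen E A (recent \<tau> p) \<union> chosen E (alive E A (recent \<tau> p)) (recent \<tau> r) = chosen E A (recent \<tau> r)"
proof -
  let ?B = "alive E A (recent \<tau> p)"
  have idle: "alive E ?B (recent \<tau> p) = ?B" "chosen E ?B (recent \<tau> p) = {}"
    using alive_disjoint [of E A "recent \<tau> p"] by (simp_all add: alive_idle chosen_idle)
  obtain zs where zs: "recent \<tau> r = zs @ recent \<tau> p"
    using recent_split [OF assms] ..
  show "alive E ?B (recent \<tau> r) = alive E A (recent \<tau> r)"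
    unfolding zs alive_append idle ..
  show "chosen E A (recent \<tau> p) \<union> chosen E ?B (recent \<tau> r) = chosen E A (recent \<tau> r)"
    unfolding zs chosen_append idle by blast
qed

lemma alive_recent_antimono:
  assumes "p \<le> r" "r \<le> length \<tau>"
  shows "alive E A (recent \<tau> r) \<subseteq> alive E A (recent \<tau> p)"
proof -
  obtain zs where zs: "recent \<tau> r = zs @ recent \<tau> p"
    using recent_split [OF assms] ..
  show ?thesis unfolding zs alive_append by (rule alive_subset)
qed

lemma sum_list_take_map: "i \<le> k \<Longrightarrow> sum_list (take i (map f [0..<k])) = (\<Sum>j<i. f j :: nat)"
  by (simp add: take_map interv_sum_list_conv_sum_set_nat atLeast0LessThan)

text \<open>The intervals \<open>{off i..<off i + len i}\<close> partition an initial segment of the positions.\<close>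

lemma gather_positions:
  fixes cs :: "nat \<Rightarrow> nat list"
  defines "off \<equiv> \<lambda>i. \<Sum>j<i. length (cs j)"
  assumes P: "(\<Sum>i<k. length (cs i)) \<le> P"
  shows "{c. \<exists>p<P. (\<Sum>i<k. if off i \<le> p \<and> p < off i + length (cs i) then Suc (cs i ! (p - off i)) else 0) = Suc c}
    = (\<Union>i<k. set (cs i))" (is "{c. \<exists>p<P. ?s p = Suc c} = _")
proof -
  let ?in = "\<lambda>i p. off i \<le> p \<and> p < off i + length (cs i)"
  have mono: "off i + length (cs i) \<le> off j" if "i < j" for i j
  proof -
    have "off i + length (cs i) = off (Suc i)" by (simp add: off_def)
    also have "\<dots> \<le> off j" unfolding off_def using that by (intro sum_mono2) auto
    finally show ?thesis .
  qed
  have unique: "i = j" if "?in i p" "?in j p" for i j p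
  proof (rule ccontr)
    assume "i \<noteq> j"
    then consider "i < j" | "j < i" by linarith
    then show False using mono [of i j] mono [of j i] that by cases linarith+
  qed
  \<comment> \<open>The intervals are disjoint, so at most one machine contributes at
    \<open>p\<close>.\<close>
  have s: "?s p = Suc (cs i ! (p - off i))" if "i < k" "?in i p" for i p
  proof -
    have "?s p = (\<Sum>j<k. if j = i then Suc (cs i ! (p - off i)) else 0)"
    proof (intro sum.cong refl)
      fix j
      show "(if ?in j p then Suc (cs j ! (p - off j)) else 0) = (if j = i then Suc (cs i ! (p - off i)) else 0)"
      proof (cases "j = i")
        case True
        then show ?thesis using that(2) by (simp only: if_True simp_thms)
      next
        case False
        then have "\<not> ?in j p" using unique [OF that(2)] by metis
        then show ?thesis using False by (simp only: if_False)
      qed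
    qed
    then show ?thesis using that(1) by simp
  qed
  show ?thesis
  proof (intro equalityI subsetI)
    fix c assume "c \<in> {c. \<exists>p<P. ?s p = Suc c}"
    then obtain p where p: "p < P" "?s p = Suc c" by blast
    have "\<exists>i<k. ?in i p"
    proof (rule ccontr)
      assume none: "\<not> ?thesis"
      have "?s p = 0"
      proof (intro sum.neutral ballI if_not_P notI)
        fix i assume "i \<in> {..<k}" "?in i p"
        then have "\<exists>i<k. ?in i p" by (intro exI [of _ i]) simp
        with none show False ..
      qed
      with p(2) show False by simp
    qed
    then obtain i where i: "i < k" "?in i p" by blast
    then have "c = cs i ! (p - off i)" using s p by simp
    moreover have "p - off i < length (cs i)" using i by linarith
    ultimately have "c \<in> set (cs i)" by simp
    with i(1) show "c \<in> (\<Union>i<k. set (cs i))" by blast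
  next
    fix c assume "c \<in> (\<Union>i<k. set (cs i))"
    then obtain i t where i: "i < k" "t < length (cs i)" "c = cs i ! t" by (auto simp: in_set_conv_nth)
    have "?s (off i + t) = Suc (cs i ! (off i + t - off i))"
      using i by (intro s) simp_all
    then have "?s (off i + t) = Suc c" using i(3) by (simp only: add_diff_cancel_left')
    moreover have "off i + t < P"
      using mono [OF i(1)] i(2) P by (simp add: off_def)
    ultimately show "c \<in> {c. \<exists>p<P. ?s p = Suc c}" by blast
  qed
qed

text \<open>Several machines may hold the same edge, as both endpoints do in the clique. Therefore
  the total load, not the number of edges, is compared with the ordered pairs.\<close>

locale mis_execution = execution C fam edges out n k inp
  for C :: nat and fam :: "nat \<Rightarrow> nat set set set" and edges :: "nat \<Rightarrow> 'i \<Rightarrow> nat set set"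
    and out :: "nat \<Rightarrow> nat set \<Rightarrow> 'o" and n k :: nat and inp :: "nat \<Rightarrow> 'i" +
  fixes E :: "nat set set"
  assumes E: "simple_graph n E"
    and edges_union: "(\<Union>i<k. edges i (inp i)) = E"
    and load: "\<And>S. S \<subseteq> {..<n} \<Longrightarrow>
      (\<Sum>i<k. card (inside (edges i (inp i)) S)) \<le> 2 * card (pairs E S)"
begin

abbreviation "F i \<equiv> edges i (inp i)"
abbreviation "load_of S \<equiv> (\<Sum>i<k. card (inside (F i) S))"

lemma Cn: "2 * n < C * n" "k \<le> C * n"
proof -
  have "3 * n \<le> C * n" using C3 by (intro mult_right_mono) auto
  then show "2 * n < C * n" "k \<le> C * n" using n1 k by linarith+
qed

lemma F_subset: "i < k \<Longrightarrow> F i \<subseteq> all_edges n"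
  using fam fam_Pow by blast

section \<open>The protocol simulates the greedy process\<close>

context
  fixes \<rho> :: "nat list"
  assumes \<rho>: "\<rho> \<in> seqs n n"
begin

abbreviation "\<tau> \<equiv> order n \<rho>"
abbreviation "Al p \<equiv> alive E {..<n} (recent \<tau> p)"
abbreviation "Ch p \<equiv> chosen E {..<n} (recent \<tau> p)"

lemma length_order: "length \<tau> = 2 * n"
  using \<rho> by (simp add: order_def seqs_def)

text \<open>The knowledge between stages after \<open>p\<close> processed positions. The values
  \<open>r\<close> and \<open>v\<close> are leftovers that the next stage overwrites.\<close>

definition boundary :: "nat \<Rightarrow> know \<Rightarrow> bool" where
  "boundary p K \<longleftrightarrow> p \<le> 2 * n \<and> (\<exists>r v. K = (if Al p = {} then 5 else 1, \<rho>, r, Al p, Ch p, v))"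

lemma proceed_start: "boundary 0 (proceed \<rho> (start_know n k))"
proof -
  have "map (total \<rho> (start_know n k)) [0..<n] = \<rho>"
  proof (rule nth_equalityI)
    fix p assume "p < length (map (total \<rho> (start_know n k)) [0..<n])"
    then have p: "p < n" by simp
    have "total \<rho> (start_know n k) p = (\<Sum>i<k. if i = 0 then \<rho> ! p else 0)"
    proof -
      have "p < C * n" using p Cn(1) by linarith
      then show ?thesis using p by (auto simp: total_def start_know_def data_def intro!: sum.cong)
    qed
    also have "\<dots> = \<rho> ! p" using k by simp
    finally show "map (total \<rho> (start_know n k)) [0..<n] ! p = \<rho> ! p" using p by simp
  qed (use \<rho> in \<open>simp add: seqs_def\<close>)
  moreover have "{..<n} \<noteq> {}" using n1 by (simp add: lessThan_empty_iff)
  ultimately show ?thesis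
    by (simp add: boundary_def proceed_def start_know_def recent_def)
qed

lemma total_count:
  assumes "p \<le> 2 * n"
  shows "total \<rho> (Suc 0, \<rho>, r, A, I, v) p = load_of (A \<inter> set (recent \<tau> p))"
proof -
  have "p < C * n" using assms Cn(1) by linarith
  then show ?thesis by (simp add: total_def data_def)
qed

lemma total_loads:
  assumes "p < k"
  shows "total \<rho> (2, \<rho>, r, A, I, v) p = card (inside (F p) (A \<inter> set (recent \<tau> r)))"
proof -
  have "p < C * n" using assms Cn(2) by linarith
  then show ?thesis using assms by (simp add: total_def data_def)
qed

lemma gathered:
  fixes A r
  defines "S \<equiv> A \<inter> set (recent \<tau> r)"
  assumes "load_of S \<le> C * n"
  shows "decode_edge n ` {c. \<exists>p<C * n. total \<rho> (3, \<rho>, r, A, I, map (\<lambda>i. card (inside (F i) S)) [0..<k]) p = Suc c}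
    = inside E S"
proof -
  define cs where "cs i = edge_codes n (inside (F i) S)" for i
  have ins: "inside (F i) S \<subseteq> all_edges n" if "i < k" for i
    using F_subset [OF that] by (auto simp: inside_def)
  have len: "length (cs i) = card (inside (F i) S)" if "i < k" for i
    using edge_codes(2) [OF ins [OF that]] by (simp add: cs_def)
  have off: "sum_list (take i (map (\<lambda>i. card (inside (F i) S)) [0..<k])) = (\<Sum>j<i. length (cs j))" if "i < k" for i
    using that len by (simp only: sum_list_take_map less_imp_le) (intro sum.cong refl, simp)
  have "{c. \<exists>p<C * n. total \<rho> (3, \<rho>, r, A, I, map (\<lambda>i. card (inside (F i) S)) [0..<k]) p = Suc c}
      = {c. \<exists>p<C * n. (\<Sum>i<k. if (\<Sum>j<i. length (cs j)) \<le> p \<and> p < (\<Sum>j<i. length (cs j)) + length (cs i)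
          then Suc (cs i ! (p - (\<Sum>j<i. length (cs j)))) else 0) = Suc c}"
  proof -
    have "total \<rho> (3, \<rho>, r, A, I, map (\<lambda>i. card (inside (F i) S)) [0..<k]) p
        = (\<Sum>i<k. if (\<Sum>j<i. length (cs j)) \<le> p \<and> p < (\<Sum>j<i. length (cs j)) + length (cs i)
          then Suc (cs i ! (p - (\<Sum>j<i. length (cs j)))) else 0)" if "p < C * n" for p
    proof -
      have "word n i (data \<rho> i) (3, \<rho>, r, A, I, map (\<lambda>i. card (inside (F i) S)) [0..<k]) p
          = (if (\<Sum>j<i. length (cs j)) \<le> p \<and> p < (\<Sum>j<i. length (cs j)) + length (cs i)
            then Suc (cs i ! (p - (\<Sum>j<i. length (cs j)))) else 0)" if "i < k" for i
        by (simp add: data_def Let_def off [OF that] flip: S_def cs_def)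
      then show ?thesis using that by (simp add: total_def)
    qed
    then show ?thesis by auto
  qed
  also have "\<dots> = (\<Union>i<k. set (cs i))"
    by (rule gather_positions) (use assms(2) len in simp)
  finally have "decode_edge n ` {c. \<exists>p<C * n. total \<rho> (3, \<rho>, r, A, I, map (\<lambda>i. card (inside (F i) S)) [0..<k]) p = Suc c}
      = (\<Union>i<k. decode_edge n ` set (cs i))" by (simp add: image_UN)
  also have "\<dots> = (\<Union>i<k. inside (F i) S)"
    using edge_codes(1) [OF ins] by (simp add: cs_def)
  also have "\<dots> = inside E S" using edges_union by (auto simp: inside_def)
  finally show ?thesis .
qed

lemma total_dead:
  assumes "p < n"
  shows "0 < total \<rho> (4, \<rho>, r, A, I, v) p \<longleftrightarrow> p \<in> (\<Union>u\<in>I. neighbors E u)"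
proof -
  have "p < C * n" using assms Cn by linarith
  then have "total \<rho> (4, \<rho>, r, A, I, v) p = 0 \<longleftrightarrow> \<not> (\<exists>i<k. \<exists>u\<in>I. {u, p} \<in> F i)"
    by (auto simp: total_def data_def)
  then have "0 < total \<rho> (4, \<rho>, r, A, I, v) p \<longleftrightarrow> (\<exists>i<k. \<exists>u\<in>I. {u, p} \<in> F i)"
    by (simp only: neq0_conv [symmetric] simp_thms)
  also have "\<dots> \<longleftrightarrow> (\<exists>u\<in>I. {u, p} \<in> E)" using edges_union by blast
  finally show ?thesis by (auto simp: neighbors_def insert_commute)
qed

text \<open>The second conjunct expresses greediness: no affordable position lies beyond the chosen
  end. The comparison with the schedule uses only this.\<close>

lemma stage:
  assumes "boundary p K" "\<not> finished K"
  shows "\<exists>p'. boundary p' ((proceed \<rho> ^^ 4) K) \<and>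
    (\<forall>q\<le>2 * n. load_of (Al p \<inter> set (recent \<tau> q)) \<le> C * n \<longrightarrow> q \<le> p')"
proof -
  obtain r v where K: "K = (1, \<rho>, r, Al p, Ch p, v)" and p: "p \<le> 2 * n"
    using assms by (auto simp: boundary_def split: if_splits)
  define good where "good = insert 0 {q \<in> {..2 * n}. load_of (Al p \<inter> set (recent \<tau> q)) \<le> C * n}"
  define p' where "p' = Max good"
  let ?S = "Al p \<inter> set (recent \<tau> p')"
  have fin: "finite good" by (simp add: good_def)
  have le: "q \<le> p'" if "q \<le> 2 * n" "load_of (Al p \<inter> set (recent \<tau> q)) \<le> C * n" for q
    unfolding p'_def using that by (intro Max_ge fin) (simp add: good_def)
  \<comment> \<open>Edges have two endpoints, so the empty batch is free and position 0 is always a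
    legitimate candidate.\<close>
  have zero: "load_of {} = 0"
  proof -
    have "inside (F i) {} = {}" if "i < k" for i
      using F_subset [OF that] by (auto simp: inside_def all_edges_def)
    then show ?thesis by simp
  qed
  have "p' \<in> good" unfolding p'_def by (rule Max_in [OF fin]) (simp add: good_def)
  then have p': "p' \<le> 2 * n" "load_of ?S \<le> C * n"
    using zero by (auto simp: good_def recent_def)
  \<comment> \<open>Progress is never lost: all picks up to \<open>p\<close> are dead, so position
    \<open>p\<close> itself costs nothing.\<close>
  have pp': "p \<le> p'"
    using le [OF p] alive_disjoint [of E "{..<n}" "recent \<tau> p"] zero by simp
  have K1: "proceed \<rho> K = (2, \<rho>, p', Al p, Ch p, v)"
  proof -
    have "{q \<in> {..2 * n}. total \<rho> K q \<le> C * n} = {q \<in> {..2 * n}. load_of (Al p \<inter> set (recent \<tau> q)) \<le> C * n}"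
      unfolding K by (intro Collect_cong conj_cong refl) (simp add: total_count)
    then show ?thesis by (simp add: proceed_def K p'_def good_def)
  qed
  define v' where "v' = map (\<lambda>i. card (inside (F i) ?S)) [0..<k]"
  have K2: "proceed \<rho> (2, \<rho>, p', Al p, Ch p, v) = (3, \<rho>, p', Al p, Ch p, v')"
    by (simp add: proceed_def v'_def total_loads)
  have ch: "chosen (inside E ?S) ?S (recent \<tau> p') = chosen E (Al p) (recent \<tau> p')"
    using chosen_local [of "recent \<tau> p'" "set (recent \<tau> p')" E "Al p"] by simp
  have K3: "proceed \<rho> (3, \<rho>, p', Al p, Ch p, v') = (4, \<rho>, p', Al p, Ch p', v')"
    using gathered [OF p'(2), of "Ch p"] alive_recent_resume(2) [OF pp', of \<tau> E "{..<n}"] p'(1)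
    by (simp add: proceed_def v'_def ch length_order)
  have K4: "proceed \<rho> (4, \<rho>, p', Al p, Ch p', v') = (if Al p' = {} then 5 else 1, \<rho>, p', Al p', Ch p', v')"
  proof -
    let ?y = "total \<rho> (4, \<rho>, p', Al p, Ch p', v')"
    have "Al p \<subseteq> {..<n}" by (rule alive_subset)
    \<comment> \<open>Phase 4 marks neighbors of all chosen vertices, old and new, so
      \<open>alive_eq\<close> applies to the whole history.\<close>
    then have "Al p - Ch p' - {q. 0 < ?y q} = Al p \<inter> ({..<n} - Ch p' - (\<Union>u\<in>Ch p'. neighbors E u))"
      using total_dead by blast
    also have "\<dots> = Al p \<inter> Al p'" using alive_eq [of E "{..<n}"] by simp
    also have "\<dots> = Al p'" using alive_recent_antimono [OF pp', of \<tau> E "{..<n}"] p'(1) by (auto simp: length_order)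
    finally show ?thesis by (simp add: proceed_def Let_def)
  qed
  have "(proceed \<rho> ^^ 4) K = proceed \<rho> (proceed \<rho> (proceed \<rho> (proceed \<rho> K)))"
    by (simp add: numeral_eq_Suc)
  then have "boundary p' ((proceed \<rho> ^^ 4) K)"
    unfolding K1 K2 K3 K4 using p'(1) by (auto simp: boundary_def)
  then show ?thesis using le by blast
qed

lemma iterate_finished: "finished K \<Longrightarrow> (proceed \<rho> ^^ t) K = K"
  by (induction t) (auto simp: proceed_def)

text \<open>Stage \<open>i + 1\<close> reaches at least \<open>r i\<close>: a protocol that is ahead
  has fewer alive vertices, so the next prescribed end is affordable. After \<open>I + 1\<close>
  stages all alive edges are affordable and one more stage runs to the end; the additional
  application distributes the sample.\<close>

lemma scheduled_finished:
  assumes "scheduled C n E I \<rho>"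
  defines "K \<equiv> (proceed \<rho> ^^ (1 + 4 * (I + 2))) (start_know n k)"
  shows "finished K \<and> maximal_independent_set n E (mis K)"
proof -
  define Ks where "Ks m = (proceed \<rho> ^^ (4 * m)) (proceed \<rho> (start_know n k))" for m
  have Ks_Suc: "Ks (Suc m) = (proceed \<rho> ^^ 4) (Ks m)" for m
    by (simp only: Ks_def mult_Suc_right funpow_add comp_apply)
  obtain r where r: "\<And>i. i \<le> I \<Longrightarrow> r i \<le> n"
    and r0: "2 * card (pairs E (set (recent \<rho> (r 0)))) \<le> C * n"
    and ri: "\<And>i. i < I \<Longrightarrow>
      2 * card (pairs E (alive E {..<n} (recent \<rho> (r i)) \<inter> set (recent \<rho> (r (Suc i))))) \<le> C * n"
    and rI: "2 * card (pairs E (alive E {..<n} (recent \<rho> (r I)))) \<le> C * n"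
    using assms unfolding scheduled_def by blast
  have len: "length \<rho> = n" using \<rho> by (simp add: seqs_def)
  have small: "load_of (Al p \<inter> X) \<le> C * n"
    if "Al p \<inter> X \<subseteq> T" "finite T" "2 * card (pairs E T) \<le> C * n" for p X T
  proof -
    have "Al p \<inter> X \<subseteq> {..<n}" using alive_subset [of E "{..<n}" "recent \<tau> p"] by blast
    then show ?thesis
      using load [of "Al p \<inter> X"] card_pairs_mono [OF that(1,2), of E] that(3) by linarith
  qed
  have Alr: "Al p \<subseteq> alive E {..<n} (recent \<rho> (r i))" if "i \<le> I" "r i \<le> p" "p \<le> 2 * n" for i p
    using alive_recent_antimono [OF that(2), of \<tau> E "{..<n}"] that(3) recent_order [OF len r [OF that(1)]]
    by (simp add: length_order)
  have finA: "finite (alive E {..<n} xs)" for xs by (rule finite_subset [OF alive_subset]) simp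
  have step: "\<exists>p'. boundary p' (Ks (Suc m)) \<and> (q \<le> p' \<or> finished (Ks (Suc m)))"
    if m: "boundary p (Ks m)" and q: "q \<le> 2 * n"
      and l: "\<not> finished (Ks m) \<Longrightarrow> load_of (Al p \<inter> set (recent \<tau> q)) \<le> C * n" for m p q
  proof (cases "finished (Ks m)")
    case True
    then have "Ks (Suc m) = Ks m" unfolding Ks_Suc by (rule iterate_finished)
    then show ?thesis using True m by auto
  next
    case False
    then show ?thesis using stage [OF m False] l q unfolding Ks_Suc by blast
  qed
  have reach: "\<exists>p. boundary p (Ks (Suc i)) \<and> (r i \<le> p \<or> finished (Ks (Suc i)))" if "i \<le> I" for i
    using that
  proof (induction i)
    case 0
    have "boundary 0 (Ks 0)" using proceed_start by (simp add: Ks_def)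
    moreover have "load_of (Al 0 \<inter> set (recent \<tau> (r 0))) \<le> C * n"
      by (rule small [OF _ _ r0]) (use recent_order [OF len r [of 0]] in auto)
    ultimately show ?case using step [of 0 0 "r 0"] r [of 0] by auto
  next
    case (Suc i)
    then obtain p where p: "boundary p (Ks (Suc i))" "r i \<le> p \<or> finished (Ks (Suc i))" by auto
    have "load_of (Al p \<inter> set (recent \<tau> (r (Suc i)))) \<le> C * n" if "\<not> finished (Ks (Suc i))"
    proof (rule small [OF _ _ ri [of i]])
      show "Al p \<inter> set (recent \<tau> (r (Suc i))) \<subseteq> alive E {..<n} (recent \<rho> (r i)) \<inter> set (recent \<rho> (r (Suc i)))"
        using Alr [of i p] p that Suc.prems recent_order [OF len r [OF Suc.prems]]
        by (auto simp: boundary_def)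
    qed (use Suc.prems in auto)
    moreover have "r (Suc i) \<le> 2 * n" using r [OF Suc.prems] by linarith
    ultimately show ?case using step [OF p(1)] by blast
  qed
  obtain p where p: "boundary p (Ks (Suc I))" "r I \<le> p \<or> finished (Ks (Suc I))"
    using reach [of I] by auto
  have "load_of (Al p \<inter> set (recent \<tau> (2 * n))) \<le> C * n" if "\<not> finished (Ks (Suc I))"
  proof (rule small [OF _ finA rI])
    show "Al p \<inter> set (recent \<tau> (2 * n)) \<subseteq> alive E {..<n} (recent \<rho> (r I))"
      using Alr [of I p] p that by (auto simp: boundary_def)
  qed
  then obtain p' where p': "boundary p' (Ks (Suc (Suc I)))" "2 * n \<le> p' \<or> finished (Ks (Suc (Suc I)))"
    using step [OF p(1) order_refl] by blast
  have KK: "K = Ks (Suc (Suc I))"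
  proof -
    have "1 + 4 * (I + 2) = 4 * Suc (Suc I) + 1" by simp
    then show ?thesis by (simp only: K_def Ks_def funpow_add comp_apply) simp
  qed
  \<comment> \<open>Reaching \<open>2 * n\<close> processes the appended list
    \<open>[0..<n]\<close>, which leaves no vertex alive even if the sample missed some.\<close>
  have "Al p' = {}"
  proof (cases "2 * n \<le> p'")
    case True
    then have "recent \<tau> p' = \<tau>" by (simp add: recent_def length_order)
    moreover have "{..<n} \<subseteq> set \<tau>" by (auto simp: order_def)
    ultimately show ?thesis
      using alive_disjoint [of E "{..<n}" \<tau>] alive_subset [of E "{..<n}" \<tau>] by auto
  next
    case False
    then show ?thesis using p' by (auto simp: boundary_def split: if_splits)
  qed
  then show ?thesis
    using p'(1) maximal_independent_chosen [OF E] unfolding KK boundary_def by auto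
qed

end

end

section \<open>Resources\<close>

lemma less_two_power_id_bits: "Suc n \<le> 2 ^ id_bits n"
proof -
  have "log 2 (real n + 1) \<le> real (id_bits n)"
    unfolding id_bits_def by linarith
  then have "real n + 1 \<le> 2 powr real (id_bits n)"
    by (simp add: log_le_iff)
  then have "real (Suc n) \<le> real (2 ^ id_bits n)"
    by (simp add: powr_realpow)
  then show ?thesis by (simp only: of_nat_le_iff)
qed

lemma id_bits_pos: "n \<ge> 1 \<Longrightarrow> id_bits n \<ge> 1"
  using less_two_power_id_bits [of n] by (cases "id_bits n") auto

lemma id_bits_le: "real (id_bits n) \<le> log 2 (real n + 1) + 1"
proof -
  have "0 \<le> log 2 (real n + 1)" by simp
  then show ?thesis unfolding id_bits_def by linarith
qed

text \<open>A subtotal is cubic in \<open>n\<close>, so four identifiers, with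
  \<open>(n + 1) ^ 4\<close> values, can hold it.\<close>

lemma words_le: "words n \<le> 2 ^ (4 * id_bits n)"
proof -
  have "words n \<le> Suc n ^ 4"
    by (simp add: words_def power4_eq_xxxx power3_eq_cube algebra_simps)
  also have "\<dots> \<le> (2 ^ id_bits n) ^ 4"
    using less_two_power_id_bits by (rule power_mono) simp
  also have "\<dots> = 2 ^ (4 * id_bits n)" by (simp add: power_mult [symmetric] mult.commute)
  finally show ?thesis .
qed

lemma card_seqs_words: "card (seqs (words n) m) \<le> 2 ^ (4 * id_bits n * m)"
  unfolding card_seqs power_mult [of 2 _ m] by (rule power_mono [OF words_le]) simp

lemma card_Times_le_power:
  "card A \<le> 2 ^ a \<Longrightarrow> card B \<le> 2 ^ b \<Longrightarrow> card (A \<times> B) \<le> 2 ^ (a + b)"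
  by (simp add: card_cartesian_product power_add mult_le_mono)

text \<open>A set of at most \<open>b\<close> elements is a list of \<open>b\<close> optional
  elements, padded with \<open>None\<close>.\<close>

lemma card_bounded_subsets:
  assumes "finite U"
  shows "card {F. F \<subseteq> U \<and> card F \<le> b} \<le> (card U + 1) ^ b"
proof -
  let ?L = "{xs. set xs \<subseteq> insert None (Some ` U) \<and> length xs = b}"
  have "{F. F \<subseteq> U \<and> card F \<le> b} \<subseteq> (\<lambda>xs. {x. Some x \<in> set xs}) ` ?L"
  proof
    fix F assume F: "F \<in> {F. F \<subseteq> U \<and> card F \<le> b}"
    then have "finite F" using finite_subset [OF _ assms] by simp
    then obtain xs where xs: "set xs = F" "distinct xs" using finite_distinct_list by blast
    let ?ys = "map Some xs @ replicate (b - length xs) None"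
    have "length xs \<le> b" using F xs distinct_card [OF xs(2)] by simp
    then have "?ys \<in> ?L" using F xs by auto
    moreover have "F = {x. Some x \<in> set ?ys}" using xs by auto
    ultimately show "F \<in> (\<lambda>xs. {x. Some x \<in> set xs}) ` ?L" by blast
  qed
  then have "card {F. F \<subseteq> U \<and> card F \<le> b} \<le> card ?L"
    using assms by (intro surj_card_le finite_lists_length_eq) auto
  also have "\<dots> = (card U + 1) ^ b"
    using assms by (subst card_lists_length_eq) (auto simp: card_image)
  finally show ?thesis .
qed

text \<open>Unordered pairs are about half as many as ordered ones, which saves one bit per edge
  against two identifiers. These spare bits make room for the rest of an MPC state.\<close>

lemma card_all_edges_power: "n \<ge> 1 \<Longrightarrow> card (all_edges n) + 1 \<le> 2 ^ (2 * id_bits n - 1)"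
proof -
  assume n: "n \<ge> 1"
  have "2 * (card (all_edges n) + 1) \<le> n * (n - 1) + 2"
    unfolding card_all_edges choose_two by simp
  also have "\<dots> \<le> Suc n * Suc n"
  proof -
    have "n * (n - 1) \<le> n * n" by (intro mult_le_mono2) simp
    moreover have "Suc n * Suc n = n * n + 2 * n + 1" by simp
    ultimately show ?thesis using n by linarith
  qed
  also have "\<dots> \<le> 2 ^ id_bits n * 2 ^ id_bits n"
    by (intro mult_le_mono less_two_power_id_bits)
  also have "\<dots> = 2 * 2 ^ (2 * id_bits n - 1)"
    using id_bits_pos [OF n] by (simp add: power_add [symmetric] mult_2 flip: power_Suc)
  finally show ?thesis by simp
qed

context execution
begin

lemma card_knows: "card (knows n k) \<le> 2 ^ (3 + (4 * id_bits n * n + (4 * id_bits n + (n + (n + 4 * id_bits n * k)))))"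
  unfolding knows_def
proof (intro card_Times_le_power card_seqs_words)
  show "card {..2 * n} \<le> 2 ^ (4 * id_bits n)"
  proof -
    have "2 * n \<le> 2 * n ^ 3" using n1 by (simp add: power3_eq_cube)
    then have "card {..2 * n} \<le> words n" by (simp add: words_def)
    then show ?thesis using words_le by (rule order_trans)
  qed
qed (simp_all add: card_Pow)

text \<open>Besides the \<open>a\<close> bits of input, \<open>C * n\<close> words cover the
  subtotals, up to rounding. The other \<open>11 * n\<close> words cover that rounding, the private
  and common samples, the counts of at most \<open>2 * n\<close> machines, the two vertex sets and
  the small fields.\<close>

lemma card_states:
  assumes "card (fam n) \<le> 2 ^ a"
  shows "card (states C fam n k) \<le> 2 ^ (a + 4 * id_bits n * (C + 11) * n)"
proof -
  let ?w = "4 * id_bits n" and ?m = "block C n k"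
  have "card (seqs n n) \<le> 2 ^ (?w * n)"
  proof -
    have "n * 1 \<le> n * (n * n)" using n1 by (intro mult_le_mono2) simp
    moreover have "words n = 2 * (n * (n * n)) + 1" by (simp add: words_def power3_eq_cube)
    ultimately have "n \<le> words n" by linarith
    then have "n ^ n \<le> words n ^ n" by (rule power_mono) simp
    then show ?thesis using card_seqs_words [of n n] by (simp only: card_seqs)
  qed
  moreover have "card (insert None (Some ` seqs (words n) ?m)) \<le> 2 ^ (1 + ?w * ?m)"
  proof -
    have "card (insert None (Some ` seqs (words n) ?m)) \<le> 1 + card (seqs (words n) ?m)"
      using card_insert_le_m1 by (simp add: card_insert_if card_image)
    also have "\<dots> \<le> 2 ^ (?w * ?m) + 2 ^ (?w * ?m)"
      by (intro add_mono card_seqs_words) simp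
    finally show ?thesis by simp
  qed
  ultimately have "card (states C fam n k)
      \<le> 2 ^ ((a + ?w * n) + ((3 + (?w * n + (?w + (n + (n + ?w * k))))) + (1 + ?w * ?m)))"
    unfolding states_def by (intro card_Times_le_power assms card_knows)
  also have "\<dots> \<le> 2 ^ (a + ?w * (C + 11) * n)"
  proof (rule power_increasing)
    have w: "?w \<ge> 4" using id_bits_pos [OF n1] by simp
    have "?m \<le> C * n + 1" by (simp add: block_def)
    then have m: "?w * ?m \<le> ?w * (C * n + 1)" by (rule mult_le_mono2)
    have k': "?w * k \<le> ?w * (2 * n)" using k(2) by (rule mult_le_mono2)
    have n': "4 * n \<le> ?w * n" using w by (rule mult_le_mono1)
    have w': "?w * 1 \<le> ?w * n" using n1 by (rule mult_le_mono2)
    have "?w * (C * n + 1) = ?w * C * n + ?w" "?w * (2 * n) = 2 * (?w * n)"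
      "?w * (C + 11) * n = ?w * C * n + 11 * (?w * n)" by (simp_all add: algebra_simps)
    then show "(a + ?w * n) + ((3 + (?w * n + (?w + (n + (n + ?w * k))))) + (1 + ?w * ?m)) \<le> a + ?w * (C + 11) * n"
      using m k' n' w' w by linarith
  qed simp
  finally show ?thesis .
qed

lemma length_message:
  assumes "\<rho> \<in> seqs n n" "K \<in> knows n k"
  shows "length (message protocol n k (full \<rho> K) i j) \<le> 4 * id_bits n * block C n k"
    and "length (message protocol n k (half \<rho> K) i j) \<le> 4 * id_bits n * block C n k"
proof -
  note len = length_code [OF finite_seqs _ card_seqs_words]
  consider "i < k" "j < k" | "\<not> (i < k \<and> j < k)" by blast
  then show "length (message protocol n k (full \<rho> K) i j) \<le> 4 * id_bits n * block C n k"
  proof cases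
    case 1
    then show ?thesis
      using len [OF words_mem [OF 1(1) assms(1)]] assms
      by (cases "finished K") (simp_all add: message_full message_finished)
  qed (auto simp: message_def)
  consider "i < k" "j < k" | "\<not> (i < k \<and> j < k)" by blast
  then show "length (message protocol n k (half \<rho> K) i j) \<le> 4 * id_bits n * block C n k"
  proof cases
    case 1
    then show ?thesis using len [OF subtotals_mem [OF assms(1)]] assms by (simp add: message_half)
  qed (auto simp: message_def)
qed

text \<open>The traffic of one machine per round in words: \<open>k\<close> blocks, where rounding
  adds \<open>k \<le> 2 * n\<close> words.\<close>

lemma block_total: "k * block C n k \<le> (C + 2) * n"
proof -
  have "k * block C n k = k * (C * n div k) + k" by (simp add: block_def)
  moreover have "k * (C * n div k) \<le> C * n" by (rule times_div_less_eq_dividend)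
  moreover have "(C + 2) * n = C * n + 2 * n" by (simp add: algebra_simps)
  ultimately show ?thesis using k by linarith
qed

end

section \<open>Number of rounds and success probability\<close>

definition levels :: "nat \<Rightarrow> nat" where
  "levels \<Delta> = (LEAST I. \<Delta> \<le> 2 ^ 2 ^ I)"

lemma double_exp_ge: "\<Delta> \<le> 2 ^ 2 ^ (\<Delta> :: nat)"
proof -
  have "\<Delta> \<le> 2 ^ \<Delta>" by (simp add: less_imp_le)
  also have "\<dots> \<le> 2 ^ 2 ^ \<Delta>" by (simp add: less_imp_le)
  finally show ?thesis .
qed

lemma levels: "\<Delta> \<le> 2 ^ 2 ^ levels \<Delta>" "levels \<Delta> \<le> \<Delta>"
  unfolding levels_def
  by (rule LeastI [of "\<lambda>I. \<Delta> \<le> 2 ^ 2 ^ I", OF double_exp_ge],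
      rule Least_le [of "\<lambda>I. \<Delta> \<le> 2 ^ 2 ^ I", OF double_exp_ge])

text \<open>Two rounds per summation: one summation for the sample and four for each of
  \<open>levels \<Delta> + 2\<close> stages.\<close>

definition rounds :: "nat \<Rightarrow> nat" where
  "rounds \<Delta> = 2 * (1 + 4 * (levels \<Delta> + 2))"

lemma rounds_bigo: "(\<lambda>\<Delta>. real (rounds \<Delta>)) \<in> O(\<lambda>\<Delta>. ln (ln (real \<Delta>)))"
proof -
  \<comment> \<open>\<open>26\<close> is the value of \<open>rounds\<close> at one level. Minimality
    of \<open>levels\<close> bounds the remaining \<open>j\<close> levels through
    \<open>2 ^ 2 ^ j < \<Delta>\<close>.\<close>
  define f where "f \<Delta> = 8 * (ln (ln (real \<Delta>)) - ln (ln 2)) / ln 2 + 26" for \<Delta> :: nat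
  have le: "real (rounds \<Delta>) \<le> f \<Delta>" if "\<Delta> \<ge> 3" for \<Delta>
  proof (cases "levels \<Delta>")
    case 0
    have "ln 2 \<le> ln (real \<Delta>)" using that by simp
    then have "ln (ln 2) \<le> ln (ln (real \<Delta>))" by (rule ln_mono) simp
    then show ?thesis using 0 by (simp add: rounds_def f_def)
  next
    case (Suc j)
    have "\<not> \<Delta> \<le> 2 ^ 2 ^ j"
      using not_less_Least [of j "\<lambda>I. \<Delta> \<le> 2 ^ 2 ^ I"] Suc by (simp add: levels_def)
    then have "real (2 ^ 2 ^ j) \<le> real \<Delta>" by (simp only: not_le of_nat_le_iff less_imp_le)
    then have "ln (real (2 ^ 2 ^ j)) \<le> ln (real \<Delta>)" by (rule ln_mono) simp
    then have "2 ^ j * ln 2 \<le> ln (real \<Delta>)" by (simp add: ln_realpow)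
    then have "ln (2 ^ j * ln 2) \<le> ln (ln (real \<Delta>))"
      by (rule ln_mono) simp
    then have "real j * ln 2 \<le> ln (ln (real \<Delta>)) - ln (ln 2)"
      by (simp add: ln_mult ln_realpow)
    then have "real j \<le> (ln (ln (real \<Delta>)) - ln (ln 2)) / ln 2" by (simp add: pos_le_divide_eq)
    moreover have "f \<Delta> = 8 * ((ln (ln (real \<Delta>)) - ln (ln 2)) / ln 2) + 26" by (simp add: f_def)
    moreover have "real (rounds \<Delta>) = 8 * real j + 26" by (simp add: rounds_def Suc)
    ultimately show ?thesis by linarith
  qed
  have "(\<lambda>\<Delta>. real (rounds \<Delta>)) \<in> O(f)"
  proof (rule bigoI [of _ 1])
    have "norm (real (rounds \<Delta>)) \<le> 1 * norm (f \<Delta>)" if "\<Delta> \<ge> 3" for \<Delta>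
      using le [OF that] by simp
    then show "eventually (\<lambda>\<Delta>. norm (real (rounds \<Delta>)) \<le> 1 * norm (f \<Delta>)) at_top"
      by (auto simp: eventually_at_top_linorder)
  qed
  also have "f \<in> O(\<lambda>\<Delta>. ln (ln (real \<Delta>)))"
    unfolding f_def by real_asymp
  finally show ?thesis .
qed

lemma card_neighbors_le_max_degree:
  assumes "v < n"
  shows "card (neighbors E v) \<le> max_degree n E"
  unfolding max_degree_def using assms by (intro Max_ge) auto

lemma max_degree_le:
  assumes "simple_graph n E" "n \<ge> 1"
  shows "max_degree n E \<le> n"
proof -
  have "card (neighbors E v) \<le> n" for v
  proof -
    have "u < n" if "{u, v} \<in> E" for u
      using bspec [OF assms(1) [unfolded simple_graph_def] that] by simp
    then have "neighbors E v \<subseteq> {..<n}" by (auto simp: neighbors_def)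
    from card_mono [OF _ this] show ?thesis by simp
  qed
  then show ?thesis
    unfolding max_degree_def using assms(2) by (subst Max_le_iff) (auto simp: lessThan_empty_iff)
qed

definition few_fail :: "nat \<Rightarrow> nat \<Rightarrow> bool" where
  "few_fail c C \<longleftrightarrow> C \<ge> 3 \<and> (\<forall>n\<ge>1. \<forall>E. simple_graph n E \<longrightarrow>
     freq n n (scheduled C n E (levels (max_degree n E))) \<ge> 1 - 1 / real n ^ c)"

lemma few_fail_exists: "\<exists>C. few_fail c C"
proof (rule freq_not_scheduled_poly [of c])
  fix C
  assume C: "C \<ge> 3"
    and fail: "\<And>n E I. n \<ge> 1 \<Longrightarrow> simple_graph n E \<Longrightarrow> I \<le> n \<Longrightarrow>
      (\<And>v. v < n \<Longrightarrow> card (neighbors E v) \<le> 2 ^ 2 ^ I) \<Longrightarrow>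
      freq n n (\<lambda>\<sigma>. \<not> scheduled C n E I \<sigma>) \<le> 1 / real n ^ c"
  have "freq n n (scheduled C n E (levels (max_degree n E))) \<ge> 1 - 1 / real n ^ c"
    if n: "n \<ge> 1" and E: "simple_graph n E" for n E
  proof -
    let ?I = "levels (max_degree n E)"
    have "freq n n (\<lambda>\<sigma>. \<not> scheduled C n E ?I \<sigma>) \<le> 1 / real n ^ c"
    proof (rule fail [OF n E])
      show "?I \<le> n" using levels(2) max_degree_le [OF E n] by (rule order_trans)
      show "card (neighbors E v) \<le> 2 ^ 2 ^ ?I" if "v < n" for v
        using card_neighbors_le_max_degree [OF that] levels(1) by (rule order_trans)
    qed
    then show ?thesis by (simp add: freq_compl [OF n])
  qed
  with C have "few_fail c C" by (simp add: few_fail_def)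
  then show "\<exists>C. few_fail c C" ..
qed

text \<open>The part shared by the two models, which differ in the resource limits, in the local
  edge sets and in how outputs are read.\<close>

lemma mis_prob:
  assumes "mis_execution C fam edges n k inp E" and "few_fail c C"
    and "\<And>\<rho> K. \<rho> \<in> seqs n n \<Longrightarrow> K \<in> knows n k \<Longrightarrow> ok (execution.conf C fam edges n k inp \<rho> K (\<lambda>_. None))"
    and "\<And>\<rho> K. \<rho> \<in> seqs n n \<Longrightarrow> K \<in> knows n k \<Longrightarrow>
      ok (execution.conf C fam edges n k inp \<rho> K (\<lambda>i. Some (execution.subtotals C edges n k inp \<rho> K i)))"
    and success: "\<And>s I. maximal_independent_set n E I \<Longrightarrow>
      (\<And>i. i < k \<Longrightarrow> result (mis_protocol C fam edges out) n k i (s i) = Some (out i I)) \<Longrightarrow> success s"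
  shows "measure_pmf.prob (run (mis_protocol C fam edges out) ok n k inp (rounds (max_degree n E)))
      (Some ` {s. success s}) \<ge> 1 - 1 / real n ^ c"
proof -
  interpret mis_execution C fam edges out n k inp E by fact
  have "1 - 1 / real n ^ c \<le> freq n n (scheduled C n E (levels (max_degree n E)))"
    using assms(2) n1 E by (auto simp: few_fail_def)
  also have "\<dots> \<le> measure_pmf.prob (run protocol ok n k inp (rounds (max_degree n E))) (Some ` {s. success s})"
    unfolding rounds_def
  proof (rule prob_run [OF assms(3,4)])
    fix \<rho> assume \<rho>: "\<rho> \<in> seqs n n" and sched: "scheduled C n E (levels (max_degree n E)) \<rho>"
    let ?K = "(proceed \<rho> ^^ (1 + 4 * (levels (max_degree n E) + 2))) (start_know n k)"
    have K: "?K \<in> knows n k" by (rule iterate_knows [OF \<rho>])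
    from scheduled_finished [OF \<rho> sched] have fin: "finished ?K" and mis: "maximal_independent_set n E (mis ?K)"
      by blast+
    show "success (full \<rho> ?K)"
      by (rule success [OF mis]) (rule result_full [OF \<rho> K _ fin])
  qed
  finally show ?thesis .
qed

text \<open>It has two roles: the bits of a state apart from its input, by
  \<open>card_states\<close>, and the number of edges that a machine may hold. As a list, that many
  edges fill \<open>mpc_memory\<close>; as a set, they leave one bit per edge, exactly enough for
  the other bits.\<close>

definition capacity :: "nat \<Rightarrow> nat \<Rightarrow> nat" where
  "capacity C n = 4 * id_bits n * (C + 11) * n"

definition mpc_memory :: "nat \<Rightarrow> nat \<Rightarrow> nat" where
  "mpc_memory C n = 2 * id_bits n * capacity C n"

text \<open>One of the two additional machines accounts for rounding, the other is machine 0, which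
  holds the vertices.\<close>

definition mpc_count :: "nat \<Rightarrow> nat \<Rightarrow> nat \<Rightarrow> nat" where
  "mpc_count C n m = m div capacity C n + 2"

definition mpc_family :: "nat \<Rightarrow> nat \<Rightarrow> nat set set set" where
  "mpc_family C n = {F. F \<subseteq> all_edges n \<and> card F \<le> capacity C n}"

abbreviation mpc_mis :: "nat \<Rightarrow> (nat set \<times> nat set set, nat set) protocol" where
  "mpc_mis C \<equiv> mis_protocol C (mpc_family C) (\<lambda>i. snd) (\<lambda>i I. I)"

lemma capacity_ge: "n \<ge> 1 \<Longrightarrow> n \<le> capacity C n"
  using id_bits_pos [of n] by (simp add: capacity_def)

lemma mpc_memory_bigo: "(\<lambda>n. real (mpc_memory C n)) \<in> O(\<lambda>n. real n * ln (real n) ^ 2)"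
proof -
  define a where "a = 8 * (real C + 11)"
  have a: "a > 0" by (simp add: a_def)
  have "(\<lambda>n. real (mpc_memory C n)) \<in> O(\<lambda>n. a * real n * (log 2 (real n + 1) + 1)\<^sup>2)"
  proof (rule bigoI [of _ 1], rule always_eventually, rule allI)
    fix n
    have "(real (id_bits n))\<^sup>2 \<le> (log 2 (real n + 1) + 1)\<^sup>2"
      by (intro power_mono id_bits_le) simp
    then have "a * real n * (real (id_bits n))\<^sup>2 \<le> a * real n * (log 2 (real n + 1) + 1)\<^sup>2"
      using a by (intro mult_left_mono) auto
    moreover have "real (mpc_memory C n) = a * real n * (real (id_bits n))\<^sup>2"
      by (simp add: mpc_memory_def capacity_def a_def power2_eq_square)
    ultimately show "norm (real (mpc_memory C n)) \<le> 1 * norm (a * real n * (log 2 (real n + 1) + 1)\<^sup>2)"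
      using a by simp
  qed
  also have "(\<lambda>n. a * real n * (log 2 (real n + 1) + 1)\<^sup>2) \<in> O(\<lambda>n. real n * ln (real n) ^ 2)"
    using a unfolding log_def by real_asymp
  finally show ?thesis .
qed

text \<open>Each machine holds at least \<open>n\<close> edges and there are fewer than
  \<open>n\<^sup>2 / 2\<close>, so the per-machine counts fit into a vector of \<open>O(n)\<close>
  words.\<close>

lemma mpc_count_le:
  assumes "n \<ge> 1" "m \<le> n choose 2"
  shows "mpc_count C n m \<le> 2 * n"
proof -
  have "m div capacity C n \<le> m div n"
    using capacity_ge [OF assms(1)] assms(1) by (intro div_le_mono2) auto
  also have "\<dots> \<le> (n * (n - 1) div 2) div n"
    using assms(2) unfolding choose_two by (rule div_le_mono)
  also have "\<dots> = (n - 1) div 2"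
    using assms(1) by (simp add: div_mult2_eq [symmetric] mult.commute [of 2])
  finally show ?thesis using assms(1) by (simp add: mpc_count_def)
qed

text \<open>The edges are numbered and cut into chunks of size \<open>capacity C n\<close>, placed
  on the machines from 1 on.\<close>

lemma mpc_machines_mpc:
  "mpc_machines (mpc_memory C) (mpc_count C)"
  unfolding mpc_machines_def
proof (intro conjI allI impI exI [of _ 2])
  fix n and E :: "nat set set"
  assume n: "n \<ge> 1" and E: "simple_graph n E"
  let ?B = "capacity C n"
  have B: "?B > 0" using capacity_ge [OF n, of C] n by linarith
  have fin: "finite E" using E finite_subset [OF _ finite_all_edges] by (simp add: simple_graph_all_edges)
  then obtain f where f: "bij_betw f E {0..<card E}" using ex_bij_betw_finite_nat by blast
  define pe where "pe e = 1 + f e div ?B" for e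
  have input: "input_bits n (card (fst (mpc_input n E (\<lambda>_. 0) pe i))) (card (snd (mpc_input n E (\<lambda>_. 0) pe i)))
      \<le> mpc_memory C n" for i
  proof -
    have "card (fst (mpc_input n E (\<lambda>_. 0) pe i)) + 2 * card (snd (mpc_input n E (\<lambda>_. 0) pe i)) \<le> 2 * ?B"
    proof (cases "i = 0")
      case True
      have "fst (mpc_input n E (\<lambda>_. 0) pe i) = {..<n}" "snd (mpc_input n E (\<lambda>_. 0) pe i) = {}"
        by (auto simp: mpc_input_def pe_def True)
      then show ?thesis using capacity_ge [OF n, of C] by simp
    next
      case False
      have "f ` {e \<in> E. pe e = i} \<subseteq> {(i - 1) * ?B..<(i - 1) * ?B + ?B}"
      proof (intro subsetI)
        fix t assume "t \<in> f ` {e \<in> E. pe e = i}"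
        then have "t div ?B = i - 1" by (auto simp: pe_def)
        moreover have "t = t div ?B * ?B + t mod ?B" by (rule div_mult_mod_eq [symmetric])
        moreover have "t mod ?B < ?B" using B by simp
        ultimately show "t \<in> {(i - 1) * ?B..<(i - 1) * ?B + ?B}" by simp
      qed
      then have "card (f ` {e \<in> E. pe e = i}) \<le> card {(i - 1) * ?B..<(i - 1) * ?B + ?B}"
        by (rule card_mono [rotated]) simp
      moreover have "card (f ` {e \<in> E. pe e = i}) = card {e \<in> E. pe e = i}"
        using f by (intro card_image) (auto simp: bij_betw_def intro: inj_on_subset)
      moreover have "{v. v < n \<and> (0::nat) = i} = {}" using False by simp
      ultimately show ?thesis using False by (simp add: mpc_input_def)
    qed
    then show ?thesis
      unfolding input_bits_def mpc_memory_def by (simp add: mult_le_mono1 mult.commute mult.left_commute)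
  qed
  have "pe e < mpc_count C n (card E)" if "e \<in> E" for e
  proof -
    have "f e < card E" using f that by (auto simp: bij_betw_def)
    then have "f e div ?B \<le> card E div ?B" by (intro div_le_mono) simp
    then show ?thesis by (simp add: pe_def mpc_count_def)
  qed
  then have "mpc_placement (mpc_memory C n) n (mpc_count C n (card E)) E (\<lambda>_. 0) pe"
    using input by (simp add: mpc_placement_def mpc_count_def)
  then show "\<exists>pv pe. mpc_placement (mpc_memory C n) n (mpc_count C n (card E)) E pv pe" by blast
next
  fix n m :: nat
  assume "n \<ge> 1" "m \<le> n choose 2"
  have "m div capacity C n * capacity C n \<le> m" by simp
  then have "2 * id_bits n * (m div capacity C n * capacity C n) \<le> 2 * id_bits n * m"
    by (rule mult_le_mono2)
  also have "2 * id_bits n * m \<le> 2 * input_bits n n m"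
    by (simp add: input_bits_def algebra_simps)
  finally have "2 * id_bits n * (m div capacity C n * capacity C n) + 2 * mpc_memory C n
      \<le> 2 * input_bits n n m + 2 * mpc_memory C n"
    by (rule add_right_mono)
  also have "2 * id_bits n * (m div capacity C n * capacity C n) + 2 * mpc_memory C n
      = mpc_count C n m * mpc_memory C n"
    unfolding mpc_count_def distrib_right by (simp only: mpc_memory_def mult_ac)
  finally show "mpc_count C n m * mpc_memory C n \<le> 2 * (input_bits n n m + mpc_memory C n)"
    by (simp only: distrib_left)
qed

lemma card_inside_le_pairs:
  assumes "simple_graph n E" "finite S"
  shows "card (inside E S) \<le> card (pairs E S)"
proof (rule surj_card_le [OF finite_pairs [OF assms(2)]])
  show "inside E S \<subseteq> (\<lambda>(u, v). {u, v}) ` pairs E S"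
  proof
    fix e assume e: "e \<in> inside E S"
    then have "card e = 2" using assms(1) by (auto simp: inside_def simple_graph_def)
    then obtain u v where "e = {u, v}" by (auto simp: card_2_iff)
    then show "e \<in> (\<lambda>(u, v). {u, v}) ` pairs E S"
      using e by (force simp: inside_def pairs_def)
  qed
qed

lemma mpc_execution:
  assumes n: "n \<ge> 1" and C: "C \<ge> 3" and E: "simple_graph n E"
    and place: "mpc_placement (mpc_memory C n) n (mpc_count C n (card E)) E pv pe"
  shows "mis_execution C (mpc_family C) (\<lambda>i. snd) n (mpc_count C n (card E)) (mpc_input n E pv pe) E"
proof
  let ?k = "mpc_count C n (card E)"
  have fin: "finite E" and sub: "E \<subseteq> all_edges n"
    using E finite_subset [OF _ finite_all_edges] by (simp_all add: simple_graph_all_edges)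
  have m: "card E \<le> n choose 2"
    using card_mono [OF finite_all_edges sub] by (simp add: card_all_edges)
  show "1 \<le> ?k" by (simp add: mpc_count_def)
  show "?k \<le> 2 * n" by (rule mpc_count_le [OF n m])
  show "mpc_family C n \<subseteq> Pow (all_edges n)" by (auto simp: mpc_family_def)
  show "snd (mpc_input n E pv pe i) \<in> mpc_family C n" if "i < ?k" for i
  proof -
    \<comment> \<open>Dividing the size limit of the placement by \<open>2 * id_bits n\<close>
      bounds the number of edges on the machine.\<close>
    have "input_bits n (card (fst (mpc_input n E pv pe i))) (card (snd (mpc_input n E pv pe i))) \<le> mpc_memory C n"
      using place that by (simp add: mpc_placement_def)
    then have "(card (fst (mpc_input n E pv pe i)) + 2 * card (snd (mpc_input n E pv pe i))) * id_bits n
        \<le> 2 * capacity C n * id_bits n"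
      by (simp add: input_bits_def mpc_memory_def mult.commute mult.left_commute)
    then have "card (fst (mpc_input n E pv pe i)) + 2 * card (snd (mpc_input n E pv pe i)) \<le> 2 * capacity C n"
      using id_bits_pos [OF n] by simp
    then have "card (snd (mpc_input n E pv pe i)) \<le> capacity C n" by linarith
    then show ?thesis using sub by (auto simp: mpc_family_def mpc_input_def)
  qed
  show "(\<Union>i<?k. snd (mpc_input n E pv pe i)) = E"
    using place by (auto simp: mpc_placement_def mpc_input_def)
  show "(\<Sum>i<?k. card (inside (snd (mpc_input n E pv pe i)) S)) \<le> 2 * card (pairs E S)"
    if S: "S \<subseteq> {..<n}" for S
  proof -
    have "(\<Sum>i<?k. card (inside (snd (mpc_input n E pv pe i)) S))
        = card (\<Union>i<?k. inside (snd (mpc_input n E pv pe i)) S)"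
      using fin by (intro card_UN_disjoint [symmetric]) (auto simp: inside_def mpc_input_def)
    also have "\<dots> \<le> card (inside E S)"
      using fin by (intro card_mono) (auto simp: inside_def mpc_input_def)
    also have "\<dots> \<le> card (pairs E S)"
      using E finite_subset [OF S] by (intro card_inside_le_pairs) auto
    finally show ?thesis by simp
  qed
qed (use n C E in auto)

lemma mpc_ok_conf:
  fixes inp :: "nat \<Rightarrow> nat set \<times> nat set set"
  assumes "mis_execution C (mpc_family C) (\<lambda>i. snd) n k inp E"
    and "\<rho> \<in> seqs n n" "K \<in> knows n k"
  shows "mpc_ok (mpc_mis C) (mpc_memory C n) n k
      (execution.conf C (mpc_family C) (\<lambda>i. snd) n k inp \<rho> K (\<lambda>_. None))"
    and "mpc_ok (mpc_mis C) (mpc_memory C n) n k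
      (execution.conf C (mpc_family C) (\<lambda>i. snd) n k inp \<rho> K
        (\<lambda>i. Some (execution.subtotals C (\<lambda>i. snd) n k inp \<rho> K i)))"
proof -
  interpret mis_execution C "mpc_family C" "\<lambda>i. snd" "\<lambda>i I. I" n k inp E by fact
  let ?L = "id_bits n" and ?B = "capacity C n"
  have L: "?L \<ge> 1" by (rule id_bits_pos [OF n1])
  have "card (mpc_family C n) \<le> (card (all_edges n) + 1) ^ ?B"
    unfolding mpc_family_def by (rule card_bounded_subsets) simp
  also have "\<dots> \<le> (2 ^ (2 * ?L - 1)) ^ ?B"
    by (rule power_mono [OF card_all_edges_power [OF n1]]) simp
  also have "\<dots> = 2 ^ ((2 * ?L - 1) * ?B)" by (simp add: power_mult)
  finally have "card (states C (mpc_family C) n k) \<le> 2 ^ ((2 * ?L - 1) * ?B + ?B)"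
    using card_states unfolding capacity_def by blast
  \<comment> \<open>The edge set takes \<open>(2 * ?L - 1) * ?B\<close> bits and the rest of the
    state \<open>?B\<close> bits; together they fill the memory exactly.\<close>
  also have "(2 * ?L - 1) * ?B + ?B = mpc_memory C n"
  proof -
    have "(2 * ?L - 1) * ?B + ?B = (2 * ?L - 1 + 1) * ?B" by (simp only: distrib_right mult_1)
    also have "2 * ?L - 1 + 1 = 2 * ?L" using L by simp
    finally show ?thesis by (simp only: mpc_memory_def)
  qed
  finally have states: "card (states C (mpc_family C) n k) \<le> 2 ^ mpc_memory C n" .
  have traffic: "k * (4 * ?L * block C n k) \<le> mpc_memory C n"
  proof -
    have "k * (4 * ?L * block C n k) = 4 * ?L * (k * block C n k)" by simp
    also have "\<dots> \<le> 4 * ?L * ((C + 2) * n)" by (rule mult_le_mono2 [OF block_total])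
    also have "\<dots> \<le> 1 * ?B" by (simp add: capacity_def algebra_simps)
    also have "\<dots> \<le> mpc_memory C n" unfolding mpc_memory_def using L by (intro mult_le_mono1) simp
    finally show ?thesis .
  qed
  have ok: "mpc_ok (mpc_mis C) (mpc_memory C n) n k s"
    if "\<And>i. i < k \<Longrightarrow> length (s i) \<le> mpc_memory C n"
      "\<And>i j. length (message (mpc_mis C) n k s i j) \<le> 4 * ?L * block C n k" for s
  proof -
    have "(\<Sum>j<k. f j) \<le> mpc_memory C n" if "\<And>j. f j \<le> 4 * ?L * block C n k" for f :: "nat \<Rightarrow> nat"
    proof -
      have "(\<Sum>j<k. f j) \<le> (\<Sum>j<k. 4 * ?L * block C n k)" using that by (rule sum_mono)
      then show ?thesis using traffic by simp
    qed
    then show ?thesis using that by (simp add: mpc_ok_def)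
  qed
  show "mpc_ok (mpc_mis C) (mpc_memory C n) n k (full \<rho> K)"
    by (rule ok [OF _ length_message(1) [OF assms(2,3)]])
      (use assms(2,3) in \<open>simp add: conf_def length_code [OF finite_states full_mem states]\<close>)
  show "mpc_ok (mpc_mis C) (mpc_memory C n) n k (half \<rho> K)"
    by (rule ok [OF _ length_message(2) [OF assms(2,3)]])
      (use assms(2,3) in \<open>simp add: conf_def length_code [OF finite_states half_mem states]\<close>)
qed

section \<open>The congested clique and the main theorem\<close>

definition edges_at :: "nat \<Rightarrow> nat set \<Rightarrow> nat set set" where
  "edges_at v N = (\<lambda>u. {u, v}) ` N"

abbreviation clique_mis :: "nat \<Rightarrow> (nat set, bool) protocol" where
  "clique_mis C \<equiv> mis_protocol C (\<lambda>n. Pow (all_edges n)) edges_at (\<lambda>v I. v \<in> I)"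

text \<open>Player \<open>v\<close> in \<open>S\<close> counts the edges inside \<open>S\<close> at
  \<open>v\<close>, so summing over the players counts ordered pairs.\<close>

lemma clique_execution:
  assumes n: "n \<ge> 1" and C: "C \<ge> 3" and E: "simple_graph n E"
  shows "mis_execution C (\<lambda>n. Pow (all_edges n)) edges_at n n (neighbors E) E"
proof
  show "edges_at v (neighbors E v) \<in> Pow (all_edges n)" for v
    using E by (auto simp: simple_graph_all_edges edges_at_def neighbors_def)
  show "(\<Union>v<n. edges_at v (neighbors E v)) = E"
  proof (intro equalityI subsetI)
    fix e assume e: "e \<in> E"
    then have "e \<subseteq> {..<n}" "card e = 2" using E by (auto simp: simple_graph_def)
    then obtain u v where "e = {u, v}" "v < n" by (auto simp: card_2_iff)
    then show "e \<in> (\<Union>v<n. edges_at v (neighbors E v))"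
      using e by (auto simp: edges_at_def neighbors_def)
  qed (auto simp: edges_at_def neighbors_def)
  show "(\<Sum>v<n. card (inside (edges_at v (neighbors E v)) S)) \<le> 2 * card (pairs E S)"
    if S: "S \<subseteq> {..<n}" for S
  proof -
    have fin: "finite S" using S by (rule finite_subset) simp
    have "card (inside (edges_at v (neighbors E v)) S) \<le> (if v \<in> S then deg E S v else 0)" for v
    proof (cases "v \<in> S")
      case True
      have "inside (edges_at v (neighbors E v)) S \<subseteq> (\<lambda>u. {u, v}) ` (S \<inter> neighbors E v)"
        by (auto simp: inside_def edges_at_def)
      then show ?thesis using True fin by (simp add: surj_card_le)
    next
      case False
      then have "inside (edges_at v (neighbors E v)) S = {}" by (auto simp: inside_def edges_at_def)
      then show ?thesis by simp
    qed
    then have "(\<Sum>v<n. card (inside (edges_at v (neighbors E v)) S)) \<le> (\<Sum>v<n. if v \<in> S then deg E S v else 0)"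
      by (rule sum_mono)
    also have "\<dots> = card (pairs E S)"
      using S by (simp add: card_pairs [OF fin] sum.If_cases Int_absorb1)
    finally show ?thesis by simp
  qed
qed (use n C E in auto)

text \<open>With one machine per vertex a block has \<open>C + 1\<close> words, hence
  \<open>O(log n)\<close> bits.\<close>

lemma clique_ok_conf:
  assumes "mis_execution C fam edges n n inp E" and "\<rho> \<in> seqs n n" "K \<in> knows n n"
  shows "clique_ok (mis_protocol C fam edges out) (4 * (C + 1) * id_bits n) n
      (execution.conf C fam edges n n inp \<rho> K (\<lambda>_. None))"
    and "clique_ok (mis_protocol C fam edges out) (4 * (C + 1) * id_bits n) n
      (execution.conf C fam edges n n inp \<rho> K (\<lambda>i. Some (execution.subtotals C edges n n inp \<rho> K i)))"
proof -
  interpret mis_execution C fam edges out n n inp E by fact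
  have "block C n n = C + 1" using n1 by (simp add: block_def)
  then show "clique_ok protocol (4 * (C + 1) * id_bits n) n (full \<rho> K)"
    and "clique_ok protocol (4 * (C + 1) * id_bits n) n (half \<rho> K)"
    using length_message [OF assms(2,3)] by (simp_all add: clique_ok_def mult.commute mult.left_commute)
qed

lemma clique_bits_bigo: "(\<lambda>n. real (4 * (C + 1) * id_bits n)) \<in> O(\<lambda>n. ln (real n))"
proof -
  define a where "a = 4 * (real C + 1)"
  have a: "a > 0" by (simp add: a_def)
  have "(\<lambda>n. real (4 * (C + 1) * id_bits n)) \<in> O(\<lambda>n. a * (log 2 (real n + 1) + 1))"
  proof (rule bigoI [of _ 1], rule always_eventually, rule allI)
    fix n
    have "a * real (id_bits n) \<le> a * (log 2 (real n + 1) + 1)"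
      using a id_bits_le by (intro mult_left_mono) auto
    moreover have eq: "real (4 * (C + 1) * id_bits n) = a * real (id_bits n)" by (simp add: a_def)
    ultimately show "norm (real (4 * (C + 1) * id_bits n)) \<le> 1 * norm (a * (log 2 (real n + 1) + 1))"
      unfolding eq using a by simp
  qed
  also have "(\<lambda>n. a * (log 2 (real n + 1) + 1)) \<in> O(\<lambda>n. ln (real n))"
    using a unfolding log_def by real_asymp
  finally show ?thesis .
qed

lemma mpc_mis_prob_ge:
  assumes "few_fail c C" and n: "n \<ge> 1" and E: "simple_graph n E"
    and place: "mpc_placement (mpc_memory C n) n (mpc_count C n (card E)) E pv pe"
  shows "mpc_mis_prob (mpc_mis C) (mpc_memory C n) n (mpc_count C n (card E)) E pv pe
    (rounds (max_degree n E)) \<ge> 1 - 1 / real n ^ c"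
proof -
  let ?k = "mpc_count C n (card E)"
  have exec: "mis_execution C (mpc_family C) (\<lambda>i. snd) n ?k (mpc_input n E pv pe) E"
    using assms by (intro mpc_execution) (simp_all add: few_fail_def)
  show ?thesis
    unfolding mpc_mis_prob_def
  proof (rule mis_prob [OF exec assms(1) mpc_ok_conf [OF exec]])
    fix s I
    assume I: "maximal_independent_set n E I"
      and res: "\<And>i. i < ?k \<Longrightarrow> result (mpc_mis C) n ?k i (s i) = Some I"
    have "?k > 0" by (simp add: mpc_count_def)
    then have "(\<Union>i<?k. the (result (mpc_mis C) n ?k i (s i))) = I" using res by auto
    then show "mpc_success (mpc_mis C) n ?k E s"
      using I res by (simp add: mpc_success_def halted_def)
  qed
qed

lemma clique_mis_prob_ge:
  assumes "few_fail c C" and n: "n \<ge> 1" and E: "simple_graph n E"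
  shows "clique_mis_prob (clique_mis C) (4 * (C + 1) * id_bits n) n E (rounds (max_degree n E))
    \<ge> 1 - 1 / real n ^ c"
proof -
  have exec: "mis_execution C (\<lambda>n. Pow (all_edges n)) edges_at n n (neighbors E) E"
    using assms by (intro clique_execution) (simp_all add: few_fail_def)
  show ?thesis
    unfolding clique_mis_prob_def
  proof (rule mis_prob [OF exec assms(1) clique_ok_conf [OF exec]])
    fix s I
    assume I: "maximal_independent_set n E I"
      and res: "\<And>v. v < n \<Longrightarrow> result (clique_mis C) n n v (s v) = Some (v \<in> I)"
    have "I \<subseteq> {..<n}" using I by (simp add: maximal_independent_set_def independent_set_def)
    then have "{v. v < n \<and> result (clique_mis C) n n v (s v) = Some True} = I" using res by auto
    then show "clique_success (clique_mis C) n E s"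
      using I res by (simp add: clique_success_def halted_def)
  qed
qed

theorem theorem1p1:
  shows
    "(\<forall>c::nat. \<exists>(A :: (nat set \<times> nat set set, nat set) protocol)
          (S :: nat \<Rightarrow> nat) (M :: nat \<Rightarrow> nat \<Rightarrow> nat) (T :: nat \<Rightarrow> nat).
        (\<exists>q::nat. (\<lambda>n. real (S n)) \<in> O(\<lambda>n. real n * ln (real n) ^ q)) \<and>
        mpc_machines S M \<and>
        (\<lambda>\<Delta>. real (T \<Delta>)) \<in> O(\<lambda>\<Delta>. ln (ln (real \<Delta>))) \<and>
        (\<forall>n\<ge>1. \<forall>E pv pe. simple_graph n E \<longrightarrow> mpc_placement (S n) n (M n (card E)) E pv pe \<longrightarrow>
           mpc_mis_prob A (S n) n (M n (card E)) E pv pe (T (max_degree n E))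
             \<ge> 1 - 1 / real n ^ c))
     \<and>
     (\<forall>c::nat. \<exists>(A :: (nat set, bool) protocol) (b :: nat \<Rightarrow> nat) (T :: nat \<Rightarrow> nat).
        (\<lambda>n. real (b n)) \<in> O(\<lambda>n. ln (real n)) \<and>
        (\<lambda>\<Delta>. real (T \<Delta>)) \<in> O(\<lambda>\<Delta>. ln (ln (real \<Delta>))) \<and>
        (\<forall>n\<ge>1. \<forall>E. simple_graph n E \<longrightarrow>
           clique_mis_prob A (b n) n E (T (max_degree n E)) \<ge> 1 - 1 / real n ^ c))"
proof (intro conjI allI)
  fix c :: nat
  obtain C where C: "few_fail c C" using few_fail_exists by blast
  show "\<exists>(A :: (nat set \<times> nat set set, nat set) protocol)
          (S :: nat \<Rightarrow> nat) (M :: nat \<Rightarrow> nat \<Rightarrow> nat) (T :: nat \<Rightarrow> nat).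
        (\<exists>q::nat. (\<lambda>n. real (S n)) \<in> O(\<lambda>n. real n * ln (real n) ^ q)) \<and>
        mpc_machines S M \<and>
        (\<lambda>\<Delta>. real (T \<Delta>)) \<in> O(\<lambda>\<Delta>. ln (ln (real \<Delta>))) \<and>
        (\<forall>n\<ge>1. \<forall>E pv pe. simple_graph n E \<longrightarrow> mpc_placement (S n) n (M n (card E)) E pv pe \<longrightarrow>
           mpc_mis_prob A (S n) n (M n (card E)) E pv pe (T (max_degree n E))
             \<ge> 1 - 1 / real n ^ c)"
    \<comment> \<open>The exponent 2 arises because the \<open>n log n\<close> bits of working state
      use one spare bit per edge: a machine must have room for that many edges, each of
      \<open>2 * id_bits n\<close> bits.\<close>
    by (intro exI [of _ "mpc_mis C"] exI [of _ "mpc_memory C"] exI [of _ "mpc_count C"] exI [of _ rounds]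
        conjI allI impI exI [of _ 2] mpc_memory_bigo mpc_machines_mpc rounds_bigo mpc_mis_prob_ge [OF C])
  show "\<exists>(A :: (nat set, bool) protocol) (b :: nat \<Rightarrow> nat) (T :: nat \<Rightarrow> nat).
        (\<lambda>n. real (b n)) \<in> O(\<lambda>n. ln (real n)) \<and>
        (\<lambda>\<Delta>. real (T \<Delta>)) \<in> O(\<lambda>\<Delta>. ln (ln (real \<Delta>))) \<and>
        (\<forall>n\<ge>1. \<forall>E. simple_graph n E \<longrightarrow>
           clique_mis_prob A (b n) n E (T (max_degree n E)) \<ge> 1 - 1 / real n ^ c)"
    by (intro exI [of _ "clique_mis C"] exI [of _ "\<lambda>n. 4 * (C + 1) * id_bits n"] exI [of _ rounds]
        conjI allI impI clique_bits_bigo rounds_bigo clique_mis_prob_ge [OF C])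
qed

end
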